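(* Let $n,d\ge1$ and $p\ge 2d+1$ be integers. Let $\Delta\in\mathbb{R}^{nd\times nd}$ be symmetric with $d\times d$ blocks $\Delta_{ij}$, $\Delta_{ji}=\Delta_{ij}^{\top}$, $\Delta_{ii}=0$; let $Z^{\top}=[I_d,\dots,I_d]\in\mathbb{R}^{d\times nd}$ and $A=ZZ^{\top}+\Delta$ (so $A_{ij}=I_d+\Delta_{ij}$). Let $\Delta_i^{\top}=[\Delta_{i1},\dots,\Delta_{in}]$ be the $i$-th block row of $\Delta$ (so $\Delta_i^{\top}Z=\sum_j\Delta_{ij}$), let $\mathrm{Tr}_d(\Delta)=[\mathrm{Tr}(\Delta_{ij})]_{i,j}\in\mathbb{R}^{n\times n}$ be the partial trace, and set \[ \gamma=\frac{\|\mathrm{Tr}_d(\Delta)\|_{\mathrm{op}}}{\|\Delta\|_{\mathrm{op}}}\vee 1,\qquad \delta=\frac{(2+\sqrt5)(p+d)\gamma}{p-2d}. \] Consider $f(S)=\langle A,SS^{\top}\rangle=\sum_{i,j}\langle A_{ij},S_iS_j^{\top}\rangle$ on the set of $S\in\mathbb{R}^{nd\times p}$ with $d\times p$ blocks $S_i$ satisfying $S_iS_i^{\top}=I_d$ for all $i$. If \[ n\ \ge\ \frac{3\delta^2 d\|\Delta\|_{\mathrm{op}}^2}{2n}+\delta\sqrt{\frac{d}{n}}\,\|\Delta\|_{\mathrm{op}}\max_{1\le i\le n}\|\Delta_i\|_{\mathrm{op}}+\max_{1\le i\le n}\|\Delta_i^{\top}Z\|_{\mathrm{op}}+\|\Delta\|_{\mathrm{op}},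 \] then $f$ has a unique local maximizer (up to replacing $S$ by $SU$ with $U\in O(p)$, i.e. all local maximizers give the same matrix $SS^{\top}$), which is the global maximizer; moreover $SS^{\top}$ is the global maximizer of the SDP $\max\{\langle A,X\rangle: X\succeq0,\ X_{ii}=I_d\}$ and has rank exactly $d$.
   Context: $\langle X,Y\rangle=\mathrm{Tr}(XY^{\top})$, $\|\cdot\|_{\mathrm{op}}$ is the spectral norm, $a\vee b=\max\{a,b\}$, $O(p)$ is the orthogonal group. This is the Burer–Monteiro formulation of orthogonal group synchronization $A_{ij}=G_iG_j^{\top}+\Delta_{ij}$, written (as throughout the paper) in coordinates where the ground truth is $G_i=I_d$. *)

theory Defs
  imports Complex_Main "Jordan_Normal_Form.Matrix" "Jordan_Normal_Form.DL_Rank"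
begin

definition mtrace :: "real mat \<Rightarrow> real" where
  "mtrace M = (\<Sum>i<dim_row M. M $$ (i, i))"

definition frob_inner :: "real mat \<Rightarrow> real mat \<Rightarrow> real" where
  "frob_inner X Y = mtrace (X * transpose_mat Y)"

definition frob_norm :: "real mat \<Rightarrow> real" where
  "frob_norm X = sqrt (frob_inner X X)"

definition vnorm :: "real vec \<Rightarrow> real" where
  "vnorm v = sqrt (v \<bullet> v)"

definition op_norm :: "real mat \<Rightarrow> real" where
  "op_norm M = Sup {vnorm (M *\<^sub>v x) | x. x \<in> carrier_vec (dim_col M) \<and> vnorm x \<le> 1}"

definition blk :: "nat \<Rightarrow> real mat \<Rightarrow> nat \<Rightarrow> nat \<Rightarrow> real mat" where
  "blk d M i j = mat d d (\<lambda>(a, b). M $$ (i * d + a, j * d + b))"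

definition rowblk :: "nat \<Rightarrow> real mat \<Rightarrow> nat \<Rightarrow> real mat" where
  "rowblk d M i = mat d (dim_col M) (\<lambda>(a, b). M $$ (i * d + a, b))"

(* Z^T = [I_d, ..., I_d], Z is nd x d *)
definition Zmat :: "nat \<Rightarrow> nat \<Rightarrow> real mat" where
  "Zmat n d = mat (n * d) d (\<lambda>(a, b). if a mod d = b then 1 else 0)"

definition partial_trace :: "nat \<Rightarrow> nat \<Rightarrow> real mat \<Rightarrow> real mat" where
  "partial_trace n d M = mat n n (\<lambda>(i, j). mtrace (blk d M i j))"

definition BM_set :: "nat \<Rightarrow> nat \<Rightarrow> nat \<Rightarrow> real mat set" where
  "BM_set n d p = {S. S \<in> carrier_mat (n * d) p \<and>
      (\<forall>i<n. rowblk d S i * transpose_mat (rowblk d S i) = 1\<^sub>m d)}"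

definition BM_obj :: "real mat \<Rightarrow> real mat \<Rightarrow> real" where
  "BM_obj A S = frob_inner A (S * transpose_mat S)"

definition BM_local_max :: "nat \<Rightarrow> nat \<Rightarrow> nat \<Rightarrow> real mat \<Rightarrow> real mat \<Rightarrow> bool" where
  "BM_local_max n d p A S \<longleftrightarrow> S \<in> BM_set n d p \<and>
     (\<exists>\<epsilon>>0. \<forall>S'\<in>BM_set n d p. frob_norm (S' - S) < \<epsilon> \<longrightarrow> BM_obj A S' \<le> BM_obj A S)"

definition BM_global_max :: "nat \<Rightarrow> nat \<Rightarrow> nat \<Rightarrow> real mat \<Rightarrow> real mat \<Rightarrow> bool" where
  "BM_global_max n d p A S \<longleftrightarrow> S \<in> BM_set n d p \<and>
     (\<forall>S'\<in>BM_set n d p. BM_obj A S' \<le> BM_obj A S)"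

definition psd :: "real mat \<Rightarrow> bool" where
  "psd X \<longleftrightarrow> X \<in> carrier_mat (dim_row X) (dim_row X) \<and> transpose_mat X = X \<and>
     (\<forall>x \<in> carrier_vec (dim_row X). x \<bullet> (X *\<^sub>v x) \<ge> 0)"

definition SDP_set :: "nat \<Rightarrow> nat \<Rightarrow> real mat set" where
  "SDP_set n d = {X. X \<in> carrier_mat (n * d) (n * d) \<and> psd X \<and> (\<forall>i<n. blk d X i i = 1\<^sub>m d)}"

definition SDP_max :: "nat \<Rightarrow> nat \<Rightarrow> real mat \<Rightarrow> real mat \<Rightarrow> bool" where
  "SDP_max n d A X \<longleftrightarrow> X \<in> SDP_set n d \<and> (\<forall>Y\<in>SDP_set n d. frob_inner A Y \<le> frob_inner A X)"

definition mrank :: "real mat \<Rightarrow> nat" where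
  "mrank X = vec_space.rank (dim_row X) X"

end

theory Submission
  imports Defs "HOL-Analysis.L2_Norm" "HOL-Analysis.Function_Topology" "HOL-Real_Asymp.Real_Asymp"
    "Jordan_Normal_Form.Determinant"
begin

text \<open>
  Write \<open>G = A S\<close>, \<open>V = Z\<^sup>T S\<close> and \<open>L\<^sub>i = G\<^sub>i S\<^sub>i\<^sup>T\<close>. At a local maximizer \<open>G\<^sub>i = L\<^sub>i S\<^sub>i\<close> with \<open>L\<^sub>i\<close> symmetric
  positive semidefinite. Summing the second-order condition over the tangent vectors
  \<open>E\<^sub>k\<^sub>l (I - S\<^sub>i\<^sup>T S\<^sub>i)\<close>, where \<open>E\<^sub>k\<^sub>l\<close> runs over the matrix units, gives
  \<open>(p - d) tr L \<ge> \<Sum>\<^sub>i\<^sub>j tr A\<^sub>i\<^sub>j (p - 2d + |S\<^sub>i S\<^sub>j\<^sup>T|\<^sup>2)\<close>. The first-order condition bounds \<open>|S S\<^sup>T|\<^sup>2\<close> from below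
  by \<open>|V|\<^sup>2 - d |\<Delta>|\<^sup>2\<close>, and together these force \<open>S\<close> to be close to \<open>Z S\<^sub>k\<close> for some block \<open>k\<close>, which is found
  by averaging over \<open>k\<close>; no polar decomposition is needed.

  Since \<open>L\<^sub>i\<^sup>2 = G\<^sub>i G\<^sub>i\<^sup>T\<close>, closeness makes \<open>L\<^sub>i\<close> larger than \<open>|\<Delta>|\<close>, so \<open>M = L - A\<close> is positive definite on the
  kernel of \<open>Z\<^sup>T\<close>; as \<open>M S = 0\<close> and \<open>V S\<^sub>k\<^sup>T\<close> is invertible, \<open>M\<close> is positive semidefinite with kernel the
  column space of \<open>F = S S\<^sub>k\<^sup>T\<close>. Thus \<open>M\<close> is a dual certificate, and every maximizer \<open>S'\<close> satisfies
  \<open>S' = F S'\<^sub>k\<close>, that is \<open>S' S'\<^sup>T = F F\<^sup>T\<close>, which has rank \<open>d\<close>. The closeness estimate is strict when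
  \<open>\<Delta> \<noteq> 0\<close>, which is why the non-strict hypothesis suffices.
\<close>

section \<open>Finite inner products\<close>

text \<open>In the averaged second-order inequality n^2 d and |V|^2 end up with the same factor p -
  2d: tr L carries p - d, and the lower bound on |S S^T|^2 takes off another d. They combine into
  the defect n^2 d - |V|^2, which is n/2 times the average over k of |S - Z S_k|^2.

  The noise enters twice, as D against S S^T and as its partial trace against the numbers |S_i
  S_j^T|^2; \<open>\<gamma>\<close> puts both on one scale. Each is compared with its value at Z
  S_k: the leading terms cancel and what remains is linear in q = |S - Z S_k|. The outcome is a
  quadratic inequality in q, whose larger root is the source of 2 + sqrt 5.

  A lower bound on G_i G_i^T controls only L_i^2; the sign of L_i needs a separate second-order test
  that moves a single block. The analysis is carried out on functions of index pairs, and matrices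
  are translated only at the end.\<close>

definition ip :: "'a set \<Rightarrow> ('a \<Rightarrow> real) \<Rightarrow> ('a \<Rightarrow> real) \<Rightarrow> real" where
  "ip B u v = (\<Sum>l\<in>B. u l * v l)"

lemma ip_commute: "ip B u v = ip B v u"
  by (simp add: ip_def mult.commute)

lemma ip_add_left: "ip B (\<lambda>l. u l + v l) w = ip B u w + ip B v w"
  and ip_add_right: "ip B w (\<lambda>l. u l + v l) = ip B w u + ip B w v"
  and ip_diff_left: "ip B (\<lambda>l. u l - v l) w = ip B u w - ip B v w"
  and ip_diff_right: "ip B w (\<lambda>l. u l - v l) = ip B w u - ip B w v"
  and ip_minus_left: "ip B (\<lambda>l. - u l) w = - ip B u w"
  and ip_minus_right: "ip B w (\<lambda>l. - u l) = - ip B w u"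
  by (simp_all add: ip_def algebra_simps sum.distrib sum_subtractf sum_negf)

lemma ip_scale_left: "ip B (\<lambda>l. c * u l) w = c * ip B u w"
  and ip_scale_right: "ip B w (\<lambda>l. c * u l) = c * ip B w u"
  by (simp_all add: ip_def algebra_simps sum_distrib_left)

lemma ip_sum_left: "ip B (\<lambda>l. \<Sum>a\<in>K. u a l) w = (\<Sum>a\<in>K. ip B (u a) w)"
  and ip_sum_right: "ip B w (\<lambda>l. \<Sum>a\<in>K. u a l) = (\<Sum>a\<in>K. ip B w (u a))"
proof -
  show left: "ip B (\<lambda>l. \<Sum>a\<in>K. u a l) w = (\<Sum>a\<in>K. ip B (u a) w)" for w
    by (simp add: ip_def sum_distrib_right sum.swap[of _ K])
  show "ip B w (\<lambda>l. \<Sum>a\<in>K. u a l) = (\<Sum>a\<in>K. ip B w (u a))"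
    using left by (simp add: ip_commute)
qed

lemma ip_zero [simp]: "ip B (\<lambda>l. 0) w = 0" "ip B w (\<lambda>l. 0) = 0"
  by (simp_all add: ip_def)

lemmas ip_simps = ip_add_left ip_add_right ip_diff_left ip_diff_right ip_minus_left ip_minus_right
  ip_scale_left ip_scale_right ip_sum_left ip_sum_right

lemma ip_nonneg [simp]: "0 \<le> ip B u u"
  by (simp add: ip_def sum_nonneg)

lemma ip_eq_0D: "finite B \<Longrightarrow> ip B u u = 0 \<Longrightarrow> l \<in> B \<Longrightarrow> u l = 0"
  by (simp add: ip_def sum_nonneg_eq_0_iff)

lemma L2_set_ip: "L2_set u B = sqrt (ip B u u)"
  by (simp add: L2_set_def ip_def power2_eq_square)

lemma L2_set_power2: "(L2_set u B)\<^sup>2 = ip B u u"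
  by (simp add: L2_set_ip)

lemma abs_ip_le_L2: "\<bar>ip B u v\<bar> \<le> L2_set u B * L2_set v B"
proof -
  have "\<bar>ip B u v\<bar> \<le> (\<Sum>l\<in>B. \<bar>u l\<bar> * \<bar>v l\<bar>)"
    unfolding ip_def by (rule order_trans[OF sum_abs]) (simp add: abs_mult)
  also have "\<dots> \<le> L2_set u B * L2_set v B"
    by (rule L2_set_mult_ineq)
  finally show ?thesis .
qed

lemma ip_le_L2: "ip B u v \<le> L2_set u B * L2_set v B"
  using abs_ip_le_L2[of B u v] by simp

lemma L2_set_minus: "L2_set (\<lambda>l. - u l) B = L2_set u B"
  by (simp add: L2_set_def)

lemma L2_set_scale: "L2_set (\<lambda>l. c * u l) B = \<bar>c\<bar> * L2_set u B"
  by (simp add: L2_set_def power_mult_distrib real_sqrt_mult flip: sum_distrib_left)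

lemma tendsto_ip:
  assumes "\<And>l. l \<in> B \<Longrightarrow> ((\<lambda>t. u t l) \<longlongrightarrow> u0 l) F" "\<And>l. l \<in> B \<Longrightarrow> ((\<lambda>t. v t l) \<longlongrightarrow> v0 l) F"
  shows "((\<lambda>t. ip B (u t) (v t)) \<longlongrightarrow> ip B u0 v0) F"
  unfolding ip_def by (intro tendsto_sum tendsto_mult assms)

section \<open>Optimality conditions\<close>

text \<open>Row \<open>a\<close> of block \<open>i\<close> has index \<open>(i, a)\<close>; the values of a function \<open>S\<close> outside \<open>I \<times> {..<p}\<close> are irrelevant.\<close>

locale sync =
  fixes n d p :: nat and D :: "nat \<times> nat \<Rightarrow> nat \<times> nat \<Rightarrow> real"
  assumes n_pos: "n \<ge> 1" and d_pos: "d \<ge> 1" and p_large: "p \<ge> 2 * d + 1"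
    and D_sym: "\<And>i a j b. i < n \<Longrightarrow> a < d \<Longrightarrow> j < n \<Longrightarrow> b < d \<Longrightarrow> D (i, a) (j, b) = D (j, b) (i, a)"
    and D_diag: "\<And>i a b. i < n \<Longrightarrow> a < d \<Longrightarrow> b < d \<Longrightarrow> D (i, a) (i, b) = 0"
begin

abbreviation I :: "(nat \<times> nat) set" where "I \<equiv> {..<n} \<times> {..<d}"

abbreviation inn :: "(nat \<Rightarrow> real) \<Rightarrow> (nat \<Rightarrow> real) \<Rightarrow> real" where "inn \<equiv> ip {..<p}"

text \<open>The indicator is the entry of Z Z^T: every block of that matrix is the identity, so only
  the positions within the blocks matter.\<close>

definition A :: "nat \<times> nat \<Rightarrow> nat \<times> nat \<Rightarrow> real" where
  "A r s = (if snd r = snd s then 1 else 0) + D r s"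

definition feas :: "(nat \<times> nat \<Rightarrow> nat \<Rightarrow> real) \<Rightarrow> bool" where
  "feas S \<longleftrightarrow> (\<forall>i<n. \<forall>a<d. \<forall>b<d. inn (S (i, a)) (S (i, b)) = (if a = b then 1 else 0))"

definition obj :: "(nat \<times> nat \<Rightarrow> nat \<Rightarrow> real) \<Rightarrow> real" where
  "obj S = (\<Sum>r\<in>I. \<Sum>s\<in>I. A r s * inn (S r) (S s))"

definition locmax :: "(nat \<times> nat \<Rightarrow> nat \<Rightarrow> real) \<Rightarrow> bool" where
  "locmax S \<longleftrightarrow> feas S \<and> (\<exists>\<epsilon>>0. \<forall>S'. feas S' \<longrightarrow>
     (\<Sum>r\<in>I. \<Sum>l<p. (S' r l - S r l)\<^sup>2) < \<epsilon> \<longrightarrow> obj S' \<le> obj S)"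

definition G :: "(nat \<times> nat \<Rightarrow> nat \<Rightarrow> real) \<Rightarrow> nat \<times> nat \<Rightarrow> nat \<Rightarrow> real" where
  "G S r l = (\<Sum>s\<in>I. A r s * S s l)"

lemma A_sym: "r \<in> I \<Longrightarrow> s \<in> I \<Longrightarrow> A r s = A s r"
  by (cases r; cases s) (auto simp: A_def D_sym)

lemma inn_G: "inn (G S r) w = (\<Sum>s\<in>I. A r s * inn (S s) w)"
  unfolding G_def by (simp add: ip_simps)

text \<open>The objective is a quadratic form, so the expansion is exact; symmetry of
  \<open>A\<close> merges the two cross terms.\<close>

lemma obj_expand:
  "obj (\<lambda>r l. S r l + P r l) = obj S + 2 * (\<Sum>r\<in>I. inn (G S r) (P r)) + obj P"
proof -
  have 1: "(\<Sum>r\<in>I. \<Sum>s\<in>I. A r s * inn (P r) (S s)) = (\<Sum>r\<in>I. inn (G S r) (P r))"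
    unfolding inn_G by (simp add: ip_commute)
  have "(\<Sum>r\<in>I. \<Sum>s\<in>I. A r s * inn (S r) (P s)) = (\<Sum>s\<in>I. \<Sum>r\<in>I. A r s * inn (S r) (P s))"
    by (rule sum.swap)
  also have "\<dots> = (\<Sum>s\<in>I. \<Sum>r\<in>I. A s r * inn (S r) (P s))"
    by (intro sum.cong refl) (simp add: A_sym)
  also have "\<dots> = (\<Sum>r\<in>I. inn (G S r) (P r))"
    unfolding inn_G by simp
  finally have 2: "(\<Sum>r\<in>I. \<Sum>s\<in>I. A r s * inn (S r) (P s)) = (\<Sum>r\<in>I. inn (G S r) (P r))" .
  show ?thesis
    unfolding obj_def using 1 2
    by (simp add: ip_simps algebra_simps sum.distrib)
qed

text \<open>Along a feasible curve the exact increment 2 <G, P t> + obj (P t) is nonpositive for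
  small t > 0. Division by t isolates the velocity \<open>W\<close>; once <G, W> vanishes, division
  by t^2 isolates the t^2 coefficient \<open>Y\<close>. One-sided limits are enough, since the
  opposite direction can be supplied as another curve.\<close>

lemma locmax_curve:
  assumes "locmax S"
    and feasible: "eventually (\<lambda>t. feas (\<lambda>r l. S r l + P t r l)) (at_right 0)"
    and lim1: "\<And>r l. r \<in> I \<Longrightarrow> l < p \<Longrightarrow> ((\<lambda>t. P t r l / t) \<longlongrightarrow> W r l) (at_right 0)"
  shows locmax_first_order: "(\<Sum>r\<in>I. inn (G S r) (W r)) \<le> 0"
    and locmax_second_order: "(\<Sum>r\<in>I. inn (G S r) (W r)) = 0 \<Longrightarrow>
      (\<And>r l. r \<in> I \<Longrightarrow> l < p \<Longrightarrow> ((\<lambda>t. (P t r l - t * W r l) / t\<^sup>2) \<longlongrightarrow> Y r l) (at_right 0)) \<Longrightarrow>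
      2 * (\<Sum>r\<in>I. inn (G S r) (Y r)) + obj W \<le> 0"
proof -
  obtain \<epsilon> where \<epsilon>: "\<epsilon> > 0" and max: "\<And>S'. feas S' \<Longrightarrow>
     (\<Sum>r\<in>I. \<Sum>l<p. (S' r l - S r l)\<^sup>2) < \<epsilon> \<Longrightarrow> obj S' \<le> obj S"
    using assms(1) unfolding locmax_def by blast
  have t0: "eventually (\<lambda>t::real. t > 0) (at_right 0)"
    by (simp add: eventually_at_right_less)
  have P0: "((\<lambda>t. P t r l) \<longlongrightarrow> 0) (at_right 0)" if "r \<in> I" "l < p" for r l
  proof -
    have "((\<lambda>t. P t r l / t * t) \<longlongrightarrow> W r l * 0) (at_right 0)"
      by (intro tendsto_mult lim1 that tendsto_ident_at)
    moreover have "eventually (\<lambda>t. P t r l / t * t = P t r l) (at_right 0)"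
      using t0 by eventually_elim simp
    ultimately show ?thesis
      using Lim_transform_eventually by fastforce
  qed
  have "((\<lambda>t. \<Sum>r\<in>I. \<Sum>l<p. (P t r l)\<^sup>2) \<longlongrightarrow> (\<Sum>r\<in>I. \<Sum>l<p. 0\<^sup>2)) (at_right 0)"
    by (intro tendsto_sum tendsto_power P0) auto
  then have "eventually (\<lambda>t. (\<Sum>r\<in>I. \<Sum>l<p. (P t r l)\<^sup>2) < \<epsilon>) (at_right 0)"
    using \<epsilon> by (intro order_tendstoD(2)) auto
  with feasible have "eventually (\<lambda>t. obj (\<lambda>r l. S r l + P t r l) \<le> obj S) (at_right 0)"
    by eventually_elim (rule max, auto)
  then have main: "eventually (\<lambda>t. 2 * (\<Sum>r\<in>I. inn (G S r) (P t r)) + obj (P t) \<le> 0) (at_right 0)"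
    by eventually_elim (simp add: obj_expand)
  \<comment> \<open>By homogeneity of degree two, obj (P t) / t^2 is the objective at the rescaled
    displacement.\<close>
  have lim_obj: "((\<lambda>t. obj (\<lambda>r l. P t r l / t)) \<longlongrightarrow> obj W) (at_right 0)"
    unfolding obj_def by (intro tendsto_sum tendsto_mult tendsto_const tendsto_ip lim1) auto
  have inn_div: "inn u (\<lambda>l. v l / t) = inn u v / t" for u v t
    by (simp add: ip_def sum_divide_distrib)
  have obj_div: "obj (\<lambda>r l. P t r l / t) = obj (P t) / t\<^sup>2" for t
    unfolding obj_def by (simp add: ip_def power2_eq_square flip: sum_divide_distrib)
  show "(\<Sum>r\<in>I. inn (G S r) (W r)) \<le> 0"
  proof -
    have "((\<lambda>t. 2 * (\<Sum>r\<in>I. inn (G S r) (\<lambda>l. P t r l / t)) + t * obj (\<lambda>r l. P t r l / t))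
      \<longlongrightarrow> 2 * (\<Sum>r\<in>I. inn (G S r) (W r)) + 0 * obj W) (at_right 0)"
      by (intro tendsto_add tendsto_mult lim_obj tendsto_const tendsto_sum tendsto_ip lim1 tendsto_ident_at) auto
    moreover have "eventually (\<lambda>t. 2 * (\<Sum>r\<in>I. inn (G S r) (\<lambda>l. P t r l / t)) +
        t * obj (\<lambda>r l. P t r l / t) \<le> 0) (at_right 0)"
      using main t0
    proof eventually_elim
      case (elim t)
      have "2 * (\<Sum>r\<in>I. inn (G S r) (\<lambda>l. P t r l / t)) + t * obj (\<lambda>r l. P t r l / t)
        = (2 * (\<Sum>r\<in>I. inn (G S r) (P t r)) + obj (P t)) / t"
        using elim by (simp add: inn_div obj_div power2_eq_square add_divide_distrib flip: sum_divide_distrib)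
      then show ?case using elim by (simp add: divide_nonpos_pos)
    qed
    ultimately have "2 * (\<Sum>r\<in>I. inn (G S r) (W r)) + 0 * obj W \<le> 0"
      by (rule tendsto_upperbound) simp
    then show ?thesis by simp
  qed
  assume W0: "(\<Sum>r\<in>I. inn (G S r) (W r)) = 0"
    and lim2: "\<And>r l. r \<in> I \<Longrightarrow> l < p \<Longrightarrow> ((\<lambda>t. (P t r l - t * W r l) / t\<^sup>2) \<longlongrightarrow> Y r l) (at_right 0)"
  have "((\<lambda>t. 2 * (\<Sum>r\<in>I. inn (G S r) (\<lambda>l. (P t r l - t * W r l) / t\<^sup>2)) + obj (\<lambda>r l. P t r l / t))
      \<longlongrightarrow> 2 * (\<Sum>r\<in>I. inn (G S r) (Y r)) + obj W) (at_right 0)"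
    by (intro tendsto_add tendsto_mult lim_obj tendsto_const tendsto_sum tendsto_ip lim2) auto
  moreover have "eventually (\<lambda>t. 2 * (\<Sum>r\<in>I. inn (G S r) (\<lambda>l. (P t r l - t * W r l) / t\<^sup>2)) +
        obj (\<lambda>r l. P t r l / t) \<le> 0) (at_right 0)"
    using main t0
  proof eventually_elim
    case (elim t)
    \<comment> \<open>Removing t \<open>W\<close> from \<open>P t\<close> changes nothing, because
      its pairing with \<open>G\<close> is zero by assumption.\<close>
    have "(\<Sum>r\<in>I. inn (G S r) (\<lambda>l. (P t r l - t * W r l) / t\<^sup>2))
       = ((\<Sum>r\<in>I. inn (G S r) (P t r)) - t * (\<Sum>r\<in>I. inn (G S r) (W r))) / t\<^sup>2"
      by (simp add: inn_div ip_simps sum_subtractf diff_divide_distrib flip: sum_divide_distrib sum_distrib_left)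
    then have "2 * (\<Sum>r\<in>I. inn (G S r) (\<lambda>l. (P t r l - t * W r l) / t\<^sup>2)) + obj (\<lambda>r l. P t r l / t)
      = (2 * (\<Sum>r\<in>I. inn (G S r) (P t r)) + obj (P t)) / t\<^sup>2"
      by (simp add: W0 obj_div add_divide_distrib)
    then show ?case using elim by (simp add: divide_nonpos_pos)
  qed
  ultimately show "2 * (\<Sum>r\<in>I. inn (G S r) (Y r)) + obj W \<le> 0"
    by (rule tendsto_upperbound) simp
qed

end

lemma sum_indicator_mult:
  "finite B \<Longrightarrow> a \<in> B \<Longrightarrow> (\<Sum>b\<in>B. (if b = a then 1 else 0) * g b) = (g a :: real)"
  by (simp add: if_distrib[of "\<lambda>c. c * _"] cong: if_cong)

text \<open>The square root renormalizes a unit row that is moved by t times an orthogonal vector of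
  squared length k. It adds nothing to the velocity of the curve and -k/2 to its t^2
  coefficient.\<close>

lemma sqrt_curve_first: "((\<lambda>t::real. (sqrt (1 - t\<^sup>2 * k) - 1) / t) \<longlongrightarrow> 0) (at_right 0)" (is ?A)
  and sqrt_curve_second: "((\<lambda>t::real. (sqrt (1 - t\<^sup>2 * k) - 1) / t\<^sup>2) \<longlongrightarrow> - k / 2) (at_right 0)" (is ?B)
proof -
  consider "k = 0" | "k > 0" | "k < 0" by linarith
  then have "?A \<and> ?B"
    by cases (simp, (rule conjI; real_asymp)+)
  then show ?A ?B by auto
qed

context sync
begin

section \<open>Rank-one variations and the multiplier blocks L_i\<close>

definition L :: "(nat \<times> nat \<Rightarrow> nat \<Rightarrow> real) \<Rightarrow> nat \<Rightarrow> nat \<Rightarrow> nat \<Rightarrow> real" where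
  "L S i a b = inn (G S (i, a)) (S (i, b))"

lemma locmax_feas: "locmax S \<Longrightarrow> feas S"
  by (simp add: locmax_def)

lemma feas_inn: "feas S \<Longrightarrow> i < n \<Longrightarrow> a < d \<Longrightarrow> b < d \<Longrightarrow> inn (S (i, a)) (S (i, b)) = (if a = b then 1 else 0)"
  by (simp add: feas_def)

lemma sum_I: "(\<Sum>r\<in>I. g r) = (\<Sum>i<n. \<Sum>a<d. g (i, a))"
  by (simp add: sum.cartesian_product)

lemma feas_comb:
  assumes "feas S" "i < n" "b < d"
  shows "inn (S (i, b)) (\<lambda>l. \<Sum>a<d. x a * S (i, a) l) = x b"
proof -
  have "inn (S (i, b)) (\<lambda>l. \<Sum>a<d. x a * S (i, a) l) = (\<Sum>a<d. (if a = b then 1 else 0) * x a)"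
    unfolding ip_simps by (intro sum.cong) (use assms in \<open>auto simp: feas_inn\<close>)
  then show ?thesis using assms by (simp add: sum_indicator_mult)
qed

text \<open>The rows of S_i are orthonormal, so mapping x to x^T S_i is an isometry; norms pass
  freely between coefficient vectors and combined rows.\<close>

lemma feas_comb2:
  assumes "feas S" "i < n"
  shows "inn (\<lambda>l. \<Sum>a<d. x a * S (i, a) l) (\<lambda>l. \<Sum>a<d. y a * S (i, a) l) = ip {..<d} x y"
  unfolding ip_sum_left ip_scale_left ip_def[of "{..<d}"]
  by (intro sum.cong) (use assms feas_comb in auto)

context
  fixes S x w
  assumes loc: "locmax S" and unit: "ip {..<d} x x = 1"
    and orth: "\<And>i a. i < n \<Longrightarrow> a < d \<Longrightarrow> inn (S (i, a)) (w i) = 0"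
begin

text \<open>Block \<open>i\<close> moves along \<open>S\<^sub>i + x ((c - 1) x\<^sup>T S\<^sub>i + t w\<^sub>i\<^sup>T)\<close> with \<open>c\<^sup>2 + t\<^sup>2 |w\<^sub>i|\<^sup>2 = 1\<close>, which preserves \<open>S\<^sub>i S\<^sub>i\<^sup>T = I\<close>
  because \<open>w\<^sub>i\<close> is orthogonal to the rows of \<open>S\<^sub>i\<close>.\<close>

definition comb_row :: "nat \<Rightarrow> nat \<Rightarrow> real" where "comb_row i l = (\<Sum>a<d. x a * S (i, a) l)"

definition curve :: "real \<Rightarrow> nat \<times> nat \<Rightarrow> nat \<Rightarrow> real" where
  "curve t = (\<lambda>(i, a) l. x a * ((sqrt (1 - t\<^sup>2 * inn (w i) (w i)) - 1) * comb_row i l + t * w i l))"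

text \<open>Row a is shifted by x_a z with one common vector z. The Gram entry of rows a and b
  changes by x_a x_b (2 (c - 1) + |z|^2), which is zero by the choice of c. There are finitely many
  blocks, so all radicands are positive at once for small t.\<close>

lemma curve_feas: "eventually (\<lambda>t. feas (\<lambda>r l. S r l + curve t r l)) (at_right 0)"
proof -
  have "eventually (\<lambda>t::real. t\<^sup>2 * k < 1) (at_right 0)" for k :: real
    by (rule order_tendstoD(2)[of _ "0\<^sup>2 * k"]) (auto intro!: tendsto_eq_intros)
  then have "eventually (\<lambda>t::real. \<forall>i\<in>{..<n}. t\<^sup>2 * inn (w i) (w i) < 1) (at_right 0)"
    by (intro eventually_ball_finite) auto
  then show ?thesis
  proof eventually_elim
    case (elim t)
    show ?case unfolding feas_def
    proof (intro allI impI)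
      fix i a b assume i: "i < n" and a: "a < d" and b: "b < d"
      define c where "c = sqrt (1 - t\<^sup>2 * inn (w i) (w i))"
      have c: "c\<^sup>2 = 1 - t\<^sup>2 * inn (w i) (w i)"
        unfolding c_def using elim i by (simp add: less_imp_le)
      have f: "feas S" using loc by (rule locmax_feas)
      have Su: "inn (S (i, b)) (comb_row i) = x b" if "b < d" for b
        unfolding comb_row_def using feas_comb[OF f i that] .
      have uuu: "inn (comb_row i) (comb_row i) = 1"
        unfolding comb_row_def using feas_comb2[OF f i, of x x] unit by simp
      have uw: "inn (comb_row i) (w i) = 0"
        unfolding comb_row_def ip_simps using orth i by simp
      define z where "z = (\<lambda>l. (c - 1) * comb_row i l + t * w i l)"
      have Sz: "inn (S (i, b)) z = (c - 1) * x b" if "b < d" for b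
        unfolding z_def ip_simps using that Su orth i by simp
      have zz: "inn z z = (c - 1)\<^sup>2 + t\<^sup>2 * inn (w i) (w i)"
        unfolding z_def ip_simps using uuu uw ip_commute[of _ "w i" "comb_row i"]
        by (simp add: power2_eq_square algebra_simps)
      have P: "curve t (i, a) = (\<lambda>l. x a * z l)" for a
        unfolding curve_def z_def c_def by simp
      have "inn (\<lambda>l. S (i, a) l + curve t (i, a) l) (\<lambda>l. S (i, b) l + curve t (i, b) l)
        = inn (S (i, a)) (S (i, b)) + x b * inn (S (i, a)) z + x a * inn (S (i, b)) z + x a * x b * inn z z"
        unfolding P ip_simps by (simp add: ip_commute[of _ z "S (i, b)"] algebra_simps)
      also have "\<dots> = inn (S (i, a)) (S (i, b)) + x a * x b * (2 * (c - 1) + ((c - 1)\<^sup>2 + t\<^sup>2 * inn (w i) (w i)))"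
        unfolding zz Sz[OF a] Sz[OF b] by (simp add: algebra_simps)
      also have "2 * (c - 1) + ((c - 1)\<^sup>2 + t\<^sup>2 * inn (w i) (w i)) = 0"
        using c by (simp add: power2_eq_square algebra_simps)
      finally show "inn (\<lambda>l. S (i, a) l + curve t (i, a) l) (\<lambda>l. S (i, b) l + curve t (i, b) l) = (if a = b then 1 else 0)"
        using f i a b by (simp add: feas_inn)
    qed
  qed
qed

lemma curve_first_limit: "((\<lambda>t. curve t r l / t) \<longlongrightarrow> x (snd r) * w (fst r) l) (at_right 0)"
proof -
  obtain i a where r: "r = (i, a)" by fastforce
  have "((\<lambda>t. x a * ((sqrt (1 - t\<^sup>2 * inn (w i) (w i)) - 1) / t * comb_row i l + w i l)) \<longlongrightarrow> x a * (0 * comb_row i l + w i l)) (at_right 0)"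
    by (intro tendsto_intros sqrt_curve_first)
  then have lim: "((\<lambda>t. x a * ((sqrt (1 - t\<^sup>2 * inn (w i) (w i)) - 1) / t * comb_row i l + w i l)) \<longlongrightarrow> x a * w i l) (at_right 0)"
    by simp
  have "eventually (\<lambda>t::real. x a * ((sqrt (1 - t\<^sup>2 * inn (w i) (w i)) - 1) / t * comb_row i l + w i l) = curve t r l / t) (at_right 0)"
    using eventually_at_right_less[of "0::real"]
    by eventually_elim (simp add: curve_def r field_simps)
  from Lim_transform_eventually[OF lim this] show ?thesis by (simp add: r)
qed

lemma curve_second_limit: "((\<lambda>t. (curve t r l - t * (x (snd r) * w (fst r) l)) / t\<^sup>2) \<longlongrightarrow>
   x (snd r) * (- inn (w (fst r)) (w (fst r)) / 2 * comb_row (fst r) l)) (at_right 0)"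
proof -
  obtain i a where r: "r = (i, a)" by fastforce
  have lim: "((\<lambda>t. x a * ((sqrt (1 - t\<^sup>2 * inn (w i) (w i)) - 1) / t\<^sup>2 * comb_row i l)) \<longlongrightarrow> x a * (- inn (w i) (w i) / 2 * comb_row i l)) (at_right 0)"
    by (intro tendsto_mult tendsto_const sqrt_curve_second)
  have "eventually (\<lambda>t::real. x a * ((sqrt (1 - t\<^sup>2 * inn (w i) (w i)) - 1) / t\<^sup>2 * comb_row i l) =
      (curve t r l - t * (x (snd r) * w (fst r) l)) / t\<^sup>2) (at_right 0)"
    using eventually_at_right_less[of "0::real"]
    by eventually_elim (simp add: curve_def r field_simps)
  from Lim_transform_eventually[OF lim this] show ?thesis by (simp add: r)
qed

lemma rank_one_first_le: "(\<Sum>i<n. \<Sum>a<d. x a * inn (G S (i, a)) (w i)) \<le> 0"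
  using locmax_first_order[OF loc curve_feas curve_first_limit]
  by (simp add: sum_I ip_simps)

text \<open>In the second-order condition the t^2 coefficient contributes -|w_i|^2 x^T L_i x per
  block, and the velocity x w_i^T contributes (x^T A_ij x) <w_i, w_j> per pair of blocks.\<close>

lemma rank_one_second_aux:
  assumes "(\<Sum>i<n. \<Sum>a<d. x a * inn (G S (i, a)) (w i)) = 0"
  shows "(\<Sum>i<n. \<Sum>j<n. (\<Sum>a<d. \<Sum>b<d. x a * x b * A (i, a) (j, b)) * inn (w i) (w j))
    \<le> (\<Sum>i<n. inn (w i) (w i) * (\<Sum>a<d. \<Sum>b<d. x a * x b * L S i a b))"
proof -
  have 0: "(\<Sum>r\<in>I. inn (G S r) (\<lambda>l. x (snd r) * w (fst r) l)) = 0"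
    using assms by (simp add: sum_I ip_simps)
  have 1: "2 * (\<Sum>r\<in>I. inn (G S r) (\<lambda>l. x (snd r) * (- inn (w (fst r)) (w (fst r)) / 2 * comb_row (fst r) l)))
      = - (\<Sum>i<n. inn (w i) (w i) * (\<Sum>a<d. \<Sum>b<d. x a * x b * L S i a b))"
    unfolding sum_I fst_conv snd_conv ip_scale_right comb_row_def ip_sum_right L_def sum_distrib_left
      sum_negf[symmetric]
    by (intro sum.cong refl) simp
  have "obj (\<lambda>r l. x (snd r) * w (fst r) l) =
    (\<Sum>i<n. \<Sum>a<d. \<Sum>j<n. \<Sum>b<d. x a * x b * A (i, a) (j, b) * inn (w i) (w j))"
    unfolding obj_def by (simp add: sum_I ip_simps mult_ac)
  also have "\<dots> = (\<Sum>i<n. \<Sum>j<n. (\<Sum>a<d. \<Sum>b<d. x a * x b * A (i, a) (j, b)) * inn (w i) (w j))"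
    unfolding sum_distrib_right by (intro sum.cong refl sum.swap)
  finally show ?thesis
    using locmax_second_order[OF loc curve_feas curve_first_limit 0 curve_second_limit] 1 by simp
qed

end

text \<open>The admissible directions form a linear space, so the inequality for w and for -w gives
  an equality.\<close>

lemma rank_one_first:
  assumes "locmax S" "ip {..<d} x x = 1" "\<And>i a. i < n \<Longrightarrow> a < d \<Longrightarrow> inn (S (i, a)) (w i) = 0"
  shows "(\<Sum>i<n. \<Sum>a<d. x a * inn (G S (i, a)) (w i)) = 0"
  using rank_one_first_le[of S x w] rank_one_first_le[of S x "\<lambda>i l. - w i l"] assms
  by (simp add: ip_simps sum_negf)

lemmas rank_one_second = rank_one_second_aux[OF _ _ _ rank_one_first]

lemma first_order_normal:
  assumes "locmax S" "i < n" "a < d" "\<And>b. b < d \<Longrightarrow> inn (S (i, b)) w = 0"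
  shows "inn (G S (i, a)) w = 0"
proof -
  \<comment> \<open>A variation of one row only: \<open>?x\<close> selects row a, and
    \<open>?w\<close> vanishes outside block i.\<close>
  let ?x = "\<lambda>b. if b = a then 1 else (0::real)"
  let ?w = "\<lambda>j. if j = i then w else (\<lambda>_. 0)"
  have "ip {..<d} ?x ?x = 1"
    unfolding ip_def using assms by (simp add: sum_indicator_mult)
  from rank_one_first[OF assms(1) this, of ?w]
  have "(\<Sum>j<n. \<Sum>b<d. ?x b * inn (G S (j, b)) (?w j)) = 0"
    using assms by auto
  also have "(\<Sum>j<n. \<Sum>b<d. ?x b * inn (G S (j, b)) (?w j)) = (\<Sum>j<n. (if j = i then 1 else 0) * inn (G S (j, a)) w)"
    using assms by (intro sum.cong refl) (simp add: sum_indicator_mult)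
  finally show ?thesis using assms by (simp add: sum_indicator_mult)
qed

text \<open>The residual of row (i, a) of \<open>G\<close> after projection to the rows of S_i is
  itself a normal direction. \<open>G\<close> is orthogonal to it there, so the residual is
  orthogonal to itself.\<close>

lemma first_order_expand:
  assumes "locmax S" "i < n" "a < d" "l < p"
  shows "G S (i, a) l = (\<Sum>b<d. L S i a b * S (i, b) l)"
proof -
  define w where "w = (\<lambda>l. G S (i, a) l - (\<Sum>b<d. L S i a b * S (i, b) l))"
  have f: "feas S" using assms by (rule_tac locmax_feas)
  have orth: "inn (S (i, b)) w = 0" if "b < d" for b
    unfolding w_def ip_diff_right feas_comb[OF f assms(2) that]
    by (simp add: L_def ip_commute)
  have "inn w w = inn (G S (i, a)) w - (\<Sum>b<d. L S i a b * inn (S (i, b)) w)"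
    by (subst (1) w_def) (simp add: ip_simps)
  also have "\<dots> = 0"
    using first_order_normal[OF assms(1-3) orth] orth by simp
  finally have "w l = 0" using assms ip_eq_0D[of "{..<p}" w l] by simp
  then show ?thesis by (simp add: w_def)
qed

text \<open>Rotating rows a and b of block i in their own plane is a tangent direction that the
  normal variations miss. Its first-order term is L_ab - L_ba; exchanging a and b gives the reverse
  inequality.\<close>

lemma L_sym_le:
  assumes loc: "locmax S" and i: "i < n" and a: "a < d" and b: "b < d" and "a \<noteq> b"
  shows "L S i a b \<le> L S i b a"
proof -
  have f: "feas S" using loc by (rule locmax_feas)
  \<comment> \<open>A rotation with sine t and cosine sqrt (1 - t^2); the radicand is written with k
    = 1 to match \<open>sqrt_curve_first\<close>.\<close>
  define P where "P = (\<lambda>t r l. if r = (i, a) then (sqrt (1 - t\<^sup>2 * 1) - 1) * S (i, a) l + t * S (i, b) l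
    else if r = (i, b) then (sqrt (1 - t\<^sup>2 * 1) - 1) * S (i, b) l - t * S (i, a) l else (0::real))"
  define W where "W = (\<lambda>r l. if r = (i, a) then S (i, b) l else if r = (i, b) then - S (i, a) l else (0::real))"
  have "eventually (\<lambda>t::real. t\<^sup>2 < 1) (at_right 0)"
    by (rule order_tendstoD(2)[of _ "0\<^sup>2"]) (auto intro!: tendsto_eq_intros)
  then have feas: "eventually (\<lambda>t. feas (\<lambda>r l. S r l + P t r l)) (at_right 0)"
  proof eventually_elim
    case (elim t)
    define c where "c = sqrt (1 - t\<^sup>2)"
    have c: "c * c = 1 - t * t"
      unfolding c_def using elim by (simp add: power2_eq_square less_imp_le)
    have row: "(\<lambda>l. S (j, e) l + P t (j, e) l) =
      (if (j, e) = (i, a) then (\<lambda>l. c * S (i, a) l + t * S (i, b) l)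
       else if (j, e) = (i, b) then (\<lambda>l. c * S (i, b) l - t * S (i, a) l) else S (j, e))" for j e
      unfolding P_def c_def by (auto simp: algebra_simps)
    show ?case
      unfolding feas_def row using f i a b \<open>a \<noteq> b\<close> c
      by (auto simp: ip_simps feas_inn algebra_simps)
  qed
  have lim: "((\<lambda>t. P t r l / t) \<longlongrightarrow> W r l) (at_right 0)" for r l
  proof -
    have l: "((\<lambda>t. (sqrt (1 - t\<^sup>2 * 1) - 1) / t * u + v) \<longlongrightarrow> v) (at_right 0)" for u v :: real
      by (rule tendsto_eq_intros sqrt_curve_first refl)+ simp
    have ev: "eventually (\<lambda>t::real. (sqrt (1 - t\<^sup>2 * 1) - 1) / t * u + v =
       ((sqrt (1 - t\<^sup>2 * 1) - 1) * u + t * v) / t) (at_right 0)" for u v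
      using eventually_at_right_less[of "0::real"] by eventually_elim (simp add: field_simps)
    note l = Lim_transform_eventually[OF l ev]
    show ?thesis unfolding P_def W_def
      using l[of "S (i, a) l" "S (i, b) l"] l[of "S (i, b) l" "- S (i, a) l"] by simp
  qed
  have "(\<Sum>r\<in>I. inn (G S r) (W r)) = (\<Sum>r\<in>{(i, a), (i, b)}. inn (G S r) (W r))"
    by (rule sum.mono_neutral_right) (use i a b in \<open>auto simp: W_def\<close>)
  also have "\<dots> = L S i a b - L S i b a"
    using \<open>a \<noteq> b\<close> unfolding L_def W_def by (simp add: ip_simps)
  finally show ?thesis
    using locmax_first_order[OF loc feas lim] by simp
qed

lemma L_sym: "locmax S \<Longrightarrow> i < n \<Longrightarrow> a < d \<Longrightarrow> b < d \<Longrightarrow> L S i a b = L S i b a"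
  by (cases "a = b") (auto intro: antisym L_sym_le)

section \<open>The second-order condition averaged over the projections I - S_i^T S_i\<close>

definition normal_proj :: "(nat \<times> nat \<Rightarrow> nat \<Rightarrow> real) \<Rightarrow> nat \<Rightarrow> nat \<Rightarrow> nat \<Rightarrow> real" where
  "normal_proj S i l m = (if m = l then 1 else 0) - (\<Sum>a<d. S (i, a) l * S (i, a) m)"

lemma inn_delta: "l < p \<Longrightarrow> inn u (\<lambda>m. if m = l then 1 else 0) = u l"
  using sum_indicator_mult[of "{..<p}" l u] by (simp add: ip_def mult.commute)

lemma normal_proj_orth: "feas S \<Longrightarrow> i < n \<Longrightarrow> a < d \<Longrightarrow> l < p \<Longrightarrow> inn (S (i, a)) (normal_proj S i l) = 0"
  unfolding normal_proj_def ip_diff_right using feas_comb[of S i a "\<lambda>a. S (i, a) l"] by (simp add: inn_delta)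

text \<open>With P_i = S_i^T S_i this is tr ((I - P_i) (I - P_j)) = p - 2d + tr (P_i P_j), and tr
  (P_i P_j) is the squared Frobenius norm of S_i S_j^T.\<close>

lemma sum_inn_normal_proj:
  assumes f: "feas S" and i: "i < n" and j: "j < n"
  shows "(\<Sum>l<p. inn (normal_proj S i l) (normal_proj S j l)) = real p - 2 * real d + (\<Sum>a<d. \<Sum>b<d. (inn (S (i, a)) (S (j, b)))\<^sup>2)"
proof -
  have row: "(\<Sum>l<p. \<Sum>a<d. S (i, a) l * S (i, a) l) = real d" if "i < n" for i
    unfolding sum.swap[of _ "{..<d}" "{..<p}"] using feas_inn[OF f that] by (simp add: ip_def)
  have "inn (normal_proj S i l) (normal_proj S j l) = 1 - (\<Sum>a<d. S (i, a) l * S (i, a) l) - (\<Sum>a<d. S (j, a) l * S (j, a) l)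
      + (\<Sum>a<d. \<Sum>b<d. S (i, a) l * S (j, b) l * inn (S (i, a)) (S (j, b)))" if "l < p" for l
    unfolding normal_proj_def ip_diff_left ip_diff_right inn_delta[OF that] ip_commute[of _ "\<lambda>m. if m = l then 1 else 0"]
    by (simp add: ip_simps sum_distrib_left mult.assoc)
  then have "(\<Sum>l<p. inn (normal_proj S i l) (normal_proj S j l)) = (\<Sum>l<p. 1 - (\<Sum>a<d. S (i, a) l * S (i, a) l) - (\<Sum>a<d. S (j, a) l * S (j, a) l)
      + (\<Sum>a<d. \<Sum>b<d. S (i, a) l * S (j, b) l * inn (S (i, a)) (S (j, b))))"
    by simp
  also have "\<dots> = real p - 2 * real d + (\<Sum>l<p. \<Sum>a<d. \<Sum>b<d. S (i, a) l * S (j, b) l * inn (S (i, a)) (S (j, b)))"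
    unfolding sum.distrib sum_subtractf row[OF i] row[OF j] by simp
  also have "(\<Sum>l<p. \<Sum>a<d. \<Sum>b<d. S (i, a) l * S (j, b) l * inn (S (i, a)) (S (j, b)))
    = (\<Sum>a<d. \<Sum>b<d. (inn (S (i, a)) (S (j, b)))\<^sup>2)"
    unfolding sum.swap[of _ _ "{..<p}"]
    by (simp add: ip_def power2_eq_square flip: sum_distrib_right)
  finally show ?thesis .
qed

lemma sum_norm_normal_proj:
  assumes f: "feas S" and i: "i < n"
  shows "(\<Sum>l<p. inn (normal_proj S i l) (normal_proj S i l)) = real p - real d"
proof -
  have "(\<Sum>a<d. \<Sum>b<d. (inn (S (i, a)) (S (i, b)))\<^sup>2) = (\<Sum>a<d. \<Sum>b<d. (if b = a then 1 else 0) * 1)"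
    by (intro sum.cong refl) (use f i in \<open>auto simp: feas_inn\<close>)
  also have "\<dots> = real d" by (simp add: sum_indicator_mult)
  finally show ?thesis using sum_inn_normal_proj[OF f i i] by simp
qed

lemma A_diag: "i < n \<Longrightarrow> a < d \<Longrightarrow> b < d \<Longrightarrow> A (i, a) (i, b) = (if b = a then 1 else 0)"
  by (simp add: A_def D_diag)

text \<open>Moving block i alone leaves only A_ii, which is the identity because the noise has zero
  diagonal blocks. A nonzero normal direction exists since I - S_i^T S_i has trace p - d >
  0.\<close>

lemma L_ge_unit:
  assumes loc: "locmax S" and i: "i < n" and x: "ip {..<d} x x = 1"
  shows "1 \<le> (\<Sum>a<d. \<Sum>b<d. x a * x b * L S i a b)"
proof -
  have f: "feas S" using loc by (rule locmax_feas)
  have "(\<Sum>l<p. inn (normal_proj S i l) (normal_proj S i l)) \<noteq> 0"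
    using sum_norm_normal_proj[OF f i] p_large by simp
  then obtain l where l: "l < p" "inn (normal_proj S i l) (normal_proj S i l) \<noteq> 0"
    by (meson lessThan_iff sum.neutral)
  let ?w = "\<lambda>j. if j = i then normal_proj S i l else (\<lambda>_. 0)"
  let ?k = "inn (normal_proj S i l) (normal_proj S i l)"
  have k: "?k > 0" using l by (simp add: less_le)
  have one: "(\<Sum>a<d. \<Sum>b<d. x a * x b * A (i, a) (i, b)) = 1"
  proof -
    have "(\<Sum>a<d. \<Sum>b<d. x a * x b * A (i, a) (i, b)) = (\<Sum>a<d. \<Sum>b<d. (if b = a then 1 else 0) * (x a * x b))"
      by (intro sum.cong refl) (use i in \<open>auto simp: A_diag\<close>)
    also have "\<dots> = 1" using x by (simp add: sum_indicator_mult ip_def)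
    finally show ?thesis .
  qed
  have "(\<Sum>i<n. \<Sum>j<n. (\<Sum>a<d. \<Sum>b<d. x a * x b * A (i, a) (j, b)) * inn (?w i) (?w j))
    \<le> (\<Sum>i<n. inn (?w i) (?w i) * (\<Sum>a<d. \<Sum>b<d. x a * x b * L S i a b))"
    using normal_proj_orth[OF f i] l by (intro rank_one_second[OF loc x _ loc x]) auto
  moreover have "(\<Sum>i<n. \<Sum>j<n. (\<Sum>a<d. \<Sum>b<d. x a * x b * A (i, a) (j, b)) * inn (?w i) (?w j))
    = (\<Sum>m<n. (if m = i then 1 else 0) * (\<Sum>j<n. (if j = i then 1 else 0) * ((\<Sum>a<d. \<Sum>b<d. x a * x b * A (m, a) (j, b)) * ?k)))"
    unfolding sum_distrib_left by (intro sum.cong refl) auto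
  moreover have "\<dots> = ?k"
    using i one by (simp add: sum_indicator_mult)
  moreover have "(\<Sum>m<n. inn (?w m) (?w m) * (\<Sum>a<d. \<Sum>b<d. x a * x b * L S m a b))
    = (\<Sum>m<n. (if m = i then 1 else 0) * (?k * (\<Sum>a<d. \<Sum>b<d. x a * x b * L S m a b)))"
    by (intro sum.cong refl) auto
  moreover have "\<dots> = ?k * (\<Sum>a<d. \<Sum>b<d. x a * x b * L S i a b)"
    using i by (simp add: sum_indicator_mult)
  ultimately have "?k * 1 \<le> ?k * (\<Sum>a<d. \<Sum>b<d. x a * x b * L S i a b)" by simp
  then show ?thesis using k by (simp only: mult_le_cancel_left_pos)
qed

lemma L_nonneg:
  assumes loc: "locmax S" and i: "i < n"
  shows "0 \<le> (\<Sum>a<d. \<Sum>b<d. x a * x b * L S i a b)"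
proof (cases "ip {..<d} x x = 0")
  case True
  then have "x a = 0" if "a < d" for a using that ip_eq_0D[of "{..<d}" x a] by simp
  then show ?thesis by simp
next
  case False
  then have k: "ip {..<d} x x > 0" by (simp add: less_le)
  let ?s = "sqrt (ip {..<d} x x)"
  define c where "c = 1 / ?s"
  have c: "c * (c * ip {..<d} x x) = 1" "c * c > 0" unfolding c_def using k by simp_all
  have "1 \<le> (\<Sum>a<d. \<Sum>b<d. (c * x a) * (c * x b) * L S i a b)"
    using c(1) by (intro L_ge_unit[OF loc i]) (simp only: ip_scale_left ip_scale_right)
  also have "\<dots> = c * c * (\<Sum>a<d. \<Sum>b<d. x a * x b * L S i a b)"
    unfolding sum_distrib_left by (intro sum.cong refl) (simp only: mult_ac)
  finally have "0 < c * c * (\<Sum>a<d. \<Sum>b<d. x a * x b * L S i a b)" by simp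
  then have "0 < (\<Sum>a<d. \<Sum>b<d. x a * x b * L S i a b)"
    using c(2) by (rule zero_less_mult_pos)
  then show ?thesis by (rule less_imp_le)
qed

text \<open>With x the k-th unit vector only \<open>A (i, k) (j, k)\<close> and
  \<open>L S i k k\<close> survive, so the sum over k produces the traces of A_ij and L_i; the sum
  over l produces the traces of the projections and of their products.\<close>

lemma averaged_second_order:
  assumes loc: "locmax S"
  shows "(\<Sum>i<n. \<Sum>j<n. (\<Sum>k<d. A (i, k) (j, k)) * (real p - 2 * real d + (\<Sum>a<d. \<Sum>b<d. (inn (S (i, a)) (S (j, b)))\<^sup>2)))
    \<le> (real p - real d) * (\<Sum>i<n. \<Sum>k<d. L S i k k)"
proof -
  have f: "feas S" using loc by (rule locmax_feas)
  have ineq: "(\<Sum>i<n. \<Sum>j<n. A (i, k) (j, k) * inn (normal_proj S i l) (normal_proj S j l)) \<le> (\<Sum>i<n. inn (normal_proj S i l) (normal_proj S i l) * L S i k k)"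
    if "k < d" "l < p" for k l
  proof -
    let ?x = "\<lambda>b. if b = k then 1 else (0::real)"
    have x: "ip {..<d} ?x ?x = 1"
      unfolding ip_def using that by (simp add: sum_indicator_mult)
    have red: "(\<Sum>a<d. \<Sum>b<d. ?x a * ?x b * g a b) = g k k" for g :: "nat \<Rightarrow> nat \<Rightarrow> real"
    proof -
      have "(\<Sum>a<d. \<Sum>b<d. ?x a * ?x b * g a b) = (\<Sum>a<d. ?x a * (\<Sum>b<d. ?x b * g a b))"
        unfolding sum_distrib_left by (simp only: mult.assoc)
      then show ?thesis using that by (simp only: sum_indicator_mult finite_lessThan lessThan_iff)
    qed
    show ?thesis
      using rank_one_second[OF loc x _ loc x, of "\<lambda>i. normal_proj S i l"] normal_proj_orth[OF f] that
      unfolding red by auto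
  qed
  have "(\<Sum>k<d. \<Sum>l<p. \<Sum>i<n. \<Sum>j<n. A (i, k) (j, k) * inn (normal_proj S i l) (normal_proj S j l))
    \<le> (\<Sum>k<d. \<Sum>l<p. \<Sum>i<n. inn (normal_proj S i l) (normal_proj S i l) * L S i k k)"
    by (rule sum_mono, rule sum_mono) (simp add: ineq)
  also have "\<dots> = (\<Sum>k<d. \<Sum>i<n. (real p - real d) * L S i k k)"
    unfolding sum.swap[of _ "{..<n}" "{..<p}"] sum_distrib_right[symmetric]
    by (intro sum.cong refl) (simp add: sum_norm_normal_proj[OF f])
  also have "\<dots> = (real p - real d) * (\<Sum>i<n. \<Sum>k<d. L S i k k)"
    unfolding sum.swap[of _ "{..<d}" "{..<n}"] by (simp add: sum_distrib_left)
  also have "(\<Sum>k<d. \<Sum>l<p. \<Sum>i<n. \<Sum>j<n. A (i, k) (j, k) * inn (normal_proj S i l) (normal_proj S j l))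
    = (\<Sum>k<d. \<Sum>i<n. \<Sum>j<n. \<Sum>l<p. A (i, k) (j, k) * inn (normal_proj S i l) (normal_proj S j l))"
    unfolding sum.swap[of _ "{..<n}" "{..<p}"] ..
  also have "\<dots> = (\<Sum>i<n. \<Sum>j<n. \<Sum>k<d. A (i, k) (j, k) * (\<Sum>l<p. inn (normal_proj S i l) (normal_proj S j l)))"
    unfolding sum.swap[of _ "{..<n}" "{..<d}"] sum_distrib_left ..
  also have "\<dots> = (\<Sum>i<n. \<Sum>j<n. (\<Sum>k<d. A (i, k) (j, k)) * (real p - 2 * real d + (\<Sum>a<d. \<Sum>b<d. (inn (S (i, a)) (S (j, b)))\<^sup>2)))"
    unfolding sum_distrib_right by (intro sum.cong refl) (simp add: sum_inn_normal_proj[OF f])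
  finally show ?thesis .
qed

end

section \<open>Proximity to the ground truth\<close>

text \<open>An upper bound on the operator norm, stated without a supremum so that it applies to any
  index sets. Positivity of c is explicit because for empty \<open>J\<close> the inequality says
  nothing about c.\<close>

definition op_bound :: "'a set \<Rightarrow> 'b set \<Rightarrow> ('a \<Rightarrow> 'b \<Rightarrow> real) \<Rightarrow> real \<Rightarrow> bool" where
  "op_bound I J K c \<longleftrightarrow> 0 \<le> c \<and> (\<forall>x. L2_set (\<lambda>i. \<Sum>j\<in>J. K i j * x j) I \<le> c * L2_set x J)"

lemma op_bound_ip:
  assumes "op_bound I J K c"
  shows "ip I (\<lambda>i. \<Sum>j\<in>J. K i j * x j) (\<lambda>i. \<Sum>j\<in>J. K i j * x j) \<le> c\<^sup>2 * ip J x x"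
  using power_mono[of "L2_set (\<lambda>i. \<Sum>j\<in>J. K i j * x j) I" "c * L2_set x J" 2] assms
  by (simp add: op_bound_def power_mult_distrib L2_set_power2)

lemma op_bound_frob:
  assumes "op_bound I J K c"
  shows "(\<Sum>i\<in>I. ip B (\<lambda>l. \<Sum>j\<in>J. K i j * E j l) (\<lambda>l. \<Sum>j\<in>J. K i j * E j l))
    \<le> c\<^sup>2 * (\<Sum>j\<in>J. ip B (E j) (E j))"
proof -
  have "(\<Sum>l\<in>B. ip I (\<lambda>i. \<Sum>j\<in>J. K i j * E j l) (\<lambda>i. \<Sum>j\<in>J. K i j * E j l))
    \<le> (\<Sum>l\<in>B. c\<^sup>2 * ip J (\<lambda>j. E j l) (\<lambda>j. E j l))"
    by (rule sum_mono) (rule op_bound_ip[OF assms])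
  then show ?thesis
    unfolding ip_def sum.swap[of _ I B] sum_distrib_left[symmetric] sum.swap[of _ J B] .
qed

lemma sum_ip_le:
  "(\<Sum>i\<in>J. ip B (u i) (v i)) \<le> sqrt (\<Sum>i\<in>J. ip B (u i) (u i)) * sqrt (\<Sum>i\<in>J. ip B (v i) (v i))"
  using ip_le_L2[of "J \<times> B" "\<lambda>(i, l). u i l" "\<lambda>(i, l). v i l"]
  unfolding L2_set_ip ip_def by (simp add: sum.cartesian_product case_prod_beta)

lemma op_bound_bilinear:
  assumes "op_bound I J K c"
  shows "(\<Sum>i\<in>I. \<Sum>j\<in>J. K i j * ip B (F i) (E j))
    \<le> c * sqrt (\<Sum>j\<in>J. ip B (E j) (E j)) * sqrt (\<Sum>i\<in>I. ip B (F i) (F i))"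
proof -
  define H where "H = (\<lambda>i l. \<Sum>j\<in>J. K i j * E j l)"
  have c: "c \<ge> 0" using assms by (simp add: op_bound_def)
  have "sqrt (\<Sum>i\<in>I. ip B (H i) (H i)) \<le> sqrt (c\<^sup>2 * (\<Sum>j\<in>J. ip B (E j) (E j)))"
    unfolding H_def by (intro real_sqrt_le_mono op_bound_frob assms)
  also have "\<dots> = c * sqrt (\<Sum>j\<in>J. ip B (E j) (E j))"
    using c by (simp add: real_sqrt_mult)
  finally have H: "sqrt (\<Sum>i\<in>I. ip B (H i) (H i)) \<le> c * sqrt (\<Sum>j\<in>J. ip B (E j) (E j))" .
  have "(\<Sum>i\<in>I. \<Sum>j\<in>J. K i j * ip B (F i) (E j)) = (\<Sum>i\<in>I. ip B (F i) (H i))"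
    unfolding H_def by (simp add: ip_simps)
  also have "\<dots> \<le> sqrt (\<Sum>i\<in>I. ip B (F i) (F i)) * sqrt (\<Sum>i\<in>I. ip B (H i) (H i))"
    by (rule sum_ip_le)
  also have "\<dots> \<le> sqrt (\<Sum>i\<in>I. ip B (F i) (F i)) * (c * sqrt (\<Sum>j\<in>J. ip B (E j) (E j)))"
    by (intro mult_left_mono H) (simp add: sum_nonneg)
  finally show ?thesis by (simp only: mult_ac)
qed

text \<open>For symmetric K the pairing of K with u u^T - v v^T equals <u + v, K (u - v)>. This
  keeps the bound linear in |u - v|; negating u - v gives the other sign.\<close>

lemma op_bound_sym_diff:
  assumes "op_bound J J K c" and sym: "\<And>i j. i \<in> J \<Longrightarrow> j \<in> J \<Longrightarrow> K i j = K j i"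
  shows "\<bar>\<Sum>i\<in>J. \<Sum>j\<in>J. K i j * (ip B (u i) (u j) - ip B (v i) (v j))\<bar>
    \<le> c * sqrt (\<Sum>i\<in>J. ip B (\<lambda>l. u i l - v i l) (\<lambda>l. u i l - v i l))
        * sqrt (\<Sum>i\<in>J. ip B (\<lambda>l. u i l + v i l) (\<lambda>l. u i l + v i l))"
proof -
  have "(\<Sum>i\<in>J. \<Sum>j\<in>J. K i j * ip B (u i) (v j)) = (\<Sum>j\<in>J. \<Sum>i\<in>J. K i j * ip B (u i) (v j))"
    by (rule sum.swap)
  also have "\<dots> = (\<Sum>i\<in>J. \<Sum>j\<in>J. K i j * ip B (v i) (u j))"
    by (intro sum.cong refl) (simp add: sym ip_commute)
  finally have cross: "(\<Sum>i\<in>J. \<Sum>j\<in>J. K i j * ip B (u i) (v j)) = (\<Sum>i\<in>J. \<Sum>j\<in>J. K i j * ip B (v i) (u j))" .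
  have eq: "(\<Sum>i\<in>J. \<Sum>j\<in>J. K i j * ip B (\<lambda>l. u i l + v i l) (\<lambda>l. u j l - v j l))
      = (\<Sum>i\<in>J. \<Sum>j\<in>J. K i j * (ip B (u i) (u j) - ip B (v i) (v j)))"
    using cross by (simp add: ip_simps algebra_simps sum.distrib sum_subtractf)
  have eq': "(\<Sum>i\<in>J. \<Sum>j\<in>J. K i j * ip B (\<lambda>l. u i l + v i l) (\<lambda>l. - (u j l - v j l)))
      = - (\<Sum>i\<in>J. \<Sum>j\<in>J. K i j * (ip B (u i) (u j) - ip B (v i) (v j)))"
    unfolding ip_minus_right eq[symmetric] by (simp add: sum_negf)
  have n: "ip B (\<lambda>l. - (u i l - v i l)) (\<lambda>l. - (u i l - v i l)) = ip B (\<lambda>l. u i l - v i l) (\<lambda>l. u i l - v i l)" for i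
    unfolding ip_minus_left ip_minus_right by simp
  show ?thesis
    using op_bound_bilinear[OF assms(1), of B "\<lambda>i l. u i l + v i l" "\<lambda>i l. u i l - v i l"]
      op_bound_bilinear[OF assms(1), of B "\<lambda>i l. u i l + v i l" "\<lambda>i l. - (u i l - v i l)"]
    unfolding eq eq' n by linarith
qed

lemma ip_add_le: "ip B (\<lambda>l. u l + v l) (\<lambda>l. u l + v l) \<le> 2 * ip B u u + 2 * ip B v v"
proof -
  have "ip B (\<lambda>l. u l + v l) (\<lambda>l. u l + v l) + ip B (\<lambda>l. u l - v l) (\<lambda>l. u l - v l)
     = 2 * ip B u u + 2 * ip B v v"
    by (simp add: ip_simps)
  then show ?thesis using ip_nonneg[of B "\<lambda>l. u l - v l"] by linarith
qed

lemma square_sum_le: "finite J \<Longrightarrow> (\<Sum>j\<in>J. x j)\<^sup>2 \<le> real (card J) * (\<Sum>j\<in>J. (x j)\<^sup>2)" for x :: "'a \<Rightarrow> real"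
  using power_mono[OF abs_ip_le_L2[of J "\<lambda>_. 1" x], of 2]
  by (simp add: power_mult_distrib L2_set_power2) (simp add: ip_def power2_eq_square)

context sync
begin

section \<open>Distance to a repeated block and the two noise terms\<close>

definition V :: "(nat \<times> nat \<Rightarrow> nat \<Rightarrow> real) \<Rightarrow> nat \<Rightarrow> nat \<Rightarrow> real" where
  "V S a l = (\<Sum>j<n. S (j, a) l)"

definition N :: "(nat \<times> nat \<Rightarrow> nat \<Rightarrow> real) \<Rightarrow> nat \<times> nat \<Rightarrow> nat \<Rightarrow> real" where
  "N S r l = (\<Sum>s\<in>I. D r s * S s l)"

text \<open>The partial trace of the noise. The left-hand side of the averaged second-order
  condition sees A only through tr A_ij = d + T_ij.\<close>

definition T :: "nat \<Rightarrow> nat \<Rightarrow> real" where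
  "T i j = (\<Sum>k<d. D (i, k) (j, k))"

definition block_sq :: "(nat \<times> nat \<Rightarrow> nat \<Rightarrow> real) \<Rightarrow> nat \<Rightarrow> nat \<Rightarrow> real" where
  "block_sq S i j = (\<Sum>a<d. \<Sum>b<d. (inn (S (i, a)) (S (j, b)))\<^sup>2)"

text \<open>This is |S - Z S_k|^2: block k, repeated n times, stands in for a rotated ground
  truth.\<close>

definition dist2 :: "(nat \<times> nat \<Rightarrow> nat \<Rightarrow> real) \<Rightarrow> nat \<Rightarrow> real" where
  "dist2 S k = (\<Sum>j<n. \<Sum>a<d. inn (\<lambda>l. S (j, a) l - S (k, a) l) (\<lambda>l. S (j, a) l - S (k, a) l))"

lemma dist2_nonneg: "0 \<le> dist2 S k"
  unfolding dist2_def by (intro sum_nonneg) auto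

lemma G_eq: "a < d \<Longrightarrow> G S (i, a) = (\<lambda>l. V S a l + N S (i, a) l)"
proof
  fix l assume a: "a < d"
  have "(\<Sum>s\<in>I. (if snd (i, a) = snd s then 1 else 0) * S s l) = (\<Sum>j<n. \<Sum>b<d. (if b = a then 1 else 0) * S (j, b) l)"
    unfolding sum_I by (intro sum.cong refl) auto
  also have "\<dots> = V S a l" using a by (simp add: sum_indicator_mult V_def)
  finally show "G S (i, a) l = V S a l + N S (i, a) l"
    unfolding G_def A_def N_def by (simp only: distrib_right sum.distrib)
qed

lemma inn_V: "inn (V S a) w = (\<Sum>j<n. inn (S (j, a)) w)"
  unfolding V_def by (simp add: ip_simps)

lemma inn_V_right: "inn w (V S a) = (\<Sum>j<n. inn w (S (j, a)))"
  unfolding V_def by (simp add: ip_simps)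

lemma sum_row_norm: "feas S \<Longrightarrow> (\<Sum>r\<in>I. inn (S r) (S r)) = real n * real d"
  unfolding sum_I by (simp add: feas_inn)

text \<open>The left side is the squared length of the part of V_a normal to the rows of S_i. Since
  \<open>G\<close> = \<open>V\<close> + \<open>N\<close> has no normal part, that of
  \<open>V\<close> is cancelled by that of \<open>N\<close>.\<close>

lemma normal_part_V:
  assumes loc: "locmax S" and i: "i < n" and a: "a < d"
  shows "inn (V S a) (V S a) - (\<Sum>b<d. (inn (V S a) (S (i, b)))\<^sup>2) \<le> inn (N S (i, a)) (N S (i, a))"
proof -
  have f: "feas S" using loc by (rule locmax_feas)
  define w where "w = (\<lambda>l. V S a l - (\<Sum>b<d. inn (V S a) (S (i, b)) * S (i, b) l))"
  have orth: "inn (S (i, b)) w = 0" if "b < d" for b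
    unfolding w_def ip_diff_right feas_comb[OF f i that] by (simp add: ip_commute)
  have ww: "inn w w = inn (V S a) w"
    by (subst (1) w_def) (simp add: ip_simps orth)
  also have "\<dots> = inn (V S a) (V S a) - (\<Sum>b<d. (inn (V S a) (S (i, b)))\<^sup>2)"
    unfolding w_def by (simp add: ip_simps power2_eq_square)
  finally have w2: "inn w w = \<dots>" .
  have "inn (V S a) w + inn (N S (i, a)) w = 0"
    using first_order_normal[OF loc i a orth] by (simp add: G_eq[OF a] ip_simps)
  then have "inn w w = inn (\<lambda>l. - N S (i, a) l) w"
    using ww by (simp add: ip_simps)
  also have "\<dots> \<le> sqrt (inn (N S (i, a)) (N S (i, a))) * sqrt (inn w w)"
    using ip_le_L2[of "{..<p}" "\<lambda>l. - N S (i, a) l" w] by (simp add: L2_set_minus L2_set_ip)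
  finally have le: "sqrt (inn w w) * sqrt (inn w w) \<le> sqrt (inn (N S (i, a)) (N S (i, a))) * sqrt (inn w w)"
    by simp
  have "inn w w \<le> inn (N S (i, a)) (N S (i, a))"
  proof (cases "inn w w = 0")
    case False
    then have "sqrt (inn w w) > 0" by (simp add: less_le)
    then have "sqrt (inn w w) \<le> sqrt (inn (N S (i, a)) (N S (i, a)))"
      using le mult_le_cancel_right_pos by blast
    then show ?thesis by simp
  qed simp
  then show ?thesis using w2 by simp
qed

text \<open>\<open>normal_part_V\<close> is summed over all rows, with |N|^2 \<le> \<nu>^2 n d. The
  tangential parts are inner products of S_ib with a sum of n rows, so Cauchy-Schwarz over those
  rows costs a factor n, which then cancels throughout.\<close>

lemma V_le_block_sq:
  assumes loc: "locmax S" and nu: "op_bound I I D \<nu>"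
  shows "(\<Sum>a<d. inn (V S a) (V S a)) - \<nu>\<^sup>2 * real d \<le> (\<Sum>i<n. \<Sum>j<n. block_sq S i j)"
proof -
  have f: "feas S" using loc by (rule locmax_feas)
  have "(\<Sum>i<n. \<Sum>a<d. inn (V S a) (V S a) - (\<Sum>b<d. (inn (V S a) (S (i, b)))\<^sup>2)) \<le>
    (\<Sum>i<n. \<Sum>a<d. inn (N S (i, a)) (N S (i, a)))"
    by (rule sum_mono, rule sum_mono) (auto intro: normal_part_V[OF loc])
  also have "\<dots> = (\<Sum>r\<in>I. inn (\<lambda>l. \<Sum>s\<in>I. D r s * S s l) (\<lambda>l. \<Sum>s\<in>I. D r s * S s l))"
    unfolding sum_I N_def ..
  also have "\<dots> \<le> \<nu>\<^sup>2 * (\<Sum>r\<in>I. inn (S r) (S r))"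
    by (rule op_bound_frob[OF nu])
  also have "\<dots> = real n * (\<nu>\<^sup>2 * real d)" using sum_row_norm[OF f] by simp
  finally have 1: "real n * (\<Sum>a<d. inn (V S a) (V S a)) - (\<Sum>i<n. \<Sum>a<d. \<Sum>b<d. (inn (V S a) (S (i, b)))\<^sup>2) \<le> real n * (\<nu>\<^sup>2 * real d)"
    by (simp add: sum_subtractf)
  have "(\<Sum>i<n. \<Sum>a<d. \<Sum>b<d. (inn (V S a) (S (i, b)))\<^sup>2) \<le>
     (\<Sum>i<n. \<Sum>a<d. \<Sum>b<d. real n * (\<Sum>j<n. (inn (S (j, a)) (S (i, b)))\<^sup>2))"
    unfolding inn_V using square_sum_le[of "{..<n}"]
    by (intro sum_mono) simp
  also have "\<dots> = real n * (\<Sum>i<n. \<Sum>j<n. block_sq S j i)"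
    unfolding block_sq_def sum.swap[of _ "{..<d}" "{..<n}"] sum_distrib_left[symmetric]
    by (simp add: sum.swap[of _ "{..<n}" "{..<d}"])
  also have "(\<Sum>i<n. \<Sum>j<n. block_sq S j i) = (\<Sum>i<n. \<Sum>j<n. block_sq S i j)"
    by (rule sum.swap)
  finally have "real n * ((\<Sum>a<d. inn (V S a) (V S a)) - \<nu>\<^sup>2 * real d) \<le> real n * (\<Sum>i<n. \<Sum>j<n. block_sq S i j)"
    using 1 by (simp add: algebra_simps)
  then show ?thesis using n_pos by simp
qed

lemma dist2_eq:
  assumes "feas S" "k < n"
  shows "dist2 S k = 2 * (\<Sum>j<n. \<Sum>a<d. 1 - inn (S (j, a)) (S (k, a)))"
  unfolding dist2_def sum_distrib_left
proof (intro sum.cong refl)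
  fix j a assume "j \<in> {..<n}" "a \<in> {..<d}"
  then show "inn (\<lambda>l. S (j, a) l - S (k, a) l) (\<lambda>l. S (j, a) l - S (k, a) l) = 2 * (1 - inn (S (j, a)) (S (k, a)))"
    using assms ip_commute[of "{..<p}" "S (k, a)" "S (j, a)"] by (simp add: ip_simps feas_inn)
qed

text \<open>The sum of \<open>dist2 S k\<close> over k is exactly 2 (n^2 d - |V|^2), so some block
  does at least as well as the average.\<close>

lemma exists_close_block:
  assumes f: "feas S"
  shows "\<exists>k<n. real n * dist2 S k \<le> 2 * ((real n)\<^sup>2 * real d - (\<Sum>a<d. inn (V S a) (V S a)))"
proof (rule ccontr)
  let ?c = "2 * ((real n)\<^sup>2 * real d - (\<Sum>a<d. inn (V S a) (V S a)))"
  assume "\<not> ?thesis"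
  then have "(\<Sum>k<n. ?c) < (\<Sum>k<n. real n * dist2 S k)"
    using n_pos by (intro sum_strict_mono) (auto simp: not_le lessThan_empty_iff)
  also have "\<dots> = real n * (2 * (\<Sum>k<n. \<Sum>j<n. \<Sum>a<d. 1 - inn (S (j, a)) (S (k, a))))"
    unfolding sum_distrib_left by (intro sum.cong refl) (simp add: dist2_eq[OF f] sum_distrib_left)
  also have "(\<Sum>k<n. \<Sum>j<n. \<Sum>a<d. 1 - inn (S (j, a)) (S (k, a))) = (real n)\<^sup>2 * real d - (\<Sum>a<d. inn (V S a) (V S a))"
  proof -
    have "(\<Sum>k<n. \<Sum>j<n. \<Sum>a<d. inn (S (j, a)) (S (k, a))) = (\<Sum>a<d. inn (V S a) (V S a))"
      unfolding inn_V_right unfolding inn_V sum.swap[of _ "{..<d}" "{..<n}"] ..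
    then show ?thesis by (simp add: sum_subtractf power2_eq_square)
  qed
  finally show False by simp
qed

text \<open>\<open>S\<^sub>i\<^sup>T S\<^sub>i\<close> as a vector in \<open>\<real>\<^sup>p \<otimes> \<real>\<^sup>p\<close>, so that \<open>|S\<^sub>i S\<^sub>j\<^sup>T|\<^sup>2\<close> is a Gram matrix.\<close>

definition W :: "(nat \<times> nat \<Rightarrow> nat \<Rightarrow> real) \<Rightarrow> nat \<Rightarrow> nat \<times> nat \<Rightarrow> real" where
  "W S i = (\<lambda>(l, m). \<Sum>a<d. S (i, a) l * S (i, a) m)"

lemma ip_W: "ip ({..<p} \<times> {..<p}) (W S i) (W S j) = block_sq S i j"
proof -
  have "ip ({..<p} \<times> {..<p}) (W S i) (W S j)
    = (\<Sum>l<p. \<Sum>m<p. (\<Sum>a<d. S (i, a) l * S (i, a) m) * (\<Sum>b<d. S (j, b) l * S (j, b) m))"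
    unfolding ip_def W_def by (simp add: sum.cartesian_product case_prod_beta)
  also have "\<dots> = (\<Sum>l<p. \<Sum>m<p. \<Sum>a<d. \<Sum>b<d. (S (i, a) l * S (j, b) l) * (S (i, a) m * S (j, b) m))"
    unfolding sum_product by (simp only: mult_ac)
  also have "\<dots> = (\<Sum>a<d. \<Sum>b<d. \<Sum>l<p. \<Sum>m<p. (S (i, a) l * S (j, b) l) * (S (i, a) m * S (j, b) m))"
    unfolding sum.swap[of _ "{..<d}" "{..<p}"] ..
  also have "\<dots> = block_sq S i j"
    unfolding block_sq_def ip_def power2_eq_square sum_product ..
  finally show ?thesis .
qed

lemma block_sq_same: "feas S \<Longrightarrow> i < n \<Longrightarrow> block_sq S i i = real d"
  using sum_inn_normal_proj[of S i i] sum_norm_normal_proj[of S i] by (simp add: block_sq_def)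

text \<open>Only the diagonal entries of S_i S_k^T are kept, each through y^2 \<ge> 2 y - 1.\<close>

lemma block_sq_ge:
  assumes f: "feas S"
  shows "2 * (\<Sum>a<d. inn (S (i, a)) (S (k, a))) - real d \<le> block_sq S i k"
proof -
  have "2 * (\<Sum>a<d. inn (S (i, a)) (S (k, a))) - real d = (\<Sum>a<d. 2 * inn (S (i, a)) (S (k, a)) - 1)"
    by (simp add: sum_subtractf sum_distrib_left)
  also have "\<dots> \<le> (\<Sum>a<d. (inn (S (i, a)) (S (k, a)))\<^sup>2)"
  proof (rule sum_mono)
    fix a
    have "0 \<le> (inn (S (i, a)) (S (k, a)) - 1)\<^sup>2" by simp
    then show "2 * inn (S (i, a)) (S (k, a)) - 1 \<le> (inn (S (i, a)) (S (k, a)))\<^sup>2"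
      by (simp add: power2_eq_square algebra_simps)
  qed
  also have "\<dots> \<le> block_sq S i k"
    unfolding block_sq_def by (intro sum_mono member_le_sum) auto
  finally show ?thesis .
qed

text \<open>Here |W_i - W_k|^2 = 2d - 2 |S_i S_k^T|^2, and \<open>block_sq_ge\<close> bounds it by 4
  (d - tr (S_i S_k^T)) = 2 |S_i - S_k|^2.\<close>

lemma sum_W_diff:
  assumes f: "feas S" and k: "k < n"
  shows "(\<Sum>i<n. ip ({..<p} \<times> {..<p}) (\<lambda>q. W S i q - W S k q) (\<lambda>q. W S i q - W S k q)) \<le> 2 * dist2 S k"
proof -
  have "ip ({..<p} \<times> {..<p}) (\<lambda>q. W S i q - W S k q) (\<lambda>q. W S i q - W S k q)
     \<le> 2 * (2 * (\<Sum>a<d. 1 - inn (S (i, a)) (S (k, a))))" if "i < n" for i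
    using block_sq_ge[OF f, of i k] block_sq_same[OF f that] block_sq_same[OF f k] ip_commute[of _ "W S k" "W S i"]
    by (simp add: ip_simps ip_W sum_subtractf)
  then show ?thesis
    unfolding dist2_eq[OF f k] sum_distrib_left by (intro sum_mono) auto
qed

lemma trace_L:
  "(\<Sum>i<n. \<Sum>k<d. L S i k k) = (\<Sum>a<d. inn (V S a) (V S a)) + (\<Sum>r\<in>I. \<Sum>s\<in>I. D r s * inn (S r) (S s))"
proof -
  have "(\<Sum>i<n. \<Sum>k<d. L S i k k) = (\<Sum>i<n. \<Sum>k<d. inn (V S k) (S (i, k)) + inn (N S (i, k)) (S (i, k)))"
    unfolding L_def by (intro sum.cong refl) (simp add: G_eq ip_simps)
  also have "\<dots> = (\<Sum>i<n. \<Sum>k<d. inn (V S k) (S (i, k))) + (\<Sum>r\<in>I. inn (N S r) (S r))"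
    by (simp add: sum.distrib sum_I)
  also have "(\<Sum>i<n. \<Sum>k<d. inn (V S k) (S (i, k))) = (\<Sum>a<d. inn (V S a) (V S a))"
    unfolding sum.swap[of _ "{..<d}" "{..<n}"]
    by (intro sum.cong refl) (simp add: inn_V_right)
  also have "(\<Sum>r\<in>I. inn (N S r) (S r)) = (\<Sum>r\<in>I. \<Sum>s\<in>I. D r s * inn (S r) (S s))"
    unfolding N_def ip_sum_left ip_scale_left by (intro sum.cong refl arg_cong2[of _ _ _ _ "(*)"] ip_commute)
  finally show ?thesis .
qed

lemma T_sym: "i < n \<Longrightarrow> j < n \<Longrightarrow> T i j = T j i"
  unfolding T_def by (intro sum.cong refl) (simp add: D_sym)

text \<open>Polarization between S and Z S_k. At Z S_k the pairing with D collapses to the sum of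
  all T_ij because S_k S_k^T = I. All rows are unit vectors, so |S + Z S_k|^2 \<le> 4 n d.\<close>

lemma noise_D:
  assumes f: "feas S" and k: "k < n" and nu: "op_bound I I D \<nu>"
  shows "(\<Sum>r\<in>I. \<Sum>s\<in>I. D r s * inn (S r) (S s)) - (\<Sum>i<n. \<Sum>j<n. T i j)
    \<le> \<nu> * sqrt (dist2 S k) * sqrt (4 * (real n * real d))"
proof -
  define K where "K = (\<lambda>r :: nat \<times> nat. S (k, snd r))"
  have K: "(\<Sum>r\<in>I. \<Sum>s\<in>I. D r s * inn (K r) (K s)) = (\<Sum>i<n. \<Sum>j<n. T i j)"
  proof -
    have "(\<Sum>r\<in>I. \<Sum>s\<in>I. D r s * inn (K r) (K s)) = (\<Sum>i<n. \<Sum>a<d. \<Sum>j<n. \<Sum>b<d. (if b = a then 1 else 0) * D (i, a) (j, b))"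
      unfolding sum_I K_def by (intro sum.cong refl) (use f k in \<open>auto simp: feas_inn\<close>)
    also have "\<dots> = (\<Sum>i<n. \<Sum>a<d. \<Sum>j<n. D (i, a) (j, a))"
      by (simp add: sum_indicator_mult)
    also have "\<dots> = (\<Sum>i<n. \<Sum>j<n. T i j)"
      unfolding T_def by (intro sum.cong refl sum.swap)
    finally show ?thesis .
  qed
  have nu0: "\<nu> \<ge> 0" using nu by (simp add: op_bound_def)
  have "(\<Sum>r\<in>I. \<Sum>s\<in>I. D r s * inn (S r) (S s)) - (\<Sum>i<n. \<Sum>j<n. T i j)
    = (\<Sum>r\<in>I. \<Sum>s\<in>I. D r s * (inn (S r) (S s) - inn (K r) (K s)))"
    unfolding K[symmetric] by (simp add: sum_subtractf algebra_simps)
  also have "\<dots> \<le> \<nu> * sqrt (\<Sum>r\<in>I. inn (\<lambda>l. S r l - K r l) (\<lambda>l. S r l - K r l))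
      * sqrt (\<Sum>r\<in>I. inn (\<lambda>l. S r l + K r l) (\<lambda>l. S r l + K r l))"
    using op_bound_sym_diff[OF nu, of "{..<p}" S K] D_sym by force
  also have "(\<Sum>r\<in>I. inn (\<lambda>l. S r l - K r l) (\<lambda>l. S r l - K r l)) = dist2 S k"
    unfolding sum_I K_def dist2_def by simp
  finally have "(\<Sum>r\<in>I. \<Sum>s\<in>I. D r s * inn (S r) (S s)) - (\<Sum>i<n. \<Sum>j<n. T i j)
    \<le> \<nu> * sqrt (dist2 S k) * sqrt (\<Sum>r\<in>I. inn (\<lambda>l. S r l + K r l) (\<lambda>l. S r l + K r l))" .
  also have "\<dots> \<le> \<nu> * sqrt (dist2 S k) * sqrt (4 * (real n * real d))"
  proof -
  have "(\<Sum>r\<in>I. inn (\<lambda>l. S r l + K r l) (\<lambda>l. S r l + K r l)) \<le> (\<Sum>r\<in>I. 4)"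
  proof (rule sum_mono)
    fix r assume "r \<in> I"
    then show "inn (\<lambda>l. S r l + K r l) (\<lambda>l. S r l + K r l) \<le> 4"
      using ip_add_le[of "{..<p}" "S r" "K r"] f k by (auto simp: K_def feas_inn)
  qed
  then show ?thesis
    using nu0 dist2_nonneg[of S k] by (intro mult_left_mono real_sqrt_le_mono) auto
  qed
  finally show ?thesis .
qed

text \<open>The same comparison one level up: the vectors W_i against the constant W_k, whose
  squared length is d.\<close>

lemma noise_T:
  assumes f: "feas S" and k: "k < n" and tau: "op_bound {..<n} {..<n} T \<tau>"
  shows "(\<Sum>i<n. \<Sum>j<n. T i j * (real d - block_sq S i j))
    \<le> \<tau> * sqrt (2 * dist2 S k) * sqrt (4 * (real n * real d))"
proof -
  let ?P = "{..<p} \<times> {..<p}"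
  have t0: "\<tau> \<ge> 0" using tau by (simp add: op_bound_def)
  have "(\<Sum>i<n. \<Sum>j<n. T i j * (real d - block_sq S i j)) = - (\<Sum>i<n. \<Sum>j<n. T i j * (ip ?P (W S i) (W S j) - ip ?P (W S k) (W S k)))"
    unfolding ip_W block_sq_same[OF f k] sum_negf[symmetric] by (simp add: algebra_simps)
  also have "\<dots> \<le> \<tau> * sqrt (\<Sum>i<n. ip ?P (\<lambda>q. W S i q - W S k q) (\<lambda>q. W S i q - W S k q))
     * sqrt (\<Sum>i<n. ip ?P (\<lambda>q. W S i q + W S k q) (\<lambda>q. W S i q + W S k q))"
    using op_bound_sym_diff[OF tau, of ?P "W S" "\<lambda>_. W S k"] T_sym by force
  also have "\<dots> \<le> \<tau> * sqrt (2 * dist2 S k) * sqrt (4 * (real n * real d))"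
  proof (intro mult_mono real_sqrt_le_mono sum_W_diff[OF f k])
    have "(\<Sum>i<n. ip ?P (\<lambda>q. W S i q + W S k q) (\<lambda>q. W S i q + W S k q)) \<le> (\<Sum>i<n. 4 * real d)"
    proof (rule sum_mono)
      fix i assume "i \<in> {..<n}"
      then show "ip ?P (\<lambda>q. W S i q + W S k q) (\<lambda>q. W S i q + W S k q) \<le> 4 * real d"
        using ip_add_le[of ?P "W S i" "W S k"] block_sq_same[OF f] k by (auto simp: ip_W)
    qed
    then show "(\<Sum>i<n. ip ?P (\<lambda>q. W S i q + W S k q) (\<lambda>q. W S i q + W S k q)) \<le> 4 * (real n * real d)"
      by simp
  qed (use t0 dist2_nonneg[of S k] in \<open>auto intro!: sum_nonneg\<close>)
  finally show ?thesis .
qed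

end

section \<open>Positive semidefinite forms\<close>

definition mv :: "'b set \<Rightarrow> ('a \<Rightarrow> 'b \<Rightarrow> real) \<Rightarrow> ('b \<Rightarrow> real) \<Rightarrow> 'a \<Rightarrow> real" where
  "mv J K x i = (\<Sum>j\<in>J. K i j * x j)"

lemma mv_add: "mv J K (\<lambda>j. x j + y j) = (\<lambda>i. mv J K x i + mv J K y i)"
  and mv_scale: "mv J K (\<lambda>j. c * x j) = (\<lambda>i. c * mv J K x i)"
  by (auto simp: mv_def algebra_simps sum.distrib sum_subtractf sum_distrib_left)

lemma ip_mv_sym:
  assumes "\<And>i j. i \<in> J \<Longrightarrow> j \<in> J \<Longrightarrow> K i j = K j i"
  shows "ip J x (mv J K y) = ip J y (mv J K x)"
proof -
  have "ip J x (mv J K y) = (\<Sum>i\<in>J. \<Sum>j\<in>J. x i * (K i j * y j))"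
    by (simp add: ip_def mv_def sum_distrib_left)
  also have "\<dots> = (\<Sum>j\<in>J. \<Sum>i\<in>J. x i * (K i j * y j))"
    by (rule sum.swap)
  also have "\<dots> = ip J y (mv J K x)"
    unfolding ip_def mv_def sum_distrib_left
    by (intro sum.cong refl) (simp add: assms mult_ac)
  finally show ?thesis .
qed

text \<open>Cauchy-Schwarz in every coordinate: the operator norm of E is at most its Frobenius
  norm.\<close>

lemma L2_set_comb_le:
  "L2_set (\<lambda>l. \<Sum>s\<in>J. z s * E s l) B \<le> L2_set z J * sqrt (\<Sum>s\<in>J. ip B (E s) (E s))"
proof (rule power2_le_imp_le)
  have "(\<Sum>s\<in>J. z s * E s l)\<^sup>2 \<le> ip J z z * (\<Sum>s\<in>J. E s l * E s l)" for l
    using power_mono[OF abs_ip_le_L2[of J z "\<lambda>s. E s l"], of 2]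
    by (simp add: power_mult_distrib L2_set_power2 ip_def)
  then have "(\<Sum>l\<in>B. (\<Sum>s\<in>J. z s * E s l)\<^sup>2) \<le> (\<Sum>l\<in>B. ip J z z * (\<Sum>s\<in>J. E s l * E s l))"
    by (intro sum_mono)
  also have "\<dots> = ip J z z * (\<Sum>s\<in>J. ip B (E s) (E s))"
    unfolding sum_distrib_left[symmetric] ip_def[of B] sum.swap[of _ J B] ..
  finally show "(L2_set (\<lambda>l. \<Sum>s\<in>J. z s * E s l) B)\<^sup>2 \<le> (L2_set z J * sqrt (\<Sum>s\<in>J. ip B (E s) (E s)))\<^sup>2"
    by (simp add: power_mult_distrib L2_set_power2 sum_nonneg) (simp add: ip_def power2_eq_square)
qed (simp add: sum_nonneg)

lemma quadratic_form_bounded: "\<exists>C>0. \<forall>x. ip J x (mv J K x) \<le> C * ip J x x"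
proof -
  define c where "c = sqrt (\<Sum>s\<in>J. ip J (\<lambda>l. K l s) (\<lambda>l. K l s))"
  have c: "c \<ge> 0" unfolding c_def by (simp add: sum_nonneg)
  have "ip J x (mv J K x) \<le> (c + 1) * ip J x x" for x
  proof -
    have "L2_set (mv J K x) J \<le> L2_set x J * c"
      using L2_set_comb_le[of x "\<lambda>s l. K l s" J J] by (simp add: mv_def[abs_def] c_def mult.commute)
    then have "L2_set x J * L2_set (mv J K x) J \<le> L2_set x J * (L2_set x J * c)"
      by (intro mult_left_mono) auto
    also have "\<dots> = c * ip J x x"
      using L2_set_power2[of x J] by (simp add: power2_eq_square)
    also have "\<dots> \<le> (c + 1) * ip J x x"
      by (intro mult_right_mono) auto
    finally show ?thesis using ip_le_L2[of J x "mv J K x"] by linarith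
  qed
  \<comment> \<open>Adding 1 to the Frobenius norm keeps C positive even for the zero matrix, so
    that it can be divided by.\<close>
  with c show ?thesis by (intro exI[of _ "c + 1"]) auto
qed

text \<open>If \<open>a\<close> is the largest number with \<open>a I \<le> K\<close> and \<open>a < \<kappa>\<close>, then \<open>|(K - a) x|\<^sup>2 \<le> C x\<^sup>T (K - a) x\<close>
  while \<open>|(K - a) x| \<ge> (\<kappa> - a) |x|\<close>, so \<open>a\<close> could be increased.\<close>

lemma psd_lower_bound:
  assumes fin: "finite J"
    and sym: "\<And>i j. i \<in> J \<Longrightarrow> j \<in> J \<Longrightarrow> K i j = K j i"
    and psd: "\<And>x. 0 \<le> ip J x (mv J K x)"
    and lower: "\<And>x. \<kappa> * L2_set x J \<le> L2_set (mv J K x) J"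
  shows "\<kappa> * ip J x x \<le> ip J x (mv J K x)"
proof (cases "J = {}")
  case True then show ?thesis by (simp add: ip_def)
next
  case False
  then obtain j where j: "j \<in> J" by blast
  define R where "R = {a. \<forall>x. a * ip J x x \<le> ip J x (mv J K x)}"
  have R0: "0 \<in> R" using psd by (simp add: R_def)
  define e where "e = (\<lambda>i. if i = j then 1 else (0::real))"
  have e: "ip J e e = 1" unfolding ip_def e_def using fin j by (simp add: sum_indicator_mult)
  have bdd: "bdd_above R"
  proof (rule bdd_aboveI)
    fix a assume "a \<in> R"
    then show "a \<le> ip J e (mv J K e)" using e unfolding R_def by (metis (mono_tags, lifting) mem_Collect_eq mult.right_neutral)
  qed
  define a where "a = Sup R"
  have a0: "a \<ge> 0" unfolding a_def using R0 bdd by (rule cSup_upper)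
  have aR: "a * ip J x x \<le> ip J x (mv J K x)" for x
  proof (cases "ip J x x = 0")
    case True then show ?thesis using psd[of x] by simp
  next
    case False
    then have pos: "ip J x x > 0" by (simp add: less_le)
    have "a \<le> ip J x (mv J K x) / ip J x x"
      unfolding a_def
    proof (rule cSup_least)
      fix b assume "b \<in> R"
      then show "b \<le> ip J x (mv J K x) / ip J x x"
        using pos by (simp add: R_def pos_le_divide_eq)
    qed (use R0 in auto)
    then show ?thesis using pos by (simp add: pos_le_divide_eq)
  qed
  have "\<kappa> \<le> a"
  proof (rule ccontr)
    assume "\<not> \<kappa> \<le> a"
    then have ka: "\<kappa> - a > 0" by simp
    obtain C where C: "C > 0" and CK: "\<And>x. ip J x (mv J K x) \<le> C * ip J x x"
      using quadratic_form_bounded by blast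
    have "(a + (\<kappa> - a)\<^sup>2 / C) * ip J x x \<le> ip J x (mv J K x)" for x
    proof -
      define y where "y = (\<lambda>i. mv J K x i - a * x i)"
      define r where "r = ip J x (mv J K x) - a * ip J x x"
      define s where "s = ip J y y"
      have Kxy: "ip J y (mv J K x) = ip J x (mv J K y)"
        by (rule ip_mv_sym) (rule sym)
      have "s = ip J y (mv J K x) - a * ip J y x"
        unfolding s_def by (subst (2) y_def) (simp only: ip_diff_right ip_scale_right)
      then have Bxy: "ip J x (mv J K y) = s + a * ip J x y"
        unfolding Kxy ip_commute[of J y x] by simp
      \<comment> \<open>The nonnegative form K - a is evaluated at x - y / C with y = (K - a) x. As
        K - a is at most C on y, the value is at most r - s / C.\<close>
      have "0 \<le> ip J (\<lambda>i. x i + (- 1 / C) * y i) (mv J K (\<lambda>i. x i + (- 1 / C) * y i))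
          - a * ip J (\<lambda>i. x i + (- 1 / C) * y i) (\<lambda>i. x i + (- 1 / C) * y i)"
        using aR by simp
      also have "\<dots> = r + 2 * (- 1 / C) * s + (- 1 / C)\<^sup>2 * (ip J y (mv J K y) - a * s)"
        unfolding mv_add mv_scale ip_add_left ip_add_right ip_scale_left ip_scale_right
          Kxy Bxy ip_commute[of J y x] r_def s_def[symmetric]
        by (simp add: algebra_simps power2_eq_square)
      also have "\<dots> \<le> r + 2 * (- 1 / C) * s + (- 1 / C)\<^sup>2 * (C * s)"
      proof (intro add_left_mono mult_left_mono)
        have "0 \<le> a * s" using a0 by (simp add: s_def)
        then show "ip J y (mv J K y) - a * s \<le> C * s" using CK[of y] by (simp add: s_def)
      qed simp
      also have "\<dots> = r - s / C"
        using C by (simp add: power2_eq_square field_simps)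
      finally have sr: "s / C \<le> r" by simp
      have "(\<kappa> - a) * L2_set x J \<le> L2_set y J"
      proof -
        have "\<kappa> * L2_set x J \<le> L2_set (\<lambda>i. y i + a * x i) J"
          using lower[of x] by (simp add: y_def)
        also have "\<dots> \<le> L2_set y J + a * L2_set x J"
          using L2_set_triangle_ineq[of y "\<lambda>i. a * x i" J] a0 by (simp add: L2_set_scale)
        finally show ?thesis by (simp add: algebra_simps)
      qed
      then have "((\<kappa> - a) * L2_set x J)\<^sup>2 \<le> (L2_set y J)\<^sup>2"
        using ka by (intro power_mono) auto
      then have "(\<kappa> - a)\<^sup>2 * ip J x x \<le> s"
        by (simp add: power_mult_distrib L2_set_power2 s_def)
      then have "(\<kappa> - a)\<^sup>2 * ip J x x / C \<le> s / C"
        using C by (simp add: divide_right_mono)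
      with sr show ?thesis by (simp add: r_def algebra_simps)
    qed
    then have "a + (\<kappa> - a)\<^sup>2 / C \<in> R" by (simp add: R_def)
    then have "a + (\<kappa> - a)\<^sup>2 / C \<le> a" unfolding a_def using bdd by (rule cSup_upper)
    moreover have "(\<kappa> - a)\<^sup>2 / C > 0" using ka C by simp
    ultimately show False by simp
  qed
  then have "\<kappa> * ip J x x \<le> a * ip J x x" by (intro mult_right_mono) auto
  with aR[of x] show ?thesis by linarith
qed

text \<open>With c as defined below, the hypothesis becomes q^2 - 4 c q \<le> 2 d^2 \<nu>^2 / (n e).
  The right side is smaller than c^2, so q stays below the larger root 2 c + sqrt 5 c of q^2 - 4 c q
  = c^2.\<close>

lemma proximity_scalar:
  fixes P d n \<gamma> \<nu> \<tau> q :: real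
  assumes "d \<ge> 1" "n \<ge> 1" "P - 2 * d > 0" "\<gamma> \<ge> 1" "\<nu> > 0" "q \<ge> 0" "\<tau> \<le> \<gamma> * \<nu>"
    and ineq: "(P - 2 * d) * (n / 2) * q\<^sup>2 \<le>
      d\<^sup>2 * \<nu>\<^sup>2 + (P - d) * (\<nu> * q * sqrt (4 * (n * d))) + \<tau> * (sqrt 2 * q) * sqrt (4 * (n * d))"
  shows "q < (2 + sqrt 5) * (P + d) * \<gamma> / (P - 2 * d) * sqrt (d / n) * \<nu>"
proof (rule ccontr)
  assume neg: "\<not> ?thesis"
  define e where "e = P - 2 * d"
  define m where "m = sqrt (n * d)"
  define c where "c = (P + d) * \<gamma> * \<nu> * m / (n * e)"
  have e: "e > 0" using assms by (simp add: e_def)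
  have nd: "n > 0" "d > 0" using assms by auto
  have m: "m > 0" "m * m = n * d" using nd by (auto simp: m_def)
  have sq: "sqrt (d / n) = m / n"
    unfolding m_def using nd by (simp add: real_sqrt_mult real_sqrt_divide field_simps)
  have m4: "sqrt (4 * (n * d)) = 2 * m" by (simp add: m_def real_sqrt_mult)
  have c: "c > 0" unfolding c_def using assms e m nd by (intro divide_pos_pos mult_pos_pos) auto
  have qc: "(2 + sqrt 5) * c \<le> q"
    using neg unfolding sq c_def e_def[symmetric] by (simp add: field_simps)
  \<comment> \<open>Replacing sqrt 2 by 2d lets the weight of the partial-trace noise add to P - d,
    which gives the factor P + d of \<open>\<delta>\<close>.\<close>
  have s2: "sqrt 2 \<le> 2 * d"
  proof -
    have "sqrt 2 \<le> sqrt (2\<^sup>2)" by (intro real_sqrt_le_mono) simp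
    then show ?thesis using assms by simp
  qed
  have "(P - d) * (\<nu> * q * (2 * m)) + \<tau> * (sqrt 2 * q) * (2 * m) \<le> 2 * q * c * n * e"
  proof -
    have "\<tau> * (sqrt 2 * q * (2 * m)) \<le> \<gamma> * \<nu> * (2 * d * q * (2 * m))"
    proof -
      have "\<tau> * (sqrt 2 * q * (2 * m)) \<le> \<gamma> * \<nu> * (sqrt 2 * q * (2 * m))"
        using assms m by (intro mult_right_mono) auto
      also have "\<dots> \<le> \<gamma> * \<nu> * (2 * d * q * (2 * m))"
        using s2 assms m by (intro mult_left_mono mult_right_mono) auto
      finally show ?thesis .
    qed
    moreover have "(P - d) * (\<nu> * q * (2 * m)) \<le> \<gamma> * ((P - d) * (\<nu> * q * (2 * m)))"
      using mult_right_mono[of 1 \<gamma> "(P - d) * (\<nu> * q * (2 * m))"] assms m by simp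
    ultimately have "(P - d) * (\<nu> * q * (2 * m)) + \<tau> * (sqrt 2 * q) * (2 * m)
        \<le> \<gamma> * ((P - d) * (\<nu> * q * (2 * m))) + \<gamma> * \<nu> * (2 * d * q * (2 * m))"
      unfolding mult.assoc[of \<tau>] by linarith
    also have "\<dots> = 2 * q * ((P + d) * \<gamma> * \<nu> * m)" by (simp add: algebra_simps)
    also have "(P + d) * \<gamma> * \<nu> * m = c * n * e" unfolding c_def using nd e by simp
    finally show ?thesis by (simp add: mult_ac)
  qed
  with ineq have "e * (n / 2) * q\<^sup>2 \<le> d\<^sup>2 * \<nu>\<^sup>2 + 2 * q * c * n * e"
    unfolding m4 e_def by linarith
  then have le: "e * n * (q\<^sup>2 - 4 * c * q) \<le> 2 * d\<^sup>2 * \<nu>\<^sup>2" by (simp add: algebra_simps)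
  have "sqrt 5 * c \<le> q - 2 * c" using qc by (simp add: algebra_simps)
  then have "(sqrt 5 * c)\<^sup>2 \<le> (q - 2 * c)\<^sup>2" using c by (intro power_mono) auto
  then have "c\<^sup>2 \<le> q\<^sup>2 - 4 * c * q" by (simp add: power_mult_distrib power2_diff algebra_simps)
  then have "e * n * c\<^sup>2 \<le> e * n * (q\<^sup>2 - 4 * c * q)" using e nd by (intro mult_left_mono) auto
  with le have "e * n * c\<^sup>2 \<le> 2 * d\<^sup>2 * \<nu>\<^sup>2" by linarith
  moreover have "e * n * c\<^sup>2 = (P + d)\<^sup>2 * \<gamma>\<^sup>2 * \<nu>\<^sup>2 * d / e"
  proof -
    have "e * n * c\<^sup>2 = (P + d)\<^sup>2 * \<gamma>\<^sup>2 * \<nu>\<^sup>2 * (m * m) / (n * e)"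
      unfolding c_def using e nd by (simp add: power2_eq_square)
    then show ?thesis using m nd e by simp
  qed
  ultimately have "(P + d)\<^sup>2 * \<gamma>\<^sup>2 * \<nu>\<^sup>2 * d \<le> 2 * d\<^sup>2 * \<nu>\<^sup>2 * e"
    using e by (simp add: pos_divide_le_eq)
  then have "((P + d)\<^sup>2 * \<gamma>\<^sup>2) * (\<nu>\<^sup>2 * d) \<le> (2 * d * e) * (\<nu>\<^sup>2 * d)"
    by (simp add: power2_eq_square mult_ac)
  then have "(P + d)\<^sup>2 * \<gamma>\<^sup>2 \<le> 2 * d * e"
    using assms by (simp add: mult_le_cancel_right)
  moreover have "(P + d)\<^sup>2 * 1 \<le> (P + d)\<^sup>2 * \<gamma>\<^sup>2"
    using assms by (intro mult_left_mono one_le_power) auto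
  \<comment> \<open>This comparison absorbs the constant term d^2 \<nu>^2 into c^2 and makes the
    final bound strict.\<close>
  moreover have "2 * d * e < (P + d)\<^sup>2"
  proof -
    have "(P + d)\<^sup>2 - 2 * d * e = P\<^sup>2 + 5 * d\<^sup>2" unfolding e_def by (simp add: power2_eq_square algebra_simps)
    moreover have "0 < P\<^sup>2 + 5 * d\<^sup>2" using nd by (intro add_nonneg_pos) auto
    ultimately show ?thesis by linarith
  qed
  ultimately show False by linarith
qed

context sync
begin

text \<open>Inserting \<open>V_le_block_sq\<close> into the averaged condition leaves (p - 2d) (n^2
  d - |V|^2) against d^2 \<nu>^2, (p - d) times the \<open>noise_D\<close> difference and the
  \<open>noise_T\<close> difference: the sum of the T_ij is split as (p - 2d) = (p - d) - d.\<close>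

lemma proximity_ineq:
  assumes loc: "locmax S" and nu: "op_bound I I D \<nu>" and tau: "op_bound {..<n} {..<n} T \<tau>"
  shows "\<exists>k<n. (real p - 2 * real d) * (real n / 2) * dist2 S k \<le> (real d)\<^sup>2 * \<nu>\<^sup>2
      + (real p - real d) * (\<nu> * sqrt (dist2 S k) * sqrt (4 * (real n * real d)))
      + \<tau> * (sqrt 2 * sqrt (dist2 S k)) * sqrt (4 * (real n * real d))"
proof -
  have f: "feas S" using loc by (rule locmax_feas)
  obtain k where k: "k < n" and close: "real n * dist2 S k \<le> 2 * ((real n)\<^sup>2 * real d - (\<Sum>a<d. inn (V S a) (V S a)))"
    using exists_close_block[OF f] by blast
  define vv where "vv = (\<Sum>a<d. inn (V S a) (V S a))"
  define x2 where "x2 = (\<Sum>i<n. \<Sum>j<n. block_sq S i j)"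
  define tt where "tt = (\<Sum>i<n. \<Sum>j<n. T i j)"
  define tx where "tx = (\<Sum>i<n. \<Sum>j<n. T i j * block_sq S i j)"
  define dx where "dx = (\<Sum>r\<in>I. \<Sum>s\<in>I. D r s * inn (S r) (S s))"
  define B1 where "B1 = \<nu> * sqrt (dist2 S k) * sqrt (4 * (real n * real d))"
  define B2 where "B2 = \<tau> * (sqrt 2 * sqrt (dist2 S k)) * sqrt (4 * (real n * real d))"
  have trA: "(\<Sum>k<d. A (i, k) (j, k)) = real d + T i j" for i j
    unfolding A_def T_def by (simp add: sum.distrib)
  have "(\<Sum>i<n. \<Sum>j<n. (real d + T i j) * (real p - 2 * real d + block_sq S i j)) \<le> (real p - real d) * (vv + dx)"
    using averaged_second_order[OF loc] unfolding trA trace_L block_sq_def vv_def dx_def .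
  moreover have "(\<Sum>i<n. \<Sum>j<n. (real d + T i j) * (real p - 2 * real d + block_sq S i j))
     = real d * (real p - 2 * real d) * (real n)\<^sup>2 + real d * x2 + (real p - 2 * real d) * tt + tx"
    unfolding x2_def tt_def tx_def
    by (simp add: distrib_left distrib_right sum.distrib sum_distrib_left power2_eq_square) (simp add: mult_ac)
  ultimately have avg: "real d * (real p - 2 * real d) * (real n)\<^sup>2 + real d * x2 + (real p - 2 * real d) * tt + tx
     \<le> (real p - real d) * (vv + dx)" by simp
  have 1: "dx - tt \<le> B1" using noise_D[OF f k nu] by (simp add: dx_def tt_def B1_def)
  have 2: "real d * tt - tx \<le> B2"
    using noise_T[OF f k tau]
    by (simp add: tt_def tx_def B2_def sum_subtractf right_diff_distrib sum_distrib_left real_sqrt_mult mult.commute[of "T _ _"])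
  have "real d * (vv - \<nu>\<^sup>2 * real d) \<le> real d * x2"
    using V_le_block_sq[OF loc nu] by (intro mult_left_mono) (auto simp: vv_def x2_def)
  then have 3: "real d * vv - (real d)\<^sup>2 * \<nu>\<^sup>2 \<le> real d * x2" by (simp add: algebra_simps power2_eq_square)
  have 4: "(real p - real d) * (dx - tt) \<le> (real p - real d) * B1"
    using 1 p_large by (intro mult_left_mono) auto
  have "(real p - 2 * real d) * (real n / 2 * dist2 S k) \<le> (real p - 2 * real d) * ((real n)\<^sup>2 * real d - vv)"
    using close p_large by (intro mult_left_mono) (auto simp: vv_def)
  also have "\<dots> \<le> (real d)\<^sup>2 * \<nu>\<^sup>2 + (real p - real d) * B1 + B2"
    using avg 2 3 4 by (simp add: algebra_simps)
  finally show ?thesis using k unfolding B1_def B2_def by (auto simp: mult.assoc)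
qed

lemma proximity:
  assumes loc: "locmax S" and nu: "op_bound I I D \<nu>" "\<nu> > 0" and tau: "op_bound {..<n} {..<n} T \<tau>"
    and g: "\<gamma> \<ge> 1" "\<tau> \<le> \<gamma> * \<nu>"
  shows "\<exists>k<n. sqrt (dist2 S k) < (2 + sqrt 5) * (real p + real d) * \<gamma> / (real p - 2 * real d) * sqrt (real d / real n) * \<nu>"
proof -
  from proximity_ineq[OF loc nu(1) tau] obtain k where k: "k < n"
    and "(real p - 2 * real d) * (real n / 2) * dist2 S k \<le> (real d)\<^sup>2 * \<nu>\<^sup>2
      + (real p - real d) * (\<nu> * sqrt (dist2 S k) * sqrt (4 * (real n * real d)))
      + \<tau> * (sqrt 2 * sqrt (dist2 S k)) * sqrt (4 * (real n * real d))" by blast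
  then have "sqrt (dist2 S k) < (2 + sqrt 5) * (real p + real d) * \<gamma> / (real p - 2 * real d) * sqrt (real d / real n) * \<nu>"
    using g nu n_pos d_pos p_large dist2_nonneg[of S k]
    by (intro proximity_scalar) auto
  with k show ?thesis by blast
qed

end

section \<open>The dual certificate\<close>

text \<open>Injectivity of a square matrix excludes determinant zero, hence gives a right inverse.
  It serves to solve for the component in the column space of F.\<close>

lemma mv_surj_of_inj:
  fixes K :: "nat \<Rightarrow> nat \<Rightarrow> real"
  assumes inj: "\<And>x. (\<And>a. a < d \<Longrightarrow> mv {..<d} K x a = 0) \<Longrightarrow> (\<And>a. a < d \<Longrightarrow> x a = 0)"
  shows "\<exists>\<xi>. \<forall>a<d. mv {..<d} K \<xi> a = \<eta> a"
proof -
  define Q where "Q = mat d d (\<lambda>(a, b). K a b)"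
  have Q: "Q \<in> carrier_mat d d" by (simp add: Q_def)
  have Qv: "(Q *\<^sub>v v) $ a = mv {..<d} K (\<lambda>b. v $ b) a" if "v \<in> carrier_vec d" "a < d" for v a
    using that by (simp add: Q_def scalar_prod_def mv_def atLeast0LessThan)
  have "det Q \<noteq> 0"
  proof
    assume "det Q = 0"
    then obtain v where v: "v \<in> carrier_vec d" "v \<noteq> 0\<^sub>v d" "Q *\<^sub>v v = 0\<^sub>v d"
      using det_0_iff_vec_prod_zero_field[OF Q] by blast
    have "v $ a = 0" if "a < d" for a
    proof (rule inj[of "\<lambda>b. v $ b", OF _ that])
      fix a assume "a < d"
      then show "mv {..<d} K (\<lambda>b. v $ b) a = 0"
        using Qv[OF v(1), of a] v(3) by simp
    qed
    then have "v = 0\<^sub>v d" using v(1) by (intro eq_vecI) auto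
    with v(2) show False by simp
  qed
  from det_non_zero_imp_unit[OF Q this, unfolded Units_def, of "()"]
  obtain B where B: "B \<in> carrier_mat d d" and QB: "Q * B = 1\<^sub>m d"
    by (auto simp: ring_mat_def)
  define v where "v = B *\<^sub>v vec d \<eta>"
  have v: "v \<in> carrier_vec d" unfolding v_def using B by simp
  have "Q *\<^sub>v v = vec d \<eta>"
    unfolding v_def using Q B QB by (simp flip: assoc_mult_mat_vec)
  then have "mv {..<d} K (\<lambda>b. v $ b) a = \<eta> a" if "a < d" for a
    using Qv[OF v that] that by simp
  then show ?thesis by blast
qed

context sync
begin

text \<open>The form of V S_k^T, summed over blocks j. The vectors x^T S_j and x^T S_k have equal
  length, so their inner product is |x|^2 minus half the squared distance, and that distance is at
  most |x| |S_j - S_k|.\<close>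

lemma V_comb_lower:
  assumes f: "feas S" and k: "k < n"
  shows "(real n - dist2 S k / 2) * ip {..<d} x x \<le> inn (\<lambda>l. \<Sum>a<d. x a * V S a l) (\<lambda>l. \<Sum>a<d. x a * S (k, a) l)"
proof -
  define u where "u = (\<lambda>j l. \<Sum>a<d. x a * S (j, a) l)"
  define e where "e = (\<lambda>j. \<Sum>a<d. inn (\<lambda>l. S (j, a) l - S (k, a) l) (\<lambda>l. S (j, a) l - S (k, a) l))"
  have comb_row: "inn (u j) (u j) = ip {..<d} x x" if "j < n" for j
    unfolding u_def by (rule feas_comb2[OF f that])
  have "ip {..<d} x x - ip {..<d} x x * e j / 2 \<le> inn (u j) (u k)" if j: "j < n" for j
  proof -
    have "(\<lambda>l. u j l - u k l) = (\<lambda>l. \<Sum>a<d. x a * (S (j, a) l - S (k, a) l))"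
      by (simp add: u_def fun_eq_iff algebra_simps sum_subtractf)
    then have "L2_set (\<lambda>l. u j l - u k l) {..<p} \<le> L2_set x {..<d} * sqrt (e j)"
      using L2_set_comb_le[of x "\<lambda>a l. S (j, a) l - S (k, a) l" "{..<d}" "{..<p}"] by (simp add: e_def)
    then have "(L2_set (\<lambda>l. u j l - u k l) {..<p})\<^sup>2 \<le> (L2_set x {..<d} * sqrt (e j))\<^sup>2"
      by (intro power_mono) auto
    then have "inn (\<lambda>l. u j l - u k l) (\<lambda>l. u j l - u k l) \<le> ip {..<d} x x * e j"
      by (simp add: power_mult_distrib L2_set_power2 e_def sum_nonneg)
    moreover have "inn (\<lambda>l. u j l - u k l) (\<lambda>l. u j l - u k l) = 2 * ip {..<d} x x - 2 * inn (u j) (u k)"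
      using comb_row[OF j] comb_row[OF k] ip_commute[of _ "u k" "u j"] by (simp add: ip_simps)
    ultimately show ?thesis by simp
  qed
  then have "(\<Sum>j<n. ip {..<d} x x - ip {..<d} x x * e j / 2) \<le> (\<Sum>j<n. inn (u j) (u k))"
    by (intro sum_mono) auto
  moreover have "(\<Sum>j<n. ip {..<d} x x - ip {..<d} x x * e j / 2) = (real n - dist2 S k / 2) * ip {..<d} x x"
    unfolding dist2_def e_def[symmetric] by (simp add: sum_subtractf algebra_simps sum_distrib_right flip: sum_divide_distrib)
  moreover have "(\<Sum>j<n. inn (u j) (u k)) = inn (\<lambda>l. \<Sum>a<d. x a * V S a l) (u k)"
  proof -
    have "(\<lambda>l. \<Sum>a<d. x a * V S a l) = (\<lambda>l. \<Sum>j<n. u j l)"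
      unfolding V_def u_def sum_distrib_left sum.swap[of _ "{..<n}" "{..<d}"] ..
    then show ?thesis by (simp add: ip_simps)
  qed
  ultimately show ?thesis unfolding u_def by simp
qed

text \<open>The noise in x^T G_i is z^T S with z = \<Delta>_i x. Writing S = (S - Z S_k) + Z S_k,
  the first part costs \<mu> |S - Z S_k|; in the second the blocks of z are summed, which is
  (\<Delta>_i^T Z)^T x and costs only \<zeta>.\<close>

lemma G_comb_lower:
  assumes f: "feas S" and k: "k < n" and i: "i < n"
    and mu: "op_bound I {..<d} (\<lambda>s a. D (i, a) s) \<mu>"
    and zeta: "op_bound {..<d} {..<d} (\<lambda>b a. \<Sum>j<n. D (i, a) (j, b)) \<zeta>"
  shows "(real n - dist2 S k / 2 - \<zeta> - sqrt (dist2 S k) * \<mu>) * L2_set x {..<d}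
    \<le> L2_set (\<lambda>l. \<Sum>a<d. x a * G S (i, a) l) {..<p}"
proof -
  define nx where "nx = L2_set x {..<d}"
  define y where "y = (\<lambda>l. \<Sum>a<d. x a * G S (i, a) l)"
  define v where "v = (\<lambda>l. \<Sum>a<d. x a * V S a l)"
  define z where "z = (\<lambda>s. \<Sum>a<d. D (i, a) s * x a)"
  define z1 where "z1 = (\<lambda>l. \<Sum>s\<in>I. z s * (S s l - S (k, snd s) l))"
  define z2 where "z2 = (\<lambda>l. \<Sum>b<d. (\<Sum>j<n. z (j, b)) * S (k, b) l)"
  have nx0: "nx \<ge> 0" by (simp add: nx_def)
  have yv: "y l = v l + (z1 l + z2 l)" for l
  proof -
    have "y l = v l + (\<Sum>a<d. x a * N S (i, a) l)"
      unfolding y_def v_def sum.distrib[symmetric] by (intro sum.cong refl) (simp add: G_eq distrib_left)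
    also have "(\<Sum>a<d. x a * N S (i, a) l) = (\<Sum>s\<in>I. z s * S s l)"
      unfolding N_def z_def sum_distrib_left sum_distrib_right sum.swap[of _ I "{..<d}"] by (simp add: mult_ac)
    also have "\<dots> = z1 l + (\<Sum>s\<in>I. z s * S (k, snd s) l)"
      unfolding z1_def sum.distrib[symmetric] by (simp add: algebra_simps)
    also have "(\<Sum>s\<in>I. z s * S (k, snd s) l) = z2 l"
      unfolding z2_def sum_I sum_distrib_right snd_conv by (rule sum.swap)
    finally show ?thesis .
  qed
  have "L2_set z1 {..<p} \<le> L2_set z I * sqrt (dist2 S k)"
    using L2_set_comb_le[of z "\<lambda>s l. S s l - S (k, snd s) l" I "{..<p}"]
    unfolding z1_def dist2_def sum_I snd_conv .
  also have "\<dots> \<le> (\<mu> * nx) * sqrt (dist2 S k)"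
    using mu dist2_nonneg[of S k] unfolding z_def nx_def op_bound_def by (intro mult_right_mono) auto
  finally have 1: "L2_set z1 {..<p} \<le> \<mu> * nx * sqrt (dist2 S k)" .
  have "L2_set z2 {..<p} = L2_set (\<lambda>b. \<Sum>j<n. z (j, b)) {..<d}"
    unfolding z2_def L2_set_ip feas_comb2[OF f k] ..
  also have "(\<lambda>b. \<Sum>j<n. z (j, b)) = (\<lambda>b. \<Sum>a<d. (\<Sum>j<n. D (i, a) (j, b)) * x a)"
    unfolding z_def sum_distrib_right sum.swap[of _ "{..<d}" "{..<n}"] ..
  also have "L2_set \<dots> {..<d} \<le> \<zeta> * nx"
    using zeta unfolding op_bound_def nx_def by blast
  finally have 2: "L2_set z2 {..<p} \<le> \<zeta> * nx" .
  have "(real n - dist2 S k / 2) * (nx * nx) \<le> L2_set v {..<p} * nx"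
  proof -
    have "(real n - dist2 S k / 2) * (nx * nx) = (real n - dist2 S k / 2) * ip {..<d} x x"
      using L2_set_power2[of x "{..<d}"] by (simp add: nx_def power2_eq_square)
    also have "\<dots> \<le> inn v (\<lambda>l. \<Sum>a<d. x a * S (k, a) l)"
      unfolding v_def by (rule V_comb_lower[OF f k])
    also have "\<dots> \<le> L2_set v {..<p} * L2_set (\<lambda>l. \<Sum>a<d. x a * S (k, a) l) {..<p}"
      by (rule ip_le_L2)
    also have "L2_set (\<lambda>l. \<Sum>a<d. x a * S (k, a) l) {..<p} = nx"
      unfolding nx_def L2_set_ip feas_comb2[OF f k] ..
    finally show ?thesis .
  qed
  then have 3: "(real n - dist2 S k / 2) * nx \<le> L2_set v {..<p}"
    using nx0 by (cases "nx = 0") (auto simp: less_le simp flip: mult.assoc)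
  have "L2_set v {..<p} = L2_set (\<lambda>l. y l + ((- z1 l) + (- z2 l))) {..<p}"
    using yv by simp
  also have "\<dots> \<le> L2_set y {..<p} + L2_set (\<lambda>l. (- z1 l) + (- z2 l)) {..<p}"
    by (rule L2_set_triangle_ineq)
  also have "L2_set (\<lambda>l. (- z1 l) + (- z2 l)) {..<p} \<le> L2_set z1 {..<p} + L2_set z2 {..<p}"
    using L2_set_triangle_ineq[of "\<lambda>l. - z1 l" "\<lambda>l. - z2 l" "{..<p}"] by (simp add: L2_set_minus)
  finally have "L2_set v {..<p} \<le> L2_set y {..<p} + (L2_set z1 {..<p} + L2_set z2 {..<p})" by simp
  with 1 2 3 show ?thesis
    unfolding y_def[symmetric] nx_def[symmetric] by (simp add: algebra_simps)
qed

lemma qf_L: "(\<Sum>a<d. \<Sum>b<d. x a * x b * L S i a b) = ip {..<d} x (mv {..<d} (L S i) x)"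
  by (simp add: ip_def mv_def sum_distrib_left mult_ac)

text \<open>Since x^T G_i = (L_i x)^T S_i has the length of L_i x, \<open>G_comb_lower\<close>
  bounds |L_i x| from below; nonnegativity of L_i turns this into a bound on the form
  itself.\<close>

lemma L_lower:
  assumes loc: "locmax S" and k: "k < n" and i: "i < n"
    and mu: "op_bound I {..<d} (\<lambda>s a. D (i, a) s) \<mu>"
    and zeta: "op_bound {..<d} {..<d} (\<lambda>b a. \<Sum>j<n. D (i, a) (j, b)) \<zeta>"
  shows "(real n - dist2 S k / 2 - \<zeta> - sqrt (dist2 S k) * \<mu>) * ip {..<d} x x
    \<le> ip {..<d} x (mv {..<d} (L S i) x)"
proof (rule psd_lower_bound)
  have f: "feas S" using loc by (rule locmax_feas)
  show "L S i a b = L S i b a" if "a \<in> {..<d}" "b \<in> {..<d}" for a b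
    using that by (intro L_sym[OF loc i]) auto
  show "0 \<le> ip {..<d} x (mv {..<d} (L S i) x)" for x
    using L_nonneg[OF loc i, of x] by (simp add: qf_L)
  show "(real n - dist2 S k / 2 - \<zeta> - sqrt (dist2 S k) * \<mu>) * L2_set x {..<d}
    \<le> L2_set (mv {..<d} (L S i) x) {..<d}" for x
  proof -
    have "L2_set (\<lambda>l. \<Sum>a<d. x a * G S (i, a) l) {..<p} = L2_set (\<lambda>l. \<Sum>b<d. mv {..<d} (L S i) x b * S (i, b) l) {..<p}"
    proof (rule L2_set_cong[OF refl])
      fix l assume l: "l \<in> {..<p}"
      have "(\<Sum>a<d. x a * G S (i, a) l) = (\<Sum>a<d. \<Sum>b<d. L S i a b * x a * S (i, b) l)"
        using first_order_expand[OF loc i] l by (intro sum.cong refl) (simp add: sum_distrib_left mult_ac)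
      also have "\<dots> = (\<Sum>b<d. \<Sum>a<d. L S i a b * x a * S (i, b) l)"
        by (rule sum.swap)
      also have "\<dots> = (\<Sum>b<d. mv {..<d} (L S i) x b * S (i, b) l)"
        unfolding mv_def sum_distrib_right using L_sym[OF loc i] by (intro sum.cong refl) auto
      finally show "(\<Sum>a<d. x a * G S (i, a) l) = (\<Sum>b<d. mv {..<d} (L S i) x b * S (i, b) l)" .
    qed
    also have "\<dots> = L2_set (mv {..<d} (L S i) x) {..<d}"
      unfolding L2_set_ip feas_comb2[OF f i] ..
    finally show ?thesis using G_comb_lower[OF f k i mu zeta, of x] by simp
  qed
qed simp

section \<open>The dual matrix, its kernel and its positivity\<close>

definition M :: "(nat \<times> nat \<Rightarrow> nat \<Rightarrow> real) \<Rightarrow> nat \<times> nat \<Rightarrow> nat \<times> nat \<Rightarrow> real" where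
  "M S r s = (if fst r = fst s then L S (fst r) (snd r) (snd s) else 0) - A r s"

lemma M_sym: "locmax S \<Longrightarrow> r \<in> I \<Longrightarrow> s \<in> I \<Longrightarrow> M S r s = M S s r"
  using A_sym[of r s] L_sym by (auto simp: M_def)

lemma sum_block:
  assumes "i < n"
  shows "(\<Sum>s\<in>I. (if i = fst s then g (snd s) else 0) * y s) = (\<Sum>b<d. g b * (y (i, b) :: real))"
proof -
  have "(\<Sum>s\<in>I. (if i = fst s then g (snd s) else 0) * y s) = (\<Sum>j<n. (if j = i then 1 else 0) * (\<Sum>b<d. g b * y (j, b)))"
    unfolding sum_I sum_distrib_left by (intro sum.cong refl) auto
  then show ?thesis using assms by (simp add: sum_indicator_mult)
qed

lemma mv_M: "i < n \<Longrightarrow> mv I (M S) y (i, a) = (\<Sum>b<d. L S i a b * y (i, b)) - (\<Sum>s\<in>I. A (i, a) s * y s)"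
  using sum_block[of i "L S i a" y]
  unfolding mv_def M_def fst_conv snd_conv left_diff_distrib sum_subtractf by simp

lemma mv_M_S:
  assumes "locmax S" "r \<in> I" "l < p"
  shows "mv I (M S) (\<lambda>s. S s l) r = 0"
proof -
  obtain i a where r: "r = (i, a)" "i < n" "a < d" using assms by auto
  show ?thesis
    unfolding r mv_M[OF r(2)] using first_order_expand[OF assms(1) r(2,3) assms(3)] by (simp add: G_def)
qed

text \<open>The middle term is |Z^T y|^2; isolating it shows that it drops out for vectors whose
  blocks sum to zero.\<close>

lemma qf_M:
  "ip I y (mv I (M S) y) = (\<Sum>i<n. ip {..<d} (\<lambda>a. y (i, a)) (mv {..<d} (L S i) (\<lambda>a. y (i, a))))
    - (\<Sum>a<d. (\<Sum>j<n. y (j, a))\<^sup>2) - ip I y (mv I D y)"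
proof -
  have "ip I y (mv I (M S) y) = (\<Sum>i<n. \<Sum>a<d. y (i, a) * (\<Sum>b<d. L S i a b * y (i, b)))
     - (\<Sum>r\<in>I. y r * (\<Sum>s\<in>I. A r s * y s))"
    unfolding ip_def sum_I by (simp add: mv_M right_diff_distrib sum_subtractf sum_I)
  also have "(\<Sum>r\<in>I. y r * (\<Sum>s\<in>I. A r s * y s)) = (\<Sum>r\<in>I. y r * (\<Sum>j<n. y (j, snd r))) + ip I y (mv I D y)"
  proof -
    have "(\<Sum>s\<in>I. A r s * y s) = (\<Sum>j<n. y (j, snd r)) + mv I D y r" if "r \<in> I" for r
    proof -
      have "(\<Sum>s\<in>I. (if snd r = snd s then 1 else 0) * y s) = (\<Sum>j<n. \<Sum>b<d. (if b = snd r then 1 else 0) * y (j, b))"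
        unfolding sum_I by (intro sum.cong refl) auto
      also have "\<dots> = (\<Sum>j<n. y (j, snd r))" using that by (auto simp: sum_indicator_mult)
      finally show ?thesis unfolding A_def mv_def distrib_right sum.distrib by simp
    qed
    then show ?thesis unfolding ip_def sum.distrib[symmetric] distrib_left[symmetric]
      by (intro sum.cong refl) simp
  qed
  also have "(\<Sum>r\<in>I. y r * (\<Sum>j<n. y (j, snd r))) = (\<Sum>a<d. (\<Sum>j<n. y (j, a))\<^sup>2)"
    unfolding sum_I snd_conv sum.swap[of _ "{..<d}" "{..<n}"] sum_distrib_right[symmetric] power2_eq_square ..
  finally show ?thesis by (simp add: ip_def mv_def)
qed

definition F :: "(nat \<times> nat \<Rightarrow> nat \<Rightarrow> real) \<Rightarrow> nat \<Rightarrow> nat \<times> nat \<Rightarrow> nat \<Rightarrow> real" where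
  "F S k r b = inn (S r) (S (k, b))"

lemma mv_M_F:
  assumes "locmax S" "r \<in> I"
  shows "mv I (M S) (\<lambda>s. \<Sum>b<d. F S k s b * \<xi> b) r = 0"
proof -
  have "mv I (M S) (\<lambda>s. \<Sum>b<d. F S k s b * \<xi> b) r
     = (\<Sum>s\<in>I. \<Sum>b<d. \<Sum>l<p. (S (k, b) l * \<xi> b) * (M S r s * S s l))"
    unfolding mv_def F_def ip_def sum_distrib_left sum_distrib_right by (simp only: mult_ac)
  also have "\<dots> = (\<Sum>b<d. \<Sum>l<p. (S (k, b) l * \<xi> b) * mv I (M S) (\<lambda>s. S s l) r)"
    unfolding mv_def sum_distrib_left sum.swap[of _ "{..<d}" I] sum.swap[of _ "{..<p}" I] ..
  also have "\<dots> = 0" using mv_M_S[OF assms] by simp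
  finally show ?thesis .
qed

text \<open>The witness \<open>\<xi>\<close> is part of the statement because two facts are read off
  from it: the form of M is nonnegative, and a vector on which it vanishes lies in the column space
  of F.\<close>

lemma certificate:
  assumes loc: "locmax S" and k: "k < n" and nu: "op_bound I I D \<nu>"
    and low: "\<And>i x. i < n \<Longrightarrow> \<kappa> * ip {..<d} x x \<le> ip {..<d} x (mv {..<d} (L S i) x)"
    and close: "dist2 S k < 2 * real n"
  shows "\<exists>\<xi>. (\<kappa> - \<nu>) * (\<Sum>r\<in>I. (y r - (\<Sum>b<d. F S k r b * \<xi> b))\<^sup>2) \<le> ip I y (mv I (M S) y)"
proof -
  have f: "feas S" using loc by (rule locmax_feas)
  define Q where "Q = (\<lambda>a b. inn (V S a) (S (k, b)))"
  \<comment> \<open>Solves Z^T F \<xi> = Z^T y, so that y - F \<xi> has block sum zero. Closeness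
    makes n - |S - Z S_k|^2 / 2 positive, hence Z^T F injective.\<close>
  have "\<exists>\<xi>. \<forall>a<d. mv {..<d} Q \<xi> a = (\<Sum>j<n. y (j, a))"
  proof (rule mv_surj_of_inj)
    fix x a assume 0: "\<And>a. a < d \<Longrightarrow> mv {..<d} Q x a = 0" and a: "a < d"
    have "(real n - dist2 S k / 2) * ip {..<d} x x \<le> inn (\<lambda>l. \<Sum>a<d. x a * V S a l) (\<lambda>l. \<Sum>a<d. x a * S (k, a) l)"
      by (rule V_comb_lower[OF f k])
    also have "\<dots> = (\<Sum>a<d. x a * mv {..<d} Q x a)"
      unfolding ip_sum_left ip_scale_left ip_sum_right ip_scale_right mv_def Q_def by (simp only: mult.commute)
    also have "\<dots> = 0" using 0 by simp
    finally have "ip {..<d} x x \<le> 0" using close by (simp add: mult_le_0_iff)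
    then have "ip {..<d} x x = 0" using ip_nonneg[of "{..<d}" x] by linarith
    then show "x a = 0" using a ip_eq_0D[of "{..<d}" x a] by simp
  qed
  then obtain \<xi> where \<xi>: "\<And>a. a < d \<Longrightarrow> mv {..<d} Q \<xi> a = (\<Sum>j<n. y (j, a))" by blast
  define h where "h = (\<lambda>r. \<Sum>b<d. F S k r b * \<xi> b)"
  define z where "z = (\<lambda>r. y r - h r)"
  have hz: "ip I h (mv I (M S) x) = 0" for x
  proof -
    have "ip I h (mv I (M S) x) = ip I x (mv I (M S) h)"
      by (rule ip_mv_sym) (rule M_sym[OF loc])
    also have "\<dots> = 0" unfolding h_def ip_def using mv_M_F[OF loc] by simp
    finally show ?thesis .
  qed
  have Mh: "ip I x (mv I (M S) h) = 0" for x
    unfolding h_def ip_def using mv_M_F[OF loc] by simp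
  have "ip I y (mv I (M S) y) = ip I (\<lambda>r. z r + h r) (mv I (M S) (\<lambda>r. z r + h r))"
    by (simp add: z_def)
  also have "\<dots> = ip I z (mv I (M S) z)"
    unfolding mv_add ip_add_left ip_add_right hz Mh by simp
  finally have yz: "ip I y (mv I (M S) y) = ip I z (mv I (M S) z)" .
  have z0: "(\<Sum>j<n. z (j, a)) = 0" if "a < d" for a
  proof -
    have "(\<Sum>j<n. h (j, a)) = mv {..<d} Q \<xi> a"
      unfolding h_def F_def mv_def Q_def inn_V sum_distrib_right by (rule sum.swap)
    then show ?thesis using \<xi>[OF that] by (simp add: z_def sum_subtractf)
  qed
  have "ip I z (mv I D z) \<le> L2_set z I * L2_set (mv I D z) I" by (rule ip_le_L2)
  also have "\<dots> \<le> L2_set z I * (\<nu> * L2_set z I)"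
    using nu unfolding op_bound_def mv_def[abs_def] by (intro mult_left_mono) auto
  also have "\<dots> = \<nu> * ip I z z" using L2_set_power2[of z I] by (simp add: power2_eq_square)
  finally have Dz: "ip I z (mv I D z) \<le> \<nu> * ip I z z" .
  have "\<kappa> * ip I z z = (\<Sum>i<n. \<kappa> * ip {..<d} (\<lambda>a. z (i, a)) (\<lambda>a. z (i, a)))"
    unfolding ip_def sum_I sum_distrib_left ..
  also have "\<dots> \<le> (\<Sum>i<n. ip {..<d} (\<lambda>a. z (i, a)) (mv {..<d} (L S i) (\<lambda>a. z (i, a))))"
    using low by (intro sum_mono) auto
  finally have "(\<kappa> - \<nu>) * ip I z z \<le> ip I z (mv I (M S) z)"
    unfolding qf_M using Dz z0 by (simp add: left_diff_distrib)
  then show ?thesis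
    unfolding yz by (intro exI[of _ \<xi>]) (simp add: ip_def z_def h_def power2_eq_square)
qed

end

section \<open>Weak duality and complementary slackness\<close>

lemma ip_mv_delta:
  assumes "finite J" "u \<in> J"
  shows "ip J x (mv J K (\<lambda>i. if i = u then 1 else 0)) = (\<Sum>i\<in>J. x i * K i u)"
proof -
  have "mv J K (\<lambda>i. if i = u then 1 else 0) i = K i u" for i
    using sum_indicator_mult[OF assms, of "K i"] by (simp add: mv_def mult.commute)
  then show ?thesis by (simp add: ip_def)
qed

text \<open>Induction on the support of \<open>Y\<close>, splitting off one rank-one summand by a Cholesky step.\<close>

lemma psd_pairing_nonneg_aux:
  assumes "finite U" "U \<subseteq> J" "finite J"
    and "\<And>i j. i \<in> J \<Longrightarrow> j \<in> J \<Longrightarrow> Y i j = Y j i"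
    and "\<And>i j. i \<in> J \<Longrightarrow> j \<in> J \<Longrightarrow> i \<notin> U \<Longrightarrow> Y i j = 0"
    and "\<And>x. 0 \<le> ip J x (mv J Y x)" and "\<And>x. 0 \<le> ip J x (mv J K x)"
  shows "0 \<le> (\<Sum>i\<in>J. \<Sum>j\<in>J. K i j * Y i j)"
  using assms
proof (induction U arbitrary: Y rule: finite_induct)
  case empty
  then show ?case by simp
next
  case (insert u U)
  have u: "u \<in> J" using insert.prems by auto
  note fin = \<open>finite J\<close> and sym = insert.prems(3) and psd = insert.prems(5)
  define e where "e = (\<lambda>i. if i = u then 1 else (0::real))"
  have Ye: "ip J x (mv J Y e) = (\<Sum>i\<in>J. x i * Y i u)" for x
    unfolding e_def by (rule ip_mv_delta[OF fin u])
  have eY: "ip J e (mv J Y x) = ip J x (mv J Y e)" for x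
    by (rule ip_mv_sym) (rule sym)
  have ee: "ip J e (mv J Y e) = Y u u"
    unfolding Ye unfolding e_def using sum_indicator_mult[OF fin u] by simp
  have shift: "ip J (\<lambda>i. x i + t * e i) (mv J Y (\<lambda>i. x i + t * e i))
      = ip J x (mv J Y x) + 2 * t * (\<Sum>i\<in>J. x i * Y i u) + t\<^sup>2 * Y u u" for x t
    unfolding mv_add mv_scale ip_add_left ip_add_right ip_scale_left ip_scale_right eY[of x] ee Ye[symmetric]
    by (simp add: algebra_simps power2_eq_square)
  show ?case
  proof (cases "Y u u = 0")
    case True
    have "Y j u = 0" if j: "j \<in> J" for j
    proof (rule ccontr)
      assume ne: "Y j u \<noteq> 0"
      define f where "f = (\<lambda>i. if i = j then 1 else (0::real))"
      \<comment> \<open>The form at f + t e is affine in t when \<open>Y u u\<close> = 0; this t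
        makes it -1.\<close>
      define t where "t = - (ip J f (mv J Y f) + 1) / (2 * Y j u)"
      have "(\<Sum>i\<in>J. f i * Y i u) = Y j u"
        unfolding f_def using sum_indicator_mult[OF fin j] by simp
      then have "0 \<le> ip J f (mv J Y f) + 2 * t * Y j u"
        using psd[of "\<lambda>i. f i + t * e i"] unfolding shift True by simp
      also have "\<dots> = - 1" unfolding t_def using ne by (simp add: field_simps)
      finally show False by simp
    qed
    then show ?thesis
      using insert.prems sym u by (intro insert.IH) (auto, metis)
  next
    case False
    have "0 \<le> Y u u" using psd[of e] ee by simp
    with False have pos: "Y u u > 0" by simp
    \<comment> \<open>The Schur complement of the pivot u. Its form is the minimum over t of the
      form of Y at x + t e, attained at t = -s / \<open>Y u u\<close>, and therefore
      nonnegative.\<close>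
    define Y' where "Y' = (\<lambda>i j. Y i j - Y i u * Y j u / Y u u)"
    have "0 \<le> (\<Sum>i\<in>J. \<Sum>j\<in>J. K i j * Y' i j)"
    proof (rule insert.IH)
      show "U \<subseteq> J" "finite J" using insert.prems by auto
      show "Y' i j = Y' j i" if "i \<in> J" "j \<in> J" for i j
        using sym[OF that] by (simp add: Y'_def)
      show "Y' i j = 0" if "i \<in> J" "j \<in> J" "i \<notin> U" for i j
      proof (cases "i = u")
        case True
        then show ?thesis using that pos sym[of u j] u by (simp add: Y'_def)
      next
        case False
        then have "Y i j = 0" "Y i u = 0" using insert.prems(4) that u by auto
        then show ?thesis by (simp add: Y'_def)
      qed
      show "0 \<le> ip J x (mv J K x)" for x by (rule insert.prems(6))
      show "0 \<le> ip J x (mv J Y' x)" for x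
      proof -
        define s where "s = (\<Sum>i\<in>J. x i * Y i u)"
        have "ip J x (mv J Y' x) = ip J x (mv J Y x) - s * s / Y u u"
        proof -
          have "mv J Y' x i = mv J Y x i - Y i u * (s / Y u u)" for i
            unfolding mv_def Y'_def s_def sum_divide_distrib sum_distrib_left sum_subtractf[symmetric]
            by (intro sum.cong refl) (simp add: algebra_simps)
          then have "ip J x (mv J Y' x) = ip J x (mv J Y x) - (\<Sum>i\<in>J. x i * Y i u * (s / Y u u))"
            unfolding ip_def by (simp add: right_diff_distrib sum_subtractf mult.assoc)
          then show ?thesis unfolding sum_distrib_right[symmetric] s_def[symmetric] by simp
        qed
        moreover have "0 \<le> ip J x (mv J Y x) + 2 * (- s / Y u u) * s + (- s / Y u u)\<^sup>2 * Y u u"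
          using psd[of "\<lambda>i. x i + (- s / Y u u) * e i"] unfolding shift s_def .
        moreover have "\<dots> = ip J x (mv J Y x) - s * s / Y u u"
          using pos by (simp add: power2_eq_square field_simps)
        ultimately show ?thesis by simp
      qed
    qed
    moreover have "(\<Sum>i\<in>J. \<Sum>j\<in>J. K i j * Y i j) = (\<Sum>i\<in>J. \<Sum>j\<in>J. K i j * Y' i j)
       + ip J (\<lambda>i. Y i u) (mv J K (\<lambda>i. Y i u)) / Y u u"
      unfolding ip_def mv_def Y'_def sum_distrib_left sum_divide_distrib sum.distrib[symmetric]
      by (intro sum.cong refl) (simp add: algebra_simps)
    moreover have "0 \<le> ip J (\<lambda>i. Y i u) (mv J K (\<lambda>i. Y i u)) / Y u u"
      using insert.prems(6) pos by simp
    ultimately show ?thesis by linarith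
  qed
qed

lemma psd_pairing_nonneg:
  assumes "finite J" "\<And>i j. i \<in> J \<Longrightarrow> j \<in> J \<Longrightarrow> Y i j = Y j i"
    and "\<And>x. 0 \<le> ip J x (mv J Y x)" and "\<And>x. 0 \<le> ip J x (mv J K x)"
  shows "0 \<le> (\<Sum>i\<in>J. \<Sum>j\<in>J. K i j * Y i j)"
  using assms by (intro psd_pairing_nonneg_aux[of J J]) auto

context sync
begin

lemma obj_trace: "obj S = (\<Sum>i<n. \<Sum>a<d. L S i a a)"
  unfolding obj_def L_def sum_I inn_G by (simp add: sum_I ip_commute)

text \<open>L meets only the diagonal blocks of Y, which are identities, so it contributes tr L =
  obj S and the pairing is the duality gap.\<close>

lemma M_pairing:
  assumes "\<And>i a b. i < n \<Longrightarrow> a < d \<Longrightarrow> b < d \<Longrightarrow> Y (i, a) (i, b) = (if a = b then 1 else 0)"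
  shows "(\<Sum>r\<in>I. \<Sum>s\<in>I. M S r s * Y r s) = obj S - (\<Sum>r\<in>I. \<Sum>s\<in>I. A r s * Y r s)"
proof -
  have "(\<Sum>r\<in>I. \<Sum>s\<in>I. M S r s * Y r s) = (\<Sum>i<n. \<Sum>a<d. \<Sum>b<d. L S i a b * Y (i, a) (i, b)) - (\<Sum>r\<in>I. \<Sum>s\<in>I. A r s * Y r s)"
  proof -
    have "(\<Sum>s\<in>I. M S (i, a) s * Y (i, a) s) = (\<Sum>b<d. L S i a b * Y (i, a) (i, b)) - (\<Sum>s\<in>I. A (i, a) s * Y (i, a) s)"
      if "i < n" for i a
      using mv_M[OF that, of S "Y (i, a)" a] by (simp add: mv_def)
    then show ?thesis by (simp add: sum_I[of "\<lambda>r. \<Sum>s\<in>I. _ r s"] sum_subtractf)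
  qed
  also have "(\<Sum>i<n. \<Sum>a<d. \<Sum>b<d. L S i a b * Y (i, a) (i, b)) = (\<Sum>i<n. \<Sum>a<d. \<Sum>b<d. (if b = a then 1 else 0) * L S i a b)"
    by (intro sum.cong refl) (use assms in auto)
  also have "\<dots> = obj S" by (simp add: sum_indicator_mult obj_trace)
  finally show ?thesis .
qed

text \<open>The gap pairs two positive semidefinite matrices. Y need not be a Gram matrix of p
  columns, so the same bound covers the semidefinite program.\<close>

lemma dual_bound:
  assumes "\<And>x. 0 \<le> ip I x (mv I (M S) x)"
    and "\<And>r s. r \<in> I \<Longrightarrow> s \<in> I \<Longrightarrow> Y r s = Y s r" "\<And>x. 0 \<le> ip I x (mv I Y x)"
    and "\<And>i a b. i < n \<Longrightarrow> a < d \<Longrightarrow> b < d \<Longrightarrow> Y (i, a) (i, b) = (if a = b then 1 else 0)"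
  shows "(\<Sum>r\<in>I. \<Sum>s\<in>I. A r s * Y r s) \<le> obj S"
  using psd_pairing_nonneg[of I Y "M S"] M_pairing[of Y S] assms by simp

lemma ip_mv_gram: "ip I x (mv I (\<lambda>r s. inn (S r) (S s)) x) = (\<Sum>l<p. (\<Sum>r\<in>I. x r * S r l)\<^sup>2)"
proof -
  have "ip I x (mv I (\<lambda>r s. inn (S r) (S s)) x) = (\<Sum>r\<in>I. \<Sum>s\<in>I. \<Sum>l<p. (x r * S r l) * (x s * S s l))"
    unfolding ip_def mv_def sum_distrib_left sum_distrib_right by (simp only: mult_ac)
  also have "\<dots> = (\<Sum>l<p. \<Sum>r\<in>I. \<Sum>s\<in>I. (x r * S r l) * (x s * S s l))"
    unfolding sum.swap[of _ I "{..<p}"] ..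
  finally show ?thesis by (simp add: power2_eq_square sum_product)
qed

lemma global_max:
  assumes "\<And>x. 0 \<le> ip I x (mv I (M S) x)" "feas S'"
  shows "obj S' \<le> obj S"
  unfolding obj_def[of S']
  using assms by (intro dual_bound) (auto simp: ip_mv_gram ip_commute feas_inn intro!: sum_nonneg)

text \<open>The duality gap at S' S'^T is the sum of the forms of M at the columns of S'. It is not
  positive while every summand is nonnegative, so each column lies in the column space of F.\<close>

lemma maximizer_factor:
  assumes f: "feas S" and k: "k < n" and c: "c > 0"
    and cert: "\<And>y. \<exists>\<xi>. c * (\<Sum>r\<in>I. (y r - (\<Sum>b<d. F S k r b * \<xi> b))\<^sup>2) \<le> ip I y (mv I (M S) y)"
    and f': "feas S'" and obj: "obj S \<le> obj S'" and r: "r \<in> I" and l: "l < p"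
  shows "S' r l = (\<Sum>b<d. F S k r b * S' (k, b) l)"
proof -
  have psd: "0 \<le> ip I y (mv I (M S) y)" for y
  proof -
    obtain \<xi> where "c * (\<Sum>r\<in>I. (y r - (\<Sum>b<d. F S k r b * \<xi> b))\<^sup>2) \<le> ip I y (mv I (M S) y)"
      using cert by blast
    moreover have "0 \<le> c * (\<Sum>r\<in>I. (y r - (\<Sum>b<d. F S k r b * \<xi> b))\<^sup>2)"
      using c by (intro mult_nonneg_nonneg sum_nonneg) auto
    ultimately show ?thesis by linarith
  qed
  have "(\<Sum>l<p. ip I (\<lambda>r. S' r l) (mv I (M S) (\<lambda>r. S' r l))) = (\<Sum>r\<in>I. \<Sum>s\<in>I. M S r s * inn (S' r) (S' s))"
    unfolding ip_def mv_def sum_distrib_left sum.swap[of _ I "{..<p}"] by (simp only: mult_ac)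
  also have "\<dots> = obj S - obj S'"
    unfolding obj_def[of S'] using f' by (intro M_pairing) (simp add: feas_inn)
  finally have "(\<Sum>l<p. ip I (\<lambda>r. S' r l) (mv I (M S) (\<lambda>r. S' r l))) \<le> 0" using obj by simp
  moreover have "0 \<le> (\<Sum>l<p. ip I (\<lambda>r. S' r l) (mv I (M S) (\<lambda>r. S' r l)))"
    using psd by (intro sum_nonneg)
  ultimately have "(\<Sum>l<p. ip I (\<lambda>r. S' r l) (mv I (M S) (\<lambda>r. S' r l))) = 0" by linarith
  then have zero: "ip I (\<lambda>r. S' r l) (mv I (M S) (\<lambda>r. S' r l)) = 0"
    using psd l by (subst (asm) sum_nonneg_eq_0_iff) auto
  obtain \<xi> where "c * (\<Sum>r\<in>I. (S' r l - (\<Sum>b<d. F S k r b * \<xi> b))\<^sup>2) \<le> 0"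
    using cert[of "\<lambda>r. S' r l"] zero by auto
  then have "(\<Sum>r\<in>I. (S' r l - (\<Sum>b<d. F S k r b * \<xi> b))\<^sup>2) \<le> 0"
    using c by (simp add: mult_le_0_iff)
  moreover have "0 \<le> (\<Sum>r\<in>I. (S' r l - (\<Sum>b<d. F S k r b * \<xi> b))\<^sup>2)" by (intro sum_nonneg) auto
  ultimately have "(\<Sum>r\<in>I. (S' r l - (\<Sum>b<d. F S k r b * \<xi> b))\<^sup>2) = 0" by linarith
  then have res: "S' r l = (\<Sum>b<d. F S k r b * \<xi> b)" if "r \<in> I" for r
    using that by (subst (asm) sum_nonneg_eq_0_iff) auto
  \<comment> \<open>Block k of F is S_k S_k^T = I, so the coefficients are read off from that
    block.\<close>
  have "S' (k, a) l = \<xi> a" if "a < d" for a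
  proof -
    have "S' (k, a) l = (\<Sum>b<d. F S k (k, a) b * \<xi> b)" using res k that by auto
    also have "\<dots> = (\<Sum>b<d. (if b = a then 1 else 0) * \<xi> b)"
      by (intro sum.cong refl) (use f k that in \<open>auto simp: F_def feas_inn\<close>)
    also have "\<dots> = \<xi> a" using that by (simp add: sum_indicator_mult)
    finally show ?thesis .
  qed
  then show ?thesis using res[OF r] by simp
qed

lemma maximizer_gram:
  assumes "k < n" "feas S'" "\<And>r l. r \<in> I \<Longrightarrow> l < p \<Longrightarrow> S' r l = (\<Sum>b<d. F S k r b * S' (k, b) l)"
    and "r \<in> I" "s \<in> I"
  shows "inn (S' r) (S' s) = (\<Sum>b<d. F S k r b * F S k s b)"
proof -
  have "inn (S' r) (S' s) = inn (\<lambda>l. \<Sum>b<d. F S k r b * S' (k, b) l) (\<lambda>l. \<Sum>b<d. F S k s b * S' (k, b) l)"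
    unfolding ip_def using assms(3-5) by (intro sum.cong refl) auto
  then show ?thesis using feas_comb2[OF assms(2,1)] by (simp add: ip_def[of "{..<d}"])
qed

section \<open>Existence of a maximizer by compactness\<close>

lemma feas_bounded:
  assumes "feas S" "r \<in> I" "l < p"
  shows "\<bar>S r l\<bar> \<le> 1"
proof -
  have "(S r l)\<^sup>2 \<le> (\<Sum>l<p. (S r l)\<^sup>2)"
    using assms by (intro member_le_sum) auto
  also have "\<dots> = 1" using assms by (auto simp: feas_def ip_def power2_eq_square)
  finally show ?thesis by (simp add: abs_square_le_1)
qed

lemma continuous_entry: "continuous_on UNIV (\<lambda>S :: nat \<times> nat \<Rightarrow> nat \<Rightarrow> real. S r l)"
  by (rule continuous_on_compose2[OF continuous_on_product_coordinates[of l] continuous_on_product_coordinates]) auto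

text \<open>The feasible functions do not form a compact set, as their values off the index set are
  free. Intersecting with a product of intervals [-1, 1], compact by Tychonoff, repairs
  this.\<close>

lemma exists_maximizer: "\<exists>S. feas S \<and> (\<forall>S'. feas S' \<longrightarrow> obj S' \<le> obj S)"
proof -
  have box: "compact (PiE UNIV (\<lambda>_. C) :: ('a \<Rightarrow> 'b::topological_space) set)" if "compact C" for C
    using that compactin_PiE[of "\<lambda>_. euclidean" UNIV "\<lambda>_. C"]
    by (simp add: euclidean_product_topology compactin_euclidean_iff)
  define K where "K = {S. feas S} \<inter> PiE UNIV (\<lambda>_. PiE UNIV (\<lambda>_. {-1..1}))"
  have cont_inn: "continuous_on UNIV (\<lambda>S. inn (S r) (S s))" for r s :: "nat \<times> nat"
    unfolding ip_def by (intro continuous_intros continuous_entry)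
  have "{S. feas S} = (\<Inter>i\<in>{..<n}. \<Inter>a\<in>{..<d}. \<Inter>b\<in>{..<d}. {S. inn (S (i, a)) (S (i, b)) = (if a = b then 1 else 0)})"
    by (auto simp: feas_def)
  moreover have "closed \<dots>"
    by (intro closed_INT ballI closed_Collect_eq cont_inn continuous_on_const)
  ultimately have "closed {S. feas S}" by simp
  then have "compact K"
    unfolding K_def by (intro closed_Int_compact box) auto
  moreover have "K \<noteq> {}"
  proof -
    have "feas (\<lambda>(i, a) l. if l = a then 1 else 0)"
      unfolding feas_def using p_large by (auto simp: inn_delta)
    then have "(\<lambda>(i, a) l. if l = a then 1 else 0) \<in> K"
      by (auto simp: K_def)
    then show ?thesis by blast
  qed
  moreover have "continuous_on K obj"
    unfolding obj_def
    by (intro continuous_intros continuous_on_subset[OF cont_inn]) auto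
  ultimately obtain S where S: "S \<in> K" "\<And>S'. S' \<in> K \<Longrightarrow> obj S' \<le> obj S"
    using continuous_attains_sup[of K obj] by blast
  have "obj S' \<le> obj S" if f: "feas S'" for S'
  proof -
    \<comment> \<open>Zeroing the irrelevant values moves any feasible function into
      \<open>K\<close> without changing the objective.\<close>
    define R where "R = (\<lambda>r l. if r \<in> I \<and> l < p then S' r l else 0)"
    have inn: "inn (R r) (R s) = inn (S' r) (S' s)" if "r \<in> I" "s \<in> I" for r s
      unfolding ip_def R_def using that by (intro sum.cong) auto
    have "feas R" using f unfolding feas_def by (simp add: inn)
    moreover have "R r l \<in> {-1..1}" for r l
      using feas_bounded[OF f, of r l] by (auto simp: R_def abs_le_iff)
    ultimately have "R \<in> K" by (auto simp: K_def)
    moreover have "obj R = obj S'" unfolding obj_def by (simp add: inn cong: sum.cong)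
    ultimately show ?thesis using S(2) by force
  qed
  with S(1) show ?thesis by (auto simp: K_def)
qed

end

text \<open>For y = K^T x one has |y|^2 = <x, K y> \<le> c |x| |y|; divide by |y|.\<close>

lemma op_bound_transpose:
  assumes "op_bound I J K c"
  shows "op_bound J I (\<lambda>j i. K i j) c"
  unfolding op_bound_def
proof (intro conjI allI)
  show c: "0 \<le> c" using assms by (simp add: op_bound_def)
  fix x
  define y where "y = (\<lambda>j. \<Sum>i\<in>I. K i j * x i)"
  have "L2_set y J * L2_set y J = ip J y y"
    using L2_set_power2[of y J] by (simp add: power2_eq_square)
  also have "\<dots> = (\<Sum>j\<in>J. \<Sum>i\<in>I. x i * (K i j * y j))"
  proof -
    have "y j * y j = (\<Sum>i\<in>I. K i j * x i) * y j" for j by (simp add: y_def)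
    then show ?thesis unfolding ip_def sum_distrib_right by (simp only: mult_ac)
  qed
  also have "\<dots> = ip I x (\<lambda>i. \<Sum>j\<in>J. K i j * y j)"
    unfolding ip_def sum_distrib_left by (rule sum.swap)
  also have "\<dots> \<le> L2_set x I * L2_set (\<lambda>i. \<Sum>j\<in>J. K i j * y j) I" by (rule ip_le_L2)
  also have "\<dots> \<le> L2_set x I * (c * L2_set y J)"
    using assms unfolding op_bound_def by (intro mult_left_mono) auto
  finally have le: "L2_set y J * L2_set y J \<le> (c * L2_set x I) * L2_set y J" by (simp add: mult_ac)
  show "L2_set y J \<le> c * L2_set x I"
  proof (cases "L2_set y J = 0")
    case True
    then show ?thesis using c by simp
  next
    case False
    then have "L2_set y J > 0" by (simp add: less_le)
    then show ?thesis using le mult_le_cancel_right_pos by blast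
  qed
qed

lemma op_bound_mono: "op_bound I J K c \<Longrightarrow> c \<le> c' \<Longrightarrow> op_bound I J K c'"
  unfolding op_bound_def by (meson L2_set_nonneg mult_right_mono order_trans)

lemma op_bound_zero: "(\<And>i j. i \<in> I \<Longrightarrow> j \<in> J \<Longrightarrow> K i j = 0) \<Longrightarrow> op_bound I J K 0"
  by (simp add: op_bound_def L2_set_def)

lemma op_bound_zeroD:
  assumes "op_bound I J K 0" "finite I" "finite J" "i \<in> I" "j \<in> J"
  shows "K i j = 0"
proof -
  let ?x = "\<lambda>i. if i = j then 1 else (0::real)"
  have "L2_set (\<lambda>i. \<Sum>j\<in>J. K i j * ?x j) I \<le> 0 * L2_set ?x J"
    using assms(1) unfolding op_bound_def by (elim conjE allE)
  moreover have "(\<Sum>j\<in>J. K i j * ?x j) = K i j" for i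
    using sum_indicator_mult[OF assms(3,5), of "K i"] by (simp add: mult.commute)
  ultimately have "L2_set (\<lambda>i. K i j) I \<le> 0" by simp
  then have "L2_set (\<lambda>i. K i j) I = 0" using L2_set_nonneg[of "\<lambda>i. K i j" I] by linarith
  then show ?thesis using assms by (simp add: L2_set_eq_0_iff)
qed

context sync
begin

text \<open>The case \<nu> = 0 is separate because the strict closeness bound would read q < 0.
  There the noise vanishes, \<open>proximity_ineq\<close> gives S = Z S_k on the index set, and c =
  n works.\<close>

lemma strict_certificate:
  assumes loc: "locmax S" and nu: "op_bound I I D \<nu>" and tau: "op_bound {..<n} {..<n} T \<tau>"
    and g: "\<gamma> \<ge> 1" "\<nu> > 0 \<Longrightarrow> \<tau> \<le> \<gamma> * \<nu>"
    and mu: "\<And>i. i < n \<Longrightarrow> op_bound I {..<d} (\<lambda>s a. D (i, a) s) \<mu>"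
    and zeta: "\<And>i. i < n \<Longrightarrow> op_bound {..<d} {..<d} (\<lambda>b a. \<Sum>j<n. D (i, a) (j, b)) \<zeta>"
    and \<delta>: "\<delta> = (2 + sqrt 5) * (real p + real d) * \<gamma> / (real p - 2 * real d)"
    and cond: "real n \<ge> 3 * \<delta>\<^sup>2 * real d * \<nu>\<^sup>2 / (2 * real n) + \<delta> * sqrt (real d / real n) * \<nu> * \<mu> + \<zeta> + \<nu>"
  shows "\<exists>k<n. \<exists>c>0. \<forall>y. \<exists>\<xi>. c * (\<Sum>r\<in>I. (y r - (\<Sum>b<d. F S k r b * \<xi> b))\<^sup>2) \<le> ip I y (mv I (M S) y)"
proof (cases "\<nu> = 0")
  case True
  have D0: "D r s = 0" if "r \<in> I" "s \<in> I" for r s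
    using op_bound_zeroD[OF nu[unfolded True] _ _ that] by simp
  have "op_bound {..<n} {..<n} T 0" by (intro op_bound_zero) (auto simp: T_def D0)
  from proximity_ineq[OF loc nu this] obtain k where k: "k < n"
    and "(real p - 2 * real d) * (real n / 2) * dist2 S k \<le> 0" unfolding True by auto
  then have "dist2 S k \<le> 0" using p_large n_pos by (auto simp: mult_le_0_iff)
  then have k0: "dist2 S k = 0" using dist2_nonneg[of S k] by linarith
  have "real n * ip {..<d} x x \<le> ip {..<d} x (mv {..<d} (L S i) x)" if i: "i < n" for i x
  proof -
    have "op_bound I {..<d} (\<lambda>s a. D (i, a) s) 0" "op_bound {..<d} {..<d} (\<lambda>b a. \<Sum>j<n. D (i, a) (j, b)) 0"
      using i by (auto intro!: op_bound_zero simp: D0)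
    from L_lower[OF loc k i this] show ?thesis by (simp add: k0)
  qed
  from certificate[OF loc k nu this] show ?thesis
    using k k0 n_pos True by (intro exI[of _ k] conjI exI[of _ "real n"]) auto
next
  case False
  have nu0: "\<nu> > 0" using False nu by (simp add: op_bound_def)
  have mu0: "\<mu> \<ge> 0" and ze0: "\<zeta> \<ge> 0" using mu[of 0] zeta[of 0] n_pos by (auto simp: op_bound_def)
  define Q where "Q = \<delta> * sqrt (real d / real n) * \<nu>"
  obtain k where k: "k < n" and q: "sqrt (dist2 S k) < Q"
    using proximity[OF loc nu nu0 tau g(1) g(2)[OF nu0]] unfolding Q_def \<delta> by blast
  define q where "q = sqrt (dist2 S k)"
  have q0: "q \<ge> 0" and q2: "q\<^sup>2 = dist2 S k" using dist2_nonneg[of S k] by (auto simp: q_def)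
  have Q2: "3 * \<delta>\<^sup>2 * real d * \<nu>\<^sup>2 / (2 * real n) = 3 / 2 * Q\<^sup>2"
    unfolding Q_def by (simp add: power_mult_distrib)
  have qQ: "q\<^sup>2 < Q\<^sup>2" using q q0 unfolding q_def[symmetric] by (intro power_strict_mono) auto
  have qm: "q * \<mu> \<le> Q * \<mu>" using q mu0 unfolding q_def[symmetric] by (intro mult_right_mono) auto
  define \<kappa> where "\<kappa> = real n - dist2 S k / 2 - \<zeta> - sqrt (dist2 S k) * \<mu>"
  have cond': "3 / 2 * Q\<^sup>2 + Q * \<mu> + \<zeta> + \<nu> \<le> real n"
    using cond unfolding Q2 Q_def by simp
  have "\<kappa> = real n - q\<^sup>2 / 2 - \<zeta> - q * \<mu>" by (simp add: \<kappa>_def q2) (simp add: q_def)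
  \<comment> \<open>Strictness of q < Q yields a positive constant although the hypothesis allows
    equality.\<close>
  then have \<kappa>: "\<kappa> - \<nu> > 0"
    using cond' qQ qm zero_le_power2[of Q] by linarith
  have "0 \<le> q * \<mu>" using q0 mu0 by simp
  then have close: "dist2 S k < 2 * real n"
    using cond' qQ[unfolded q2] qm ze0 nu0 zero_le_power2[of Q] by linarith
  have low: "\<kappa> * ip {..<d} x x \<le> ip {..<d} x (mv {..<d} (L S i) x)" if "i < n" for i x
    unfolding \<kappa>_def by (rule L_lower[OF loc k that mu[OF that] zeta[OF that]])
  from certificate[OF loc k nu low close] show ?thesis using k \<kappa> by blast
qed

end

section \<open>Block matrices\<close>

definition ix :: "nat \<Rightarrow> nat \<times> nat \<Rightarrow> nat" where
  "ix d r = fst r * d + snd r"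

lemma ix_less: "i * d + a < n * d" if "i < n" "a < d" for i a n d :: nat
proof -
  have "i * d + a < Suc i * d" using that by simp
  also have "\<dots> \<le> n * d" using that by (intro mult_le_mono1) simp
  finally show ?thesis .
qed

lemma bij_betw_ix: "d \<ge> 1 \<Longrightarrow> bij_betw (ix d) ({..<n} \<times> {..<d}) {..<n * d}"
  by (rule bij_betw_byWitness[of _ "\<lambda>r. (r div d, r mod d)"])
    (auto simp: ix_def ix_less less_mult_imp_div_less)

lemma sum_ix: "d \<ge> 1 \<Longrightarrow> (\<Sum>r<n * d. g r) = (\<Sum>r\<in>{..<n} \<times> {..<d}. g (ix d r))"
  using sum.reindex_bij_betw[OF bij_betw_ix, of d g n] by simp

lemma ip_ix: "d \<ge> 1 \<Longrightarrow> ip {..<n * d} u v = ip ({..<n} \<times> {..<d}) (\<lambda>r. u (ix d r)) (\<lambda>r. v (ix d r))"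
  unfolding ip_def by (rule sum_ix)

lemma L2_set_ix: "d \<ge> 1 \<Longrightarrow> L2_set u {..<n * d} = L2_set (\<lambda>r. u (ix d r)) ({..<n} \<times> {..<d})"
  unfolding L2_set_ip by (simp add: ip_ix)

lemma vnorm_eq: "vnorm v = L2_set (\<lambda>i. v $ i) {..<dim_vec v}"
  by (simp add: vnorm_def L2_set_ip ip_def scalar_prod_def atLeast0LessThan)

lemma vnorm_mult_mat_vec:
  assumes "K \<in> carrier_mat m k" "v \<in> carrier_vec k"
  shows "vnorm (K *\<^sub>v v) = L2_set (\<lambda>i. \<Sum>j<k. K $$ (i, j) * v $ j) {..<m}"
  unfolding vnorm_eq using assms
  by (intro L2_set_cong) (auto simp: scalar_prod_def atLeast0LessThan)

text \<open>The supremum is meaningful because the Frobenius norm bounds the set and the zero vector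
  makes it nonempty; scaling extends the bound from the unit ball.\<close>

lemma op_bound_op_norm:
  assumes K: "K \<in> carrier_mat m k"
  shows "op_bound {..<m} {..<k} (\<lambda>i j. K $$ (i, j)) (op_norm K)"
proof -
  define R where "R = {vnorm (K *\<^sub>v x) | x. x \<in> carrier_vec (dim_col K) \<and> vnorm x \<le> 1}"
  have opn: "op_norm K = Sup R" by (simp add: op_norm_def R_def)
  have bdd: "bdd_above R"
  proof (rule bdd_aboveI)
    fix t assume "t \<in> R"
    then obtain x where x: "x \<in> carrier_vec k" "vnorm x \<le> 1" "t = vnorm (K *\<^sub>v x)"
      using K by (auto simp: R_def)
    have "t = L2_set (\<lambda>i. \<Sum>j<k. x $ j * K $$ (i, j)) {..<m}"
      using x vnorm_mult_mat_vec[OF K x(1)] by (simp add: mult.commute)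
    also have "\<dots> \<le> L2_set (\<lambda>j. x $ j) {..<k} * sqrt (\<Sum>j<k. ip {..<m} (\<lambda>i. K $$ (i, j)) (\<lambda>i. K $$ (i, j)))"
      by (rule L2_set_comb_le)
    also have "\<dots> \<le> 1 * sqrt (\<Sum>j<k. ip {..<m} (\<lambda>i. K $$ (i, j)) (\<lambda>i. K $$ (i, j)))"
      using x by (intro mult_right_mono) (auto simp: vnorm_eq sum_nonneg)
    finally show "t \<le> 1 * sqrt (\<Sum>j<k. ip {..<m} (\<lambda>i. K $$ (i, j)) (\<lambda>i. K $$ (i, j)))" .
  qed
  have upper: "vnorm (K *\<^sub>v x) \<le> op_norm K" if "x \<in> carrier_vec k" "vnorm x \<le> 1" for x
    unfolding opn using that K by (intro cSup_upper[OF _ bdd]) (auto simp: R_def)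
  have pos: "0 \<le> op_norm K"
  proof -
    have "0 \<le> vnorm (K *\<^sub>v 0\<^sub>v k)" by (simp add: vnorm_eq)
    also have "\<dots> \<le> op_norm K" by (rule upper) (auto simp: vnorm_eq L2_set_def)
    finally show ?thesis .
  qed
  have "L2_set (\<lambda>i. \<Sum>j<k. K $$ (i, j) * x j) {..<m} \<le> op_norm K * L2_set x {..<k}" for x
  proof (cases "L2_set x {..<k} = 0")
    case True
    then have "x j = 0" if "j < k" for j using that by (simp add: L2_set_eq_0_iff)
    then show ?thesis using True by (simp add: L2_set_def)
  next
    case False
    define s where "s = L2_set x {..<k}"
    have s: "s > 0" using False by (simp add: s_def less_le)
    define v where "v = vec k (\<lambda>j. 1 / s * x j)"
    have v: "v \<in> carrier_vec k" by (simp add: v_def)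
    have "vnorm v = L2_set (\<lambda>j. 1 / s * x j) {..<k}"
      unfolding vnorm_eq by (rule L2_set_cong) (auto simp: v_def)
    also have "\<dots> = 1" unfolding L2_set_scale using s by (simp add: s_def)
    finally have "vnorm (K *\<^sub>v v) \<le> op_norm K" using upper[OF v] by simp
    also have "vnorm (K *\<^sub>v v) = L2_set (\<lambda>i. 1 / s * (\<Sum>j<k. K $$ (i, j) * x j)) {..<m}"
      unfolding vnorm_mult_mat_vec[OF K v] sum_distrib_left
      by (rule L2_set_cong) (auto simp: v_def intro!: sum.cong)
    also have "\<dots> = L2_set (\<lambda>i. \<Sum>j<k. K $$ (i, j) * x j) {..<m} / s"
      unfolding L2_set_scale using s by simp
    finally show ?thesis using s by (simp add: pos_divide_le_eq s_def)
  qed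
  with pos show ?thesis by (simp add: op_bound_def)
qed

lemma op_bound_ix_left: "d \<ge> 1 \<Longrightarrow> op_bound {..<n * d} J K c \<Longrightarrow> op_bound ({..<n} \<times> {..<d}) J (\<lambda>r. K (ix d r)) c"
  unfolding op_bound_def by (simp add: L2_set_ix)

text \<open>Columns are reindexed as rows of the transpose.\<close>

lemma op_bound_ix:
  assumes "d \<ge> 1" "op_bound {..<n * d} {..<n * d} K c"
  shows "op_bound ({..<n} \<times> {..<d}) ({..<n} \<times> {..<d}) (\<lambda>r s. K (ix d r) (ix d s)) c"
  using op_bound_transpose[OF op_bound_ix_left[OF assms(1) op_bound_transpose[OF op_bound_ix_left[OF assms]]]] .

lemma frob_inner_eq:
  assumes "P \<in> carrier_mat m k" "Q \<in> carrier_mat m k"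
  shows "frob_inner P Q = (\<Sum>i<m. \<Sum>j<k. P $$ (i, j) * Q $$ (i, j))"
  using assms by (auto simp: frob_inner_def mtrace_def scalar_prod_def atLeast0LessThan intro!: sum.cong)

text \<open>The identity block makes the columns of B independent and puts each of them among the
  columns of B B^T. Conversely the columns of B B^T are combinations of those of B, so the spans
  agree.\<close>

lemma rank_gram_block:
  fixes B :: "real mat"
  assumes B: "B \<in> carrier_mat m d" and off: "i0 + d \<le> m"
    and id: "\<And>a b. a < d \<Longrightarrow> b < d \<Longrightarrow> B $$ (i0 + a, b) = (if a = b then 1 else 0)"
  shows "vec_space.rank m (B * transpose_mat B) = d"
proof -
  interpret vec_space "TYPE(real)" m .
  let ?X = "B * transpose_mat B"
  have Bv: "(B *\<^sub>v v) $ (i0 + a) = v $ a" if "v \<in> carrier_vec d" "a < d" for v a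
  proof -
    have "(B *\<^sub>v v) $ (i0 + a) = (\<Sum>b<d. (if b = a then 1 else 0) * v $ b)"
      using that B off id by (auto simp: scalar_prod_def atLeast0LessThan intro!: sum.cong)
    then show ?thesis using that by (simp add: sum_indicator_mult)
  qed
  have dist: "distinct (cols B)"
    unfolding distinct_conv_nth
  proof (intro allI impI)
    fix b c assume bc: "b < length (cols B)" "c < length (cols B)" "b \<noteq> c"
    then have "col B b $ (i0 + b) \<noteq> col B c $ (i0 + b)"
      using B off id[of b b] id[of b c] by auto
    then show "cols B ! b \<noteq> cols B ! c" using bc by auto
  qed
  have indep: "lin_indpt (set (cols B))"
  proof
    assume "lin_dep (set (cols B))"
    then obtain v where v: "v \<in> carrier_vec d" "v \<noteq> 0\<^sub>v d" "B *\<^sub>v v = 0\<^sub>v m"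
      using lin_depE[OF B _ dist] by blast
    have "v $ a = 0" if "a < d" for a
      using Bv[OF v(1) that] v(3) off that by simp
    then have "v = 0\<^sub>v d" using v(1) by (intro eq_vecI) auto
    with v(2) show False by simp
  qed
  have colX: "col ?X j = B *\<^sub>v row B j" if "j < m" for j
    using col_mult2[OF B _ that, of "transpose_mat B"] that B by simp
  have cB: "set (cols B) \<subseteq> carrier_vec m" and cX: "set (cols ?X) \<subseteq> carrier_vec m"
    using B cols_dim[of B] cols_dim[of ?X] by auto
  have "set (cols ?X) \<subseteq> span (set (cols B))"
  proof
    fix v assume "v \<in> set (cols ?X)"
    then obtain j where j: "j < m" "v = col ?X j" using B by (auto simp: cols_def)
    have "row B j \<in> carrier_vec d" using B j by simp
    then have "v = lincomb (\<lambda>a. row B j $ find_first a (cols B)) (set (cols B))"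
      using lincomb_eq_mat_mult[OF B _ dist] colX j by simp
    then show "v \<in> span (set (cols B))" unfolding span_def by auto
  qed
  moreover have "set (cols B) \<subseteq> span (set (cols ?X))"
  proof
    fix v assume "v \<in> set (cols B)"
    then obtain b where b: "b < d" "v = col B b" using B by (auto simp: cols_def)
    have "row B (i0 + b) = unit_vec d b"
      using B off b id by (intro eq_vecI) auto
    then have "col ?X (i0 + b) = B *\<^sub>v unit_vec d b" using colX[of "i0 + b"] off b by simp
    also have "\<dots> = v" using B b by (intro eq_vecI) auto
    finally have "v = col ?X (i0 + b)" by simp
    moreover have "i0 + b < dim_col ?X" using B off b by simp
    ultimately have "v \<in> set (cols ?X)" unfolding cols_def set_map by auto
    then show "v \<in> span (set (cols ?X))" using in_own_span[OF cX] by auto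
  qed
  ultimately have "span (set (cols ?X)) = span (set (cols B))"
    using cB cX span_subsetI by (metis subset_antisym)
  then have "rank ?X = rank B" by (simp add: rank_def)
  also have "\<dots> = d" by (rule lin_indpt_full_rank[OF B dist indep])
  finally show ?thesis .
qed

section \<open>Translation between matrices and functions on index pairs\<close>

locale sync_mat =
  fixes n d p :: nat and \<Delta> :: "real mat"
  assumes n1: "n \<ge> 1" and d1: "d \<ge> 1" and p1: "p \<ge> 2 * d + 1"
    and \<Delta>_carrier: "\<Delta> \<in> carrier_mat (n * d) (n * d)"
    and \<Delta>_sym: "transpose_mat \<Delta> = \<Delta>"
    and \<Delta>_diag: "\<forall>i<n. blk d \<Delta> i i = 0\<^sub>m d d"
begin

sublocale sync n d p "\<lambda>r s. \<Delta> $$ (ix d r, ix d s)"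
proof
  show "n \<ge> 1" "d \<ge> 1" "p \<ge> 2 * d + 1" by (rule n1 d1 p1)+
  fix i a j b assume *: "i < n" "a < d" "j < n" "b < d"
  have "transpose_mat \<Delta> $$ (ix d (i, a), ix d (j, b)) = \<Delta> $$ (ix d (j, b), ix d (i, a))"
    using * \<Delta>_carrier by (auto simp: ix_def ix_less)
  then show "\<Delta> $$ (ix d (i, a), ix d (j, b)) = \<Delta> $$ (ix d (j, b), ix d (i, a))"
    by (simp add: \<Delta>_sym)
next
  fix i a b assume *: "i < n" "a < d" "b < d"
  then have "blk d \<Delta> i i $$ (a, b) = 0" using \<Delta>_diag by simp
  then show "\<Delta> $$ (ix d (i, a), ix d (i, b)) = 0" using * by (simp add: blk_def ix_def)
qed

abbreviation Amat :: "real mat" where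
  "Amat \<equiv> Zmat n d * transpose_mat (Zmat n d) + \<Delta>"

definition rows_of :: "real mat \<Rightarrow> nat \<times> nat \<Rightarrow> nat \<Rightarrow> real" where
  "rows_of S r l = S $$ (ix d r, l)"

definition mat_of :: "(nat \<times> nat \<Rightarrow> nat \<Rightarrow> real) \<Rightarrow> real mat" where
  "mat_of S = mat (n * d) p (\<lambda>(r, l). S (r div d, r mod d) l)"

lemma ix_I: "r \<in> I \<Longrightarrow> ix d r < n * d"
  by (auto simp: ix_def ix_less)

lemma ix_div_mod: "r \<in> I \<Longrightarrow> (ix d r div d, ix d r mod d) = r"
  by (auto simp: ix_def)

lemma mat_of_carrier: "mat_of S \<in> carrier_mat (n * d) p"
  by (simp add: mat_of_def)

lemma rows_of_mat_of: "r \<in> I \<Longrightarrow> l < p \<Longrightarrow> rows_of (mat_of S) r l = S r l"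
  using ix_I[of r] ix_div_mod[of r] by (simp add: rows_of_def mat_of_def)

lemma inn_rows_of_mat_of: "r \<in> I \<Longrightarrow> s \<in> I \<Longrightarrow> inn (rows_of (mat_of S) r) (rows_of (mat_of S) s) = inn (S r) (S s)"
  unfolding ip_def by (intro sum.cong refl) (simp add: rows_of_mat_of)

lemma Amat_carrier: "Amat \<in> carrier_mat (n * d) (n * d)"
  using \<Delta>_carrier by (simp add: Zmat_def)

lemma Amat_entry:
  assumes "r \<in> I" "s \<in> I"
  shows "Amat $$ (ix d r, ix d s) = A r s"
proof -
  have m: "ix d r mod d = snd r" "ix d s mod d = snd s" using assms by (auto simp: ix_def)
  have "(Zmat n d * transpose_mat (Zmat n d)) $$ (ix d r, ix d s)
    = (\<Sum>c<d. (if ix d r mod d = c then 1 else 0) * (if ix d s mod d = c then 1 else 0))"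
    using ix_I[OF assms(1)] ix_I[OF assms(2)]
    by (simp add: Zmat_def scalar_prod_def atLeast0LessThan)
  also have "\<dots> = (\<Sum>c<d. (if c = snd r then 1 else 0) * (if snd s = c then 1 else 0))"
    unfolding m by (intro sum.cong) auto
  also have "\<dots> = (if snd r = snd s then 1 else 0)"
    using assms by (subst sum_indicator_mult) auto
  finally show ?thesis
    using ix_I[OF assms(1)] ix_I[OF assms(2)] \<Delta>_carrier by (simp add: A_def Zmat_def)
qed

lemma frob_inner_Amat:
  assumes "Y \<in> carrier_mat (n * d) (n * d)"
  shows "frob_inner Amat Y = (\<Sum>r\<in>I. \<Sum>s\<in>I. A r s * Y $$ (ix d r, ix d s))"
  unfolding frob_inner_eq[OF Amat_carrier assms] sum_ix[OF d1]
  by (intro sum.cong refl) (simp add: Amat_entry)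

lemma gram_entry:
  assumes "S \<in> carrier_mat (n * d) p" "r \<in> I" "s \<in> I"
  shows "(S * transpose_mat S) $$ (ix d r, ix d s) = inn (rows_of S r) (rows_of S s)"
  using assms(1) ix_I[OF assms(2)] ix_I[OF assms(3)]
  by (simp add: ip_def rows_of_def scalar_prod_def atLeast0LessThan)

lemma BM_obj_eq: "S \<in> carrier_mat (n * d) p \<Longrightarrow> BM_obj Amat S = obj (rows_of S)"
  unfolding BM_obj_def obj_def by (subst frob_inner_Amat) (auto simp: gram_entry cong: sum.cong)

lemma BM_set_iff: "S \<in> BM_set n d p \<longleftrightarrow> S \<in> carrier_mat (n * d) p \<and> feas (rows_of S)"
proof (cases "S \<in> carrier_mat (n * d) p")
  case True
  have entry: "(rowblk d S i * transpose_mat (rowblk d S i)) $$ (a, b) = inn (rows_of S (i, a)) (rows_of S (i, b))"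
    if "i < n" "a < d" "b < d" for i a b
    using that True by (simp add: rowblk_def ip_def rows_of_def ix_def scalar_prod_def atLeast0LessThan)
  have "rowblk d S i * transpose_mat (rowblk d S i) = 1\<^sub>m d \<longleftrightarrow>
      (\<forall>a<d. \<forall>b<d. inn (rows_of S (i, a)) (rows_of S (i, b)) = (if a = b then 1 else 0))" if i: "i < n" for i
  proof
    assume *: "rowblk d S i * transpose_mat (rowblk d S i) = 1\<^sub>m d"
    show "\<forall>a<d. \<forall>b<d. inn (rows_of S (i, a)) (rows_of S (i, b)) = (if a = b then 1 else 0)"
      using entry[OF i] unfolding * by auto
  next
    assume *: "\<forall>a<d. \<forall>b<d. inn (rows_of S (i, a)) (rows_of S (i, b)) = (if a = b then 1 else 0)"
    show "rowblk d S i * transpose_mat (rowblk d S i) = 1\<^sub>m d"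
      by (rule eq_matI) (use entry[OF i] * in \<open>auto simp: rowblk_def\<close>)
  qed
  then show ?thesis using True unfolding BM_set_def feas_def by auto
qed (simp add: BM_set_def)

lemma frob_norm_diff:
  assumes "S \<in> carrier_mat (n * d) p" "S' \<in> carrier_mat (n * d) p"
  shows "frob_norm (S' - S) = sqrt (\<Sum>r\<in>I. \<Sum>l<p. (rows_of S' r l - rows_of S r l)\<^sup>2)"
proof -
  have c: "S' - S \<in> carrier_mat (n * d) p" using assms(1) by (rule minus_carrier_mat)
  show ?thesis
    unfolding frob_norm_def frob_inner_eq[OF c c] sum_ix[OF d1]
    using assms ix_I by (intro arg_cong[of _ _ sqrt] sum.cong refl) (auto simp: rows_of_def power2_eq_square)
qed

text \<open>A competing function becomes a matrix by keeping only its relevant entries, which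
  preserves feasibility, objective and distance. The radius is squared because \<open>locmax\<close>
  measures squared distance.\<close>

lemma locmax_rows_of:
  assumes "BM_local_max n d p Amat S"
  shows "locmax (rows_of S)"
proof -
  obtain \<epsilon> where S: "S \<in> BM_set n d p" and \<epsilon>: "\<epsilon> > 0"
    and max: "\<And>S'. S' \<in> BM_set n d p \<Longrightarrow> frob_norm (S' - S) < \<epsilon> \<Longrightarrow> BM_obj Amat S' \<le> BM_obj Amat S"
    using assms unfolding BM_local_max_def by blast
  have c: "S \<in> carrier_mat (n * d) p" and f: "feas (rows_of S)" using S by (auto simp: BM_set_iff)
  show ?thesis unfolding locmax_def
  proof (intro conjI f exI[of _ "\<epsilon>\<^sup>2"] allI impI)
    show "\<epsilon>\<^sup>2 > 0" using \<epsilon> by simp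
    fix S' assume f': "feas S'" and close: "(\<Sum>r\<in>I. \<Sum>l<p. (S' r l - rows_of S r l)\<^sup>2) < \<epsilon>\<^sup>2"
    have "feas (rows_of (mat_of S'))"
      using f' unfolding feas_def by (auto simp: inn_rows_of_mat_of)
    then have 1: "mat_of S' \<in> BM_set n d p" by (simp add: BM_set_iff mat_of_carrier)
    have "(\<Sum>r\<in>I. \<Sum>l<p. (rows_of (mat_of S') r l - rows_of S r l)\<^sup>2) = (\<Sum>r\<in>I. \<Sum>l<p. (S' r l - rows_of S r l)\<^sup>2)"
      by (intro sum.cong refl) (simp add: rows_of_mat_of)
    then have "frob_norm (mat_of S' - S) < sqrt (\<epsilon>\<^sup>2)"
      unfolding frob_norm_diff[OF c mat_of_carrier] using close by (intro real_sqrt_less_mono) simp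
    then have "BM_obj Amat (mat_of S') \<le> BM_obj Amat S" using \<epsilon> by (intro max[OF 1]) simp
    moreover have "obj (rows_of (mat_of S')) = obj S'"
      unfolding obj_def by (intro sum.cong refl) (simp add: inn_rows_of_mat_of)
    ultimately show "obj S' \<le> obj (rows_of S)"
      by (simp add: BM_obj_eq c mat_of_carrier)
  qed
qed

lemma exists_global_max: "\<exists>S. BM_global_max n d p Amat S"
proof -
  obtain S where f: "feas S" and max: "\<And>S'. feas S' \<Longrightarrow> obj S' \<le> obj S"
    using exists_maximizer by blast
  have "feas (rows_of (mat_of S))"
    using f unfolding feas_def by (auto simp: inn_rows_of_mat_of)
  moreover have "obj (rows_of (mat_of S)) = obj S"
    unfolding obj_def by (intro sum.cong refl) (simp add: inn_rows_of_mat_of)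
  ultimately have "BM_global_max n d p Amat (mat_of S)"
    unfolding BM_global_max_def using max by (auto simp: BM_set_iff mat_of_carrier BM_obj_eq)
  then show ?thesis by blast
qed

lemma BM_global_imp_local: "BM_global_max n d p Amat S \<Longrightarrow> BM_local_max n d p Amat S"
  unfolding BM_global_max_def BM_local_max_def by (auto intro: exI[of _ 1])

lemma SDP_pairing:
  assumes Y: "Y \<in> SDP_set n d" and psd: "\<And>x. 0 \<le> ip I x (mv I (M S) x)"
  shows "frob_inner Amat Y \<le> obj S"
proof -
  have c: "Y \<in> carrier_mat (n * d) (n * d)" and sym: "transpose_mat Y = Y"
    and pos: "\<And>x. x \<in> carrier_vec (n * d) \<Longrightarrow> 0 \<le> x \<bullet> (Y *\<^sub>v x)"
    and blk: "\<And>i. i < n \<Longrightarrow> blk d Y i i = 1\<^sub>m d"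
    using Y unfolding SDP_set_def psd_def by auto
  show ?thesis unfolding frob_inner_Amat[OF c]
  proof (rule dual_bound[OF psd])
    fix r s assume "r \<in> I" "s \<in> I"
    then have "transpose_mat Y $$ (ix d r, ix d s) = Y $$ (ix d s, ix d r)"
      using ix_I[of r] ix_I[of s] c by auto
    then show "Y $$ (ix d r, ix d s) = Y $$ (ix d s, ix d r)" by (simp add: sym)
  next
    fix x :: "nat \<times> nat \<Rightarrow> real"
    define v where "v = vec (n * d) (\<lambda>r. x (r div d, r mod d))"
    have vx: "v $ ix d r = x r" if "r \<in> I" for r
      using ix_I[OF that] ix_div_mod[OF that] by (simp add: v_def)
    have "v \<bullet> (Y *\<^sub>v v) = (\<Sum>r<n * d. v $ r * (\<Sum>s<n * d. Y $$ (r, s) * v $ s))"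
      using c by (simp add: scalar_prod_def atLeast0LessThan v_def)
    also have "\<dots> = ip I x (mv I (\<lambda>r s. Y $$ (ix d r, ix d s)) x)"
      unfolding sum_ix[OF d1] ip_def mv_def by (intro sum.cong refl arg_cong2[of _ _ _ _ "(*)"]) (simp_all add: vx)
    finally show "0 \<le> ip I x (mv I (\<lambda>r s. Y $$ (ix d r, ix d s)) x)"
      using pos[of v] by (simp add: v_def)
  next
    fix i a b assume *: "i < n" "a < d" "b < d"
    then have "blk d Y i i $$ (a, b) = (if a = b then 1 else 0)" using blk by simp
    then show "Y $$ (ix d (i, a), ix d (i, b)) = (if a = b then 1 else 0)"
      using * by (simp add: blk_def ix_def)
  qed
qed

lemma gram_SDP_set:
  assumes "S \<in> BM_set n d p"
  shows "S * transpose_mat S \<in> SDP_set n d"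
proof -
  have c: "S \<in> carrier_mat (n * d) p" and f: "feas (rows_of S)" using assms by (auto simp: BM_set_iff)
  have "0 \<le> x \<bullet> (S * transpose_mat S *\<^sub>v x)" if x: "x \<in> carrier_vec (n * d)" for x
  proof -
    have "x \<bullet> (S * transpose_mat S *\<^sub>v x) = x \<bullet> (S *\<^sub>v (transpose_mat S *\<^sub>v x))"
      using c x by (simp add: assoc_mult_mat_vec[of S "n * d" p])
    also have "\<dots> = (transpose_mat S *\<^sub>v x) \<bullet> (transpose_mat S *\<^sub>v x)"
      using c x by (subst transpose_vec_mult_scalar[of S "n * d" p]) auto
    also have "0 \<le> \<dots>" by (simp add: scalar_prod_def sum_nonneg)
    finally show ?thesis .
  qed
  moreover have "transpose_mat (S * transpose_mat S) = S * transpose_mat S"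
    using c by (subst transpose_mult[of _ "n * d" p]) auto
  moreover have "blk d (S * transpose_mat S) i i = 1\<^sub>m d" if "i < n" for i
  proof (rule eq_matI)
    fix a b assume "a < dim_row (1\<^sub>m d :: real mat)" "b < dim_col (1\<^sub>m d :: real mat)"
    then show "blk d (S * transpose_mat S) i i $$ (a, b) = 1\<^sub>m d $$ (a, b)"
      using gram_entry[OF c, of "(i, a)" "(i, b)"] that f by (auto simp: blk_def ix_def feas_inn)
  qed (auto simp: blk_def)
  ultimately show ?thesis using c by (auto simp: SDP_set_def psd_def)
qed

lemma op_norm_D: "op_bound I I (\<lambda>r s. \<Delta> $$ (ix d r, ix d s)) (op_norm \<Delta>)"
  by (rule op_bound_ix[OF d1 op_bound_op_norm[OF \<Delta>_carrier]])

lemma op_norm_T: "op_bound {..<n} {..<n} T (op_norm (partial_trace n d \<Delta>))"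
proof -
  have "op_bound {..<n} {..<n} (\<lambda>i j. partial_trace n d \<Delta> $$ (i, j)) (op_norm (partial_trace n d \<Delta>))"
    by (rule op_bound_op_norm) (simp add: partial_trace_def)
  moreover have "partial_trace n d \<Delta> $$ (i, j) = T i j" if "i < n" "j < n" for i j
    using that unfolding T_def by (simp add: partial_trace_def mtrace_def blk_def ix_def)
  ultimately show ?thesis unfolding op_bound_def by (simp cong: L2_set_cong_simp)
qed

text \<open>\<open>rowblk\<close> is the block row \<Delta>_i^T, so its transpose is the nd by d
  matrix \<Delta>_i that acts on x.\<close>

lemma op_norm_row:
  assumes "i < n"
  shows "op_bound I {..<d} (\<lambda>s a. \<Delta> $$ (ix d (i, a), ix d s)) (op_norm (transpose_mat (rowblk d \<Delta> i)))"
proof -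
  let ?K = "transpose_mat (rowblk d \<Delta> i)"
  have "op_bound {..<n * d} {..<d} (\<lambda>s a. ?K $$ (s, a)) (op_norm ?K)"
    using \<Delta>_carrier by (intro op_bound_op_norm) (auto simp: rowblk_def)
  from op_bound_ix_left[OF d1 this]
  have "op_bound I {..<d} (\<lambda>s a. ?K $$ (ix d s, a)) (op_norm ?K)" .
  moreover have "?K $$ (ix d s, a) = \<Delta> $$ (ix d (i, a), ix d s)" if "s \<in> I" "a < d" for s a
    using that ix_I[of s] \<Delta>_carrier by (simp add: rowblk_def ix_def)
  ultimately show ?thesis unfolding op_bound_def by (simp cong: L2_set_cong_simp)
qed

lemma op_norm_row_Z:
  assumes "i < n"
  shows "op_bound {..<d} {..<d} (\<lambda>b a. \<Sum>j<n. \<Delta> $$ (ix d (i, a), ix d (j, b))) (op_norm (rowblk d \<Delta> i * Zmat n d))"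
proof -
  let ?K = "rowblk d \<Delta> i * Zmat n d"
  have "op_bound {..<d} {..<d} (\<lambda>a b. ?K $$ (a, b)) (op_norm ?K)"
    by (intro op_bound_op_norm) (auto simp: rowblk_def Zmat_def)
  from op_bound_transpose[OF this]
  have "op_bound {..<d} {..<d} (\<lambda>b a. ?K $$ (a, b)) (op_norm ?K)" .
  moreover have "?K $$ (a, b) = (\<Sum>j<n. \<Delta> $$ (ix d (i, a), ix d (j, b)))" if "a < d" "b < d" for a b
  proof -
    have "?K $$ (a, b) = (\<Sum>s<n * d. \<Delta> $$ (i * d + a, s) * (if s mod d = b then 1 else 0))"
      using that \<Delta>_carrier by (simp add: rowblk_def Zmat_def scalar_prod_def atLeast0LessThan)
    also have "\<dots> = (\<Sum>j<n. \<Sum>c<d. (if c = b then 1 else 0) * \<Delta> $$ (i * d + a, j * d + c))"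
      unfolding sum_ix[OF d1] sum_I by (intro sum.cong refl) (auto simp: ix_def)
    also have "\<dots> = (\<Sum>j<n. \<Delta> $$ (ix d (i, a), ix d (j, b)))"
      using that by (simp add: sum_indicator_mult ix_def)
    finally show ?thesis .
  qed
  ultimately show ?thesis unfolding op_bound_def by (simp cong: L2_set_cong_simp)
qed

end

theorem theorem3:
  fixes n d p :: nat and \<Delta> :: "real mat"
  assumes "n \<ge> 1" and "d \<ge> 1" and "p \<ge> 2 * d + 1"
    and "\<Delta> \<in> carrier_mat (n * d) (n * d)"
    and "transpose_mat \<Delta> = \<Delta>"
    and "\<forall>i<n. blk d \<Delta> i i = 0\<^sub>m d d"
  defines "Z \<equiv> Zmat n d"
  defines "A \<equiv> Z * transpose_mat Z + \<Delta>"
    and "\<gamma> \<equiv> max (op_norm (partial_trace n d \<Delta>) / op_norm \<Delta>) 1"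
  defines "\<delta> \<equiv> (2 + sqrt 5) * (real p + real d) * \<gamma> / (real p - 2 * real d)"
  assumes "real n \<ge> 3 * \<delta>\<^sup>2 * real d * (op_norm \<Delta>)\<^sup>2 / (2 * real n)
      + \<delta> * sqrt (real d / real n) * op_norm \<Delta> * Max ((\<lambda>i. op_norm (transpose_mat (rowblk d \<Delta> i))) ` {..<n})
      + Max ((\<lambda>i. op_norm (rowblk d \<Delta> i * Z)) ` {..<n})
      + op_norm \<Delta>"
  shows "\<exists>X0. (\<exists>S. BM_local_max n d p A S)
      \<and> (\<forall>S. BM_local_max n d p A S \<longrightarrow> S * transpose_mat S = X0 \<and> BM_global_max n d p A S)
      \<and> SDP_max n d A X0
      \<and> mrank X0 = d"
proof -
  interpret sm: sync_mat n d p \<Delta> by unfold_locales (fact assms(1-6))+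
  have A: "A = sm.Amat" by (simp add: A_def Z_def)
  let ?mu = "Max ((\<lambda>i. op_norm (transpose_mat (rowblk d \<Delta> i))) ` {..<n})"
  let ?ze = "Max ((\<lambda>i. op_norm (rowblk d \<Delta> i * Zmat n d)) ` {..<n})"
  have cert: "\<exists>k<n. \<exists>c>0. \<forall>y. \<exists>\<xi>. c * (\<Sum>r\<in>sm.I. (y r - (\<Sum>b<d. sm.F S k r b * \<xi> b))\<^sup>2)
      \<le> ip sm.I y (mv sm.I (sm.M S) y)" if "sm.locmax S" for S
  proof (rule sm.strict_certificate[OF that sm.op_norm_D sm.op_norm_T, where \<gamma> = \<gamma> and \<mu> = ?mu and \<zeta> = ?ze and \<delta> = \<delta>])
    show "\<gamma> \<ge> 1" by (simp add: \<gamma>_def)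
    \<comment> \<open>Claimed only for nonzero norm: otherwise the quotient is 0 by convention and
      \<open>\<gamma>\<close> is 1.\<close>
    show "op_norm (partial_trace n d \<Delta>) \<le> \<gamma> * op_norm \<Delta>" if "op_norm \<Delta> > 0"
      using that unfolding \<gamma>_def by (simp add: pos_divide_le_eq[symmetric])
    show "op_bound sm.I {..<d} (\<lambda>s a. \<Delta> $$ (ix d (i, a), ix d s)) ?mu" if "i < n" for i
      by (rule op_bound_mono[OF sm.op_norm_row[OF that]]) (use that in \<open>auto intro: Max_ge\<close>)
    show "op_bound {..<d} {..<d} (\<lambda>b a. \<Sum>j<n. \<Delta> $$ (ix d (i, a), ix d (j, b))) ?ze" if "i < n" for i
      by (rule op_bound_mono[OF sm.op_norm_row_Z[OF that]]) (use that in \<open>auto intro: Max_ge\<close>)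
    show "\<delta> = (2 + sqrt 5) * (real p + real d) * \<gamma> / (real p - 2 * real d)" by (simp add: \<delta>_def)
    show "3 * \<delta>\<^sup>2 * real d * (op_norm \<Delta>)\<^sup>2 / (2 * real n) + \<delta> * sqrt (real d / real n) * op_norm \<Delta> * ?mu
       + ?ze + op_norm \<Delta> \<le> real n" using assms(11) by (simp add: Z_def)
  qed
  have psd: "0 \<le> ip sm.I y (mv sm.I (sm.M S) y)" if loc: "sm.locmax S" for S y
  proof -
    obtain k c \<xi> where c: "c > 0" and "c * (\<Sum>r\<in>sm.I. (y r - (\<Sum>b<d. sm.F S k r b * \<xi> b))\<^sup>2)
      \<le> ip sm.I y (mv sm.I (sm.M S) y)" using cert[OF loc] by blast
    moreover have "0 \<le> c * (\<Sum>r\<in>sm.I. (y r - (\<Sum>b<d. sm.F S k r b * \<xi> b))\<^sup>2)"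
      using c by (intro mult_nonneg_nonneg sum_nonneg) auto
    ultimately show ?thesis by linarith
  qed
  have global: "BM_global_max n d p A S" if "BM_local_max n d p A S" for S
  proof -
    have loc: "sm.locmax (sm.rows_of S)" using sm.locmax_rows_of that unfolding A by blast
    have S: "S \<in> BM_set n d p" using that by (simp add: BM_local_max_def)
    then show ?thesis
      using sm.global_max[OF psd[OF loc]] unfolding BM_global_max_def A
      by (auto simp: sm.BM_set_iff sm.BM_obj_eq)
  qed
  obtain S0 where glob0: "BM_global_max n d p A S0" using sm.exists_global_max unfolding A by blast
  then have loc0: "BM_local_max n d p A S0" using sm.BM_global_imp_local unfolding A by blast
  have lm0: "sm.locmax (sm.rows_of S0)" using sm.locmax_rows_of loc0 unfolding A by blast
  have S0: "S0 \<in> BM_set n d p" and c0: "S0 \<in> carrier_mat (n * d) p" and f0: "sm.feas (sm.rows_of S0)"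
    using loc0 by (auto simp: BM_local_max_def sm.BM_set_iff)
  obtain k c where k: "k < n" and c: "c > 0"
    and ck: "\<And>y. \<exists>\<xi>. c * (\<Sum>r\<in>sm.I. (y r - (\<Sum>b<d. sm.F (sm.rows_of S0) k r b * \<xi> b))\<^sup>2)
      \<le> ip sm.I y (mv sm.I (sm.M (sm.rows_of S0)) y)" using cert[OF lm0] by blast
  \<comment> \<open>The matrix F of one fixed maximizer \<open>S0\<close>; it serves as the common
    Gram factor of all local maximizers.\<close>
  define B where "B = mat (n * d) d (\<lambda>(r, b). sm.F (sm.rows_of S0) k (r div d, r mod d) b)"
  have B: "B \<in> carrier_mat (n * d) d" by (simp add: B_def)
  have Bix: "B $$ (ix d r, b) = sm.F (sm.rows_of S0) k r b" if "r \<in> sm.I" "b < d" for r b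
    using that sm.ix_I[OF that(1)] sm.ix_div_mod[OF that(1)] by (simp add: B_def)
  have gram: "S * transpose_mat S = B * transpose_mat B" if loc: "BM_local_max n d p A S" for S
  proof -
    have S: "S \<in> BM_set n d p" and cS: "S \<in> carrier_mat (n * d) p" and fS: "sm.feas (sm.rows_of S)"
      using loc by (auto simp: BM_local_max_def sm.BM_set_iff)
    \<comment> \<open>Every local maximizer is global by its own certificate, so it ties with
      \<open>S0\<close> and the certificate of \<open>S0\<close> applies to it.\<close>
    have "BM_obj A S0 \<le> BM_obj A S"
      using global[OF loc] S0 by (simp add: BM_global_max_def)
    then have obj: "sm.obj (sm.rows_of S0) \<le> sm.obj (sm.rows_of S)"
      unfolding A by (simp add: sm.BM_obj_eq c0 cS)
    have gr: "sm.inn (sm.rows_of S r) (sm.rows_of S s) = (\<Sum>b<d. sm.F (sm.rows_of S0) k r b * sm.F (sm.rows_of S0) k s b)"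
      if "r \<in> sm.I" "s \<in> sm.I" for r s
      by (rule sm.maximizer_gram[OF k fS sm.maximizer_factor[OF f0 k c ck fS obj] that])
    have dm: "i = ix d (i div d, i mod d)" "(i div d, i mod d) \<in> sm.I" if "i < n * d" for i
      using that assms(2) by (auto simp: ix_def less_mult_imp_div_less)
    show ?thesis
    proof (rule eq_matI)
      fix i j assume "i < dim_row (B * transpose_mat B)" "j < dim_col (B * transpose_mat B)"
      then have ij: "i < n * d" "j < n * d" using B by auto
      define r s where "r = (i div d, i mod d)" and "s = (j div d, j mod d)"
      have r: "i = ix d r" "r \<in> sm.I" and s: "j = ix d s" "s \<in> sm.I"
        using dm[OF ij(1)] dm[OF ij(2)] unfolding r_def s_def by blast+
      have "(B * transpose_mat B) $$ (i, j) = (\<Sum>b<d. B $$ (i, b) * B $$ (j, b))"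
        using ij B by (simp add: scalar_prod_def atLeast0LessThan)
      also have "\<dots> = (\<Sum>b<d. sm.F (sm.rows_of S0) k r b * sm.F (sm.rows_of S0) k s b)"
        unfolding r(1) s(1) by (intro sum.cong refl) (simp add: Bix r s)
      finally show "(S * transpose_mat S) $$ (i, j) = (B * transpose_mat B) $$ (i, j)"
        using sm.gram_entry[OF cS r(2) s(2)] gr[OF r(2) s(2)] by (simp add: r(1) s(1))
    qed (use cS B in auto)
  qed
  have "SDP_max n d A (S0 * transpose_mat S0)"
    unfolding SDP_max_def
  proof (intro conjI ballI)
    show "S0 * transpose_mat S0 \<in> SDP_set n d" by (rule sm.gram_SDP_set[OF S0])
    fix Y assume "Y \<in> SDP_set n d"
    then have "frob_inner A Y \<le> sm.obj (sm.rows_of S0)"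
      unfolding A by (rule sm.SDP_pairing) (rule psd[OF lm0])
    also have "\<dots> = frob_inner A (S0 * transpose_mat S0)"
      using sm.BM_obj_eq[OF c0] unfolding A BM_obj_def by simp
    finally show "frob_inner A Y \<le> frob_inner A (S0 * transpose_mat S0)" .
  qed
  moreover have "mrank (B * transpose_mat B) = d"
  proof -
    have "vec_space.rank (n * d) (B * transpose_mat B) = d"
    proof (rule rank_gram_block[OF B, of "k * d"])
      have "Suc k * d \<le> n * d" using k by (intro mult_le_mono1) simp
      then show "k * d + d \<le> n * d" by simp
      fix a b assume ab: "a < d" "b < d"
      then show "B $$ (k * d + a, b) = (if a = b then 1 else 0)"
        using Bix[of "(k, a)" b] k f0 by (simp add: ix_def sm.F_def sm.feas_inn)
    qed
    then show ?thesis using B by (simp add: mrank_def)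
  qed
  ultimately show ?thesis
    using gram global loc0 by (intro exI[of _ "B * transpose_mat B"]) auto
qed

end
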